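(* The map $\Phi^+:\mathcal Y_2^+\to Y(\mathfrak{sp}_2,\mathfrak{gl}_1)^{tw}$ given by $$k\mapsto-\tfrac12\mathsf k^{(0)},\qquad F\mapsto-\tfrac18\mathsf e^{(1)},\qquad E\mapsto\tfrac18\mathsf f^{(1)}$$ is an algebra isomorphism.
   Context: All algebras are unital associative over $\mathbb C$. The orthogonal twisted Yangian $\mathcal Y_2^+$ in Drinfeld's original presentation is generated by $k,E,F$ with relations $[k,E]=2E$, $[k,F]=-2F$, $[E,[E,[F,E]]]=12\,EkE$, $[F,[F,[F,E]]]=12\,FkF$. It is known to embed into $\mathcal Y_2$ via $k\mapsto h$, $E\mapsto J(e)-\frac14(eh+he)$, $F\mapsto J(f)+\frac14(fh+hf)$, where $\mathcal Y_2$ is the Yangian of $\mathfrak{sl}_2$ in Drinfeld's original presentation: generators $h,e,f,J(h),J(e),J(f)$, relations $[h,e]=2e$, $[h,f]=-2f$, $[e,f]=h$, $[h,J(e)]=[J(h),e]=2J(e)$, $[h,J(f)]=[J(h),f]=-2J(f)$, $[e,J(f)]=[J(e),f]=J(h)$, $[J(h),[J(e),J(f)]]=(J(f)e-fJ(e))h$. $Y(\mathfrak{sp}_2)$: $2\times2$ matrices are indexed by $\{-1,1\}$ (in this order), $P=\sum E_{ij}\otimes E_{ji}$, $(E_{ij})^t=\mathrm{sign}(i)\,\mathrm{sign}(j)E_{-j,-i}$, $Q$ is the partial transpose of $P$ under $t$, $R(u)=I-\frac Pu+\frac Q{u-2}$. $X(\mathfrak{sp}_2)$ is generated by the coefficients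 of $T(u)=I+O(u^{-1})$ with relation $R(u-v)T_1(u)T_2(v)=T_2(v)T_1(u)R(u-v)$; $T(u)T(u+2)^t=z(u)I$ with $z(u)$ having central coefficients, and $Y(\mathfrak{sp}_2)=X(\mathfrak{sp}_2)/(z(u)-1)$, with $\mathcal T(u)$ the image of $T(u)$. $Y(\mathfrak{sp}_2,\mathfrak{gl}_1)^{tw}\subset Y(\mathfrak{sp}_2)$ is the subalgebra generated by the coefficients of $\Sigma(u)=\mathcal T(u-1)\,\mathcal G\,\mathcal T(1-u)^t$ with $\mathcal G=\mathrm{diag}(1,-1)=E_{-1,-1}-E_{11}$. The series $\mathsf e(u),\mathsf f(u),\mathsf k_{\pm1}(u)$ are defined by the Gauss decomposition $$\Sigma(u)=\begin{pmatrix}1&0\\\mathsf f(u)&1\end{pmatrix}\begin{pmatrix}\mathsf k_{-1}(u)&0\\0&\mathsf k_1(u)\end{pmatrix}\begin{pmatrix}1&\mathsf e(u)\\0&1\end{pmatrix},$$ $\mathsf k(u)=\mathsf k_{-1}(u)$, and $\mathsf f(u)=\sum_{r\ge0}\mathsf f^{(r)}u^{-r-1}$, $\mathsf k(u)=1+\sum_{r\ge0}\mathsf k^{(r)}u^{-r-1}$, $\mathsf e(u)=\sum_{r\ge0}\mathsf e^{(r)}u^{-r-1}$. *)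

theory Defs
  imports
    "HOL-Analysis.Analysis"
    "HOL-Library.Poly_Mapping"
    "HOL-Computational_Algebra.Formal_Laurent_Series"
begin

unbundle no fps_syntax

section \<open>Unital associative complex algebras\<close>

class complex_algebra_1 = ring_1 +
  fixes scaleC :: "complex \<Rightarrow> 'a \<Rightarrow> 'a"  (infixr \<open>*\<^sub>C\<close> 75)
  assumes scaleC_add_right: "a *\<^sub>C (x + y) = a *\<^sub>C x + a *\<^sub>C y"
    and scaleC_add_left: "(a + b) *\<^sub>C x = a *\<^sub>C x + b *\<^sub>C x"
    and scaleC_scaleC: "a *\<^sub>C (b *\<^sub>C x) = (a * b) *\<^sub>C x"
    and scaleC_one: "1 *\<^sub>C x = x"
    and mult_scaleC_left: "(a *\<^sub>C x) * y = a *\<^sub>C (x * y)"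
    and mult_scaleC_right: "x * (a *\<^sub>C y) = a *\<^sub>C (x * y)"

lemma scaleC_zero [simp]: "c *\<^sub>C (0 :: 'a::complex_algebra_1) = 0"
  using scaleC_add_right[of c 0 "0::'a"] by simp

definition algebra_hom :: "('a::complex_algebra_1 \<Rightarrow> 'b::complex_algebra_1) \<Rightarrow> bool" where
  "algebra_hom \<phi> \<longleftrightarrow> \<phi> 1 = 1 \<and> (\<forall>x y. \<phi> (x + y) = \<phi> x + \<phi> y) \<and>
     (\<forall>x y. \<phi> (x * y) = \<phi> x * \<phi> y) \<and> (\<forall>c x. \<phi> (c *\<^sub>C x) = c *\<^sub>C \<phi> x)"

definition subalgebra :: "'a::complex_algebra_1 set \<Rightarrow> bool" where
  "subalgebra S \<longleftrightarrow> 1 \<in> S \<and> (\<forall>x\<in>S. \<forall>y\<in>S. x + y \<in> S \<and> x * y \<in> S) \<and> (\<forall>c. \<forall>x\<in>S. c *\<^sub>C x \<in> S)"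

text \<open>An isomorphism onto a subalgebra \<open>B\<close> of the codomain type.\<close>

definition algebra_iso_onto ::
  "'b set \<Rightarrow> ('a::complex_algebra_1 \<Rightarrow> 'b::complex_algebra_1) \<Rightarrow> bool" where
  "algebra_iso_onto B \<phi> \<longleftrightarrow> algebra_hom \<phi> \<and> bij_betw \<phi> UNIV B"

text \<open>In a unital algebra a two-sided ideal of the ring is closed under scalars as well.\<close>

definition two_sided_ideal :: "'a::ring_1 set \<Rightarrow> bool" where
  "two_sided_ideal I \<longleftrightarrow> 0 \<in> I \<and> (\<forall>x\<in>I. \<forall>y\<in>I. x + y \<in> I) \<and> (\<forall>a. \<forall>x\<in>I. a * x \<in> I \<and> x * a \<in> I)"

lemma two_sided_idealD:
  assumes "two_sided_ideal I"
  shows "0 \<in> I" "x \<in> I \<Longrightarrow> y \<in> I \<Longrightarrow> x + y \<in> I" "x \<in> I \<Longrightarrow> a * x \<in> I" "x \<in> I \<Longrightarrow> x * a \<in> I"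
    "x \<in> I \<Longrightarrow> - x \<in> I" "x \<in> I \<Longrightarrow> y \<in> I \<Longrightarrow> x - y \<in> I"
proof -
  show 1: "0 \<in> I" "x \<in> I \<Longrightarrow> y \<in> I \<Longrightarrow> x + y \<in> I" "x \<in> I \<Longrightarrow> a * x \<in> I" "x \<in> I \<Longrightarrow> x * a \<in> I" for x y a
    using assms by (auto simp: two_sided_ideal_def)
  show 2: "x \<in> I \<Longrightarrow> - x \<in> I" for x using 1(3)[of x "-1"] by simp
  show "x \<in> I \<Longrightarrow> y \<in> I \<Longrightarrow> x - y \<in> I" using 1(2)[of x "- y"] 2[of y] by simp
qed

lemma two_sided_ideal_sum:
  assumes "two_sided_ideal I" "\<And>i. i \<in> A \<Longrightarrow> f i \<in> I"
  shows "sum f A \<in> I"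
  using assms(2)
  by (induction A rule: infinite_finite_induct) (auto intro: two_sided_idealD[OF assms(1)])

lemma two_sided_ideal_hull: "two_sided_ideal (two_sided_ideal hull S)"
  by (rule hull_in) (auto simp: two_sided_ideal_def)

lemma two_sided_ideal_equivp:
  assumes I: "two_sided_ideal I"
  shows "equivp (\<lambda>x y. x - y \<in> I)"
proof (rule equivpI)
  show "reflp (\<lambda>x y. x - y \<in> I)" by (simp add: reflp_def two_sided_idealD(1)[OF I])
  show "symp (\<lambda>x y. x - y \<in> I)"
    unfolding symp_def using two_sided_idealD(5)[OF I] by (metis minus_diff_eq)
  show "transp (\<lambda>x y. x - y \<in> I)"
    unfolding transp_def using two_sided_idealD(2)[OF I] by (metis diff_add_cancel add_diff_eq)
qed

lemma two_sided_ideal_cong: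
  assumes I: "two_sided_ideal I" and "x - x' \<in> I" "y - y' \<in> I"
  shows "(x + y) - (x' + y') \<in> I" "(x - y) - (x' - y') \<in> I" "x * y - x' * y' \<in> I" "- x - - x' \<in> I"
proof -
  have "(x + y) - (x' + y') = (x - x') + (y - y')" "(x - y) - (x' - y') = (x - x') - (y - y')"
    "x * y - x' * y' = (x - x') * y + x' * (y - y')" "- x - - x' = - (x - x')"
    by (simp_all add: algebra_simps)
  then show "(x + y) - (x' + y') \<in> I" "(x - y) - (x' - y') \<in> I" "x * y - x' * y' \<in> I"
    "- x - - x' \<in> I"
    using two_sided_idealD[OF I] assms(2,3) by metis+
qed


section \<open>Free algebras and presentations\<close>

datatype 'g free_monoid = Word "'g list"

instantiation free_monoid :: (type) monoid_add
begin

definition "0 = Word []"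

fun plus_free_monoid where "Word xs + Word ys = Word (xs @ ys)"

instance
proof
  fix a b c :: "'a free_monoid"
  show "a + b + c = a + (b + c)" by (cases a; cases b; cases c) simp
  show "0 + a = a" "a + 0 = a" by (cases a; simp add: zero_free_monoid_def)+
qed

end

lemma free_monoid_plus_eq_0: "(a + b = (0 :: 'g free_monoid)) \<longleftrightarrow> a = 0 \<and> b = 0"
  by (cases a; cases b) (simp add: zero_free_monoid_def)

instantiation complex :: complex_algebra_1
begin
definition "scaleC_complex c (x::complex) = c * x"
instance by standard (simp_all add: scaleC_complex_def algebra_simps)
end

instantiation poly_mapping :: (monoid_add, complex_algebra_1) complex_algebra_1
begin

definition scaleC_poly_mapping :: "complex \<Rightarrow> ('a \<Rightarrow>\<^sub>0 'b) \<Rightarrow> ('a \<Rightarrow>\<^sub>0 'b)" where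
  "scaleC_poly_mapping c p = Poly_Mapping.map (\<lambda>x. c *\<^sub>C x) p"

lemma lookup_scaleC: "Poly_Mapping.lookup (c *\<^sub>C p) k = c *\<^sub>C Poly_Mapping.lookup p k"
  for p :: "'a \<Rightarrow>\<^sub>0 'b"
  by (simp add: scaleC_poly_mapping_def Poly_Mapping.map.rep_eq when_def)

lemma scaleC_single: "c *\<^sub>C Poly_Mapping.single k x = Poly_Mapping.single k (c *\<^sub>C x)"
  for x :: 'b and k :: 'a
  by (rule poly_mapping_eqI) (simp add: lookup_scaleC lookup_single when_def)

lemma scaleC_poly_mapping_conv_mult:
  "c *\<^sub>C p = Poly_Mapping.single 0 (c *\<^sub>C 1) * p" for p :: "'a \<Rightarrow>\<^sub>0 'b"
proof -
  have "(\<lambda>x::'b. c *\<^sub>C x) = (*) (c *\<^sub>C 1)"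
    by (simp add: fun_eq_iff mult_scaleC_left)
  then have "c *\<^sub>C p = Poly_Mapping.map ((*) (c *\<^sub>C 1)) p"
    unfolding scaleC_poly_mapping_def by (rule arg_cong)
  then show ?thesis
    unfolding mult_map_scale_conv_mult .
qed

instance
proof
  fix a b :: complex and x y :: "'a \<Rightarrow>\<^sub>0 'b"
  show "a *\<^sub>C (x + y) = a *\<^sub>C x + a *\<^sub>C y"
    by (rule poly_mapping_eqI) (simp add: lookup_scaleC lookup_add scaleC_add_right)
  show "(a + b) *\<^sub>C x = a *\<^sub>C x + b *\<^sub>C x"
    by (rule poly_mapping_eqI) (simp add: lookup_scaleC lookup_add scaleC_add_left)
  show "a *\<^sub>C b *\<^sub>C x = (a * b) *\<^sub>C x"
    by (rule poly_mapping_eqI) (simp add: lookup_scaleC scaleC_scaleC)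
  show "1 *\<^sub>C x = x"
    by (rule poly_mapping_eqI) (simp add: lookup_scaleC scaleC_one)
  show left: "a *\<^sub>C x * y = a *\<^sub>C (x * y)" for x y :: "'a \<Rightarrow>\<^sub>0 'b"
    unfolding scaleC_poly_mapping_conv_mult by (rule mult.assoc)
  have comm: "x * Poly_Mapping.single 0 (a *\<^sub>C 1) = a *\<^sub>C x"
  proof (rule poly_mapping_eqI)
    fix k :: 'a
    have 1: "Sum_any (\<lambda>q. Poly_Mapping.lookup (Poly_Mapping.single 0 (a *\<^sub>C (1::'b))) q when k = l + q)
        = (a *\<^sub>C 1 when l = k)" for l
    proof -
      have "Sum_any (\<lambda>q. Poly_Mapping.lookup (Poly_Mapping.single 0 (a *\<^sub>C (1::'b))) q when k = l + q)
          = Sum_any (\<lambda>q::'a. (a *\<^sub>C 1 when l = k) when q = 0)"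
        by (rule Sum_any.cong) (auto simp: lookup_single when_def)
      then show ?thesis by simp
    qed
    have "Poly_Mapping.lookup (x * Poly_Mapping.single 0 (a *\<^sub>C 1)) k = Poly_Mapping.lookup x k * (a *\<^sub>C 1)"
      unfolding lookup_mult by (simp only: 1 mult_when Sum_any_when_equal)
    then show "Poly_Mapping.lookup (x * Poly_Mapping.single 0 (a *\<^sub>C 1)) k = Poly_Mapping.lookup (a *\<^sub>C x) k"
      by (simp add: lookup_scaleC mult_scaleC_right)
  qed
  show "x * a *\<^sub>C y = a *\<^sub>C (x * y)"
    unfolding scaleC_poly_mapping_conv_mult[of a y] mult.assoc[symmetric] comm by (rule left)
qed

end

type_synonym 'g free_algebra = "'g free_monoid \<Rightarrow>\<^sub>0 complex"

definition gen :: "'g \<Rightarrow> 'g free_algebra" where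
  "gen g = Poly_Mapping.single (Word [g]) 1"

lemma lookup_gen_0 [simp]: "Poly_Mapping.lookup (gen g) 0 = 0"
  by (simp add: gen_def lookup_single zero_free_monoid_def)

lemma lookup_mult_0: "Poly_Mapping.lookup (x * y) 0 = Poly_Mapping.lookup x 0 * Poly_Mapping.lookup y 0" for x y :: "'g free_algebra"
proof -
  have 1: "Sum_any (\<lambda>q. Poly_Mapping.lookup y q when (0 :: 'g free_monoid) = l + q) = (Poly_Mapping.lookup y 0 when l = 0)" for l
  proof -
    have "Sum_any (\<lambda>q. Poly_Mapping.lookup y q when (0 :: 'g free_monoid) = l + q)
          = Sum_any (\<lambda>q. (Poly_Mapping.lookup y q when l = 0) when q = 0)"
      by (rule Sum_any.cong) (auto simp: eq_commute[of 0 "l + _"] free_monoid_plus_eq_0 when_def)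
    then show ?thesis by simp
  qed
  show ?thesis
    unfolding lookup_mult by (simp only: 1 mult_when Sum_any_when_equal)
qed

lemma two_sided_ideal_augmentation: "two_sided_ideal {x :: 'g free_algebra. Poly_Mapping.lookup x 0 = 0}"
  by (simp add: two_sided_ideal_def lookup_add lookup_mult_0)

text \<open>
  A presentation, attached to the type of its generators.  The class axiom (no relator has a
  constant term) holds for all presentations below; it is only there because the class
  \<open>ring_1\<close> demands \<open>0 \<noteq> 1\<close> in the presented algebra.
\<close>

class presentation =
  fixes relators :: "'a free_algebra set"
  assumes lookup_relator_0: "r \<in> relators \<Longrightarrow> Poly_Mapping.lookup r 0 = 0"

definition relator_ideal :: "'g::presentation free_algebra set" where
  "relator_ideal = two_sided_ideal hull relators"

lemma two_sided_ideal_relator_ideal: "two_sided_ideal relator_ideal"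
  by (simp add: relator_ideal_def two_sided_ideal_hull)

lemma lookup_relator_ideal_0:
  fixes x :: "'g::presentation free_algebra"
  assumes "x \<in> relator_ideal"
  shows "Poly_Mapping.lookup x 0 = 0"
proof -
  have "(relators :: 'g free_algebra set) \<subseteq> {x. Poly_Mapping.lookup x 0 = 0}"
    by (rule subsetI) (simp add: lookup_relator_0)
  then have "(relator_ideal :: 'g free_algebra set) \<subseteq> {x. Poly_Mapping.lookup x 0 = 0}"
    unfolding relator_ideal_def by (rule hull_minimal) (rule two_sided_ideal_augmentation)
  then show ?thesis using assms by blast
qed

quotient_type (overloaded) 'g presented = "'g::presentation free_algebra" /
  "\<lambda>x y. x - y \<in> relator_ideal"
  by (rule two_sided_ideal_equivp[OF two_sided_ideal_relator_ideal])

instantiation presented :: (presentation) complex_algebra_1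
begin

lift_definition zero_presented :: "'a presented" is 0 .
lift_definition one_presented :: "'a presented" is 1 .
lift_definition plus_presented :: "'a presented \<Rightarrow> 'a presented \<Rightarrow> 'a presented" is "(+)"
  by (rule two_sided_ideal_cong[OF two_sided_ideal_relator_ideal])
lift_definition minus_presented :: "'a presented \<Rightarrow> 'a presented \<Rightarrow> 'a presented" is "(-)"
  by (rule two_sided_ideal_cong[OF two_sided_ideal_relator_ideal])
lift_definition uminus_presented :: "'a presented \<Rightarrow> 'a presented" is uminus
  by (rule two_sided_ideal_cong(4)[OF two_sided_ideal_relator_ideal])
lift_definition times_presented :: "'a presented \<Rightarrow> 'a presented \<Rightarrow> 'a presented" is "(*)"
  by (rule two_sided_ideal_cong[OF two_sided_ideal_relator_ideal])
lift_definition scaleC_presented :: "complex \<Rightarrow> 'a presented \<Rightarrow> 'a presented" is scaleC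
  by (metis scaleC_poly_mapping_conv_mult right_diff_distrib
      two_sided_idealD(3)[OF two_sided_ideal_relator_ideal])

instance
proof
  show "(0 :: 'a presented) \<noteq> 1"
    by transfer (auto dest!: lookup_relator_ideal_0 simp: lookup_minus)
qed (transfer; simp add: algebra_simps scaleC_add_right scaleC_add_left scaleC_scaleC scaleC_one
      mult_scaleC_left mult_scaleC_right two_sided_idealD(1)[OF two_sided_ideal_relator_ideal])+

end

definition pgen :: "'g::presentation \<Rightarrow> 'g presented" where
  "pgen g = abs_presented (gen g)"


section \<open>The orthogonal twisted Yangian in Drinfeld's original presentation\<close>

definition comm :: "'a::ring_1 \<Rightarrow> 'a \<Rightarrow> 'a" where
  "comm x y = x * y - y * x"

datatype ygen = Gk | GE | GF

instantiation ygen :: presentation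
begin

definition relators_ygen :: "ygen free_algebra set" where
  "relators_ygen = (let k = gen Gk; E = gen GE; F = gen GF in
     {comm k E - 2 * E,
      comm k F - (- 2 * F),
      comm E (comm E (comm F E)) - 12 * (E * k * E),
      comm F (comm F (comm F E)) - 12 * (F * k * F)})"

instance
  by standard
    (auto simp: relators_ygen_def comm_def Let_def lookup_minus lookup_add lookup_mult_0)

end

type_synonym Y2_plus = "ygen presented"


section \<open>Matrices indexed by \<open>-1, 1\<close>\<close>

datatype ix = N1 | P1

lemma UNIV_ix: "(UNIV :: ix set) = {N1, P1}"
  by (auto intro: ix.exhaust)

lemma all_ix: "(\<forall>i. P i) \<longleftrightarrow> P N1 \<and> P P1"
  by (metis ix.exhaust)

instance ix :: finite
  by standard (simp add: UNIV_ix)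

fun ix_neg :: "ix \<Rightarrow> ix" where
  "ix_neg N1 = P1" | "ix_neg P1 = N1"

fun ix_sign :: "ix \<Rightarrow> 'a::ring_1" where
  "ix_sign N1 = - 1" | "ix_sign P1 = 1"

fun mat2_entry :: "'a \<Rightarrow> 'a \<Rightarrow> 'a \<Rightarrow> 'a \<Rightarrow> ix \<Rightarrow> ix \<Rightarrow> 'a" where
  "mat2_entry a b c d N1 N1 = a" | "mat2_entry a b c d N1 P1 = b"
| "mat2_entry a b c d P1 N1 = c" | "mat2_entry a b c d P1 P1 = d"

text \<open>\<open>mat2 a b c d\<close> has rows \<open>(a, b)\<close> and \<open>(c, d)\<close>, with \<open>-1\<close> preceding \<open>1\<close>.\<close>

definition mat2 :: "'a \<Rightarrow> 'a \<Rightarrow> 'a \<Rightarrow> 'a \<Rightarrow> 'a^ix^ix" where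
  "mat2 a b c d = (\<chi> i j. mat2_entry a b c d i j)"

definition mat_unit :: "ix \<Rightarrow> ix \<Rightarrow> 'a::ring_1^ix^ix" where
  "mat_unit i j = (\<chi> k l. if k = i \<and> l = j then 1 else 0)"

definition sp_transpose :: "'a::ring_1^ix^ix \<Rightarrow> 'a^ix^ix" where
  "sp_transpose A = (\<chi> i j. ix_sign i * ix_sign j * A $ ix_neg j $ ix_neg i)"

lemma sp_transpose_mat_unit:
  "sp_transpose (mat_unit i j) =
    (\<chi> k l. ix_sign i * ix_sign j * (mat_unit (ix_neg j) (ix_neg i) $ k $ l :: 'a::ring_1))"
proof -
  have "ix_sign k * ix_sign l * (mat_unit i j $ ix_neg l $ ix_neg k) =
      ix_sign i * ix_sign j * (mat_unit (ix_neg j) (ix_neg i) $ k $ l :: 'a)" for k l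
    by (cases i; cases j; cases k; cases l) (simp_all add: mat_unit_def)
  then show ?thesis
    by (simp add: sp_transpose_def vec_eq_iff)
qed

definition kron :: "'a::times^'n^'m \<Rightarrow> 'a^'q^'p \<Rightarrow> 'a^('n \<times> 'q)^('m \<times> 'p)"  (infixl \<open>\<otimes>\<^sub>k\<close> 75) where
  "A \<otimes>\<^sub>k B = (\<chi> i j. A $ fst i $ fst j * B $ snd i $ snd j)"

definition perm_P :: "'a::ring_1^(ix \<times> ix)^(ix \<times> ix)" where
  "perm_P = (\<Sum>i\<in>UNIV. \<Sum>j\<in>UNIV. mat_unit i j \<otimes>\<^sub>k mat_unit j i)"

text \<open>Transposing either tensor factor of \<open>P\<close> gives the same matrix.\<close>

definition perm_Q :: "'a::ring_1^(ix \<times> ix)^(ix \<times> ix)" where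
  "perm_Q = (\<Sum>i\<in>UNIV. \<Sum>j\<in>UNIV. mat_unit i j \<otimes>\<^sub>k sp_transpose (mat_unit j i))"

lemma perm_Q_transpose_first:
  "perm_Q = (\<Sum>i\<in>UNIV. \<Sum>j\<in>UNIV. sp_transpose (mat_unit i j) \<otimes>\<^sub>k mat_unit j i :: 'a::ring_1^_^_)"
proof -
  have "perm_Q $ (a, b) $ (c, d) =
      (\<Sum>i\<in>UNIV. \<Sum>j\<in>UNIV. sp_transpose (mat_unit i j) \<otimes>\<^sub>k mat_unit j i :: 'a^_^_) $ (a, b) $ (c, d)"
    for a b c d
    by (cases a; cases b; cases c; cases d)
      (simp_all add: perm_Q_def UNIV_ix sp_transpose_def mat_unit_def kron_def)
  then show ?thesis by (simp add: vec_eq_iff)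
qed


section \<open>The extended Yangian of \<open>sp\<^sub>2\<close>\<close>

text \<open>
  A series in \<open>u\<^sup>-\<^sup>1\<close> is a formal power series whose variable stands for \<open>u\<^sup>-\<^sup>1\<close>.
  Expressions in two spectral parameters live in \<open>A((v\<^sup>-\<^sup>1))((u\<^sup>-\<^sup>1))\<close>, i.e. in the type
  \<open>A fls fls\<close> with outer variable \<open>u\<^sup>-\<^sup>1\<close> and inner variable \<open>v\<^sup>-\<^sup>1\<close>; there \<open>1/(u - v - c)\<close> is
  its expansion \<open>\<Sum>k\<ge>0. (v + c)^k u\<^sup>-\<^sup>k\<^sup>-\<^sup>1\<close>.
\<close>

definition var_u :: "'a::ring_1 fls fls" where "var_u = fls_X_inv"
definition var_v :: "'a::ring_1 fls fls" where "var_v = fls_const fls_X_inv"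

definition in_u :: "'a::ring_1 fps \<Rightarrow> 'a fls fls" where
  "in_u f = fps_to_fls (Abs_fps (\<lambda>n. fls_const (fps_nth f n)))"

definition in_v :: "'a::ring_1 fps \<Rightarrow> 'a fls fls" where
  "in_v f = fls_const (fps_to_fls f)"

definition recip_uv :: "nat \<Rightarrow> 'a::ring_1 fls fls" where
  "recip_uv c = fps_to_fls (fps_X * Abs_fps (\<lambda>k. (fls_X_inv + of_nat c) ^ k))"

lemma recip_uv_inverse:
  "(var_u - var_v - of_nat c) * recip_uv c = (1 :: 'a::ring_1 fls fls)"
  "recip_uv c * (var_u - var_v - of_nat c) = (1 :: 'a::ring_1 fls fls)"
proof -
  define w :: "'a fls" where "w = fls_X_inv + of_nat c"
  have eq: "var_u - var_v - of_nat c = (fls_X_inv - fls_const w :: 'a fls fls)"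
    by (simp add: var_u_def var_v_def w_def fls_of_nat algebra_simps flip: fls_plus_const)
  have nth: "fls_nth (recip_uv c) n = (if n \<le> 0 then 0 else w ^ nat (n - 1))" for n
  proof -
    have "nat n - 1 = nat (n - 1)" by simp
    then show ?thesis by (auto simp: recip_uv_def w_def)
  qed
  have [simp]: "nat n = Suc (nat (n - 1))" if "n \<ge> 1" for n using that by simp
  show "(var_u - var_v - of_nat c) * recip_uv c = (1 :: 'a fls fls)"
    "recip_uv c * (var_u - var_v - of_nat c) = (1 :: 'a fls fls)"
    unfolding eq left_diff_distrib right_diff_distrib fls_X_inv_times_conv_shift
    by (rule fls_eqI; auto simp: nth power_commutes)+
qed

text \<open>\<open>R_uv\<close> is \<open>R(u - v)\<close>.\<close>

definition R_uv :: "'a::ring_1 fls fls^(ix \<times> ix)^(ix \<times> ix)" where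
  "R_uv = mat 1 - perm_P ** mat (recip_uv 0) + perm_Q ** mat (recip_uv 2)"

definition rtt_defect :: "'a::ring_1 fps^ix^ix \<Rightarrow> 'a fls fls^(ix \<times> ix)^(ix \<times> ix)" where
  "rtt_defect T = (let T1 = map_matrix in_u T \<otimes>\<^sub>k mat 1; T2 = mat 1 \<otimes>\<^sub>k map_matrix in_v T in
     R_uv ** T1 ** T2 - T2 ** T1 ** R_uv)"

text \<open>Index shift: \<open>t i j s\<close> is the coefficient of \<open>u\<^sup>-\<^sup>s\<^sup>-\<^sup>1\<close>, as the leading term is the identity.\<close>

definition T_series :: "(ix \<Rightarrow> ix \<Rightarrow> nat \<Rightarrow> 'a::ring_1) \<Rightarrow> 'a fps^ix^ix" where
  "T_series t = (\<chi> i j. Abs_fps (\<lambda>r. case r of 0 \<Rightarrow> if i = j then 1 else 0 | Suc s \<Rightarrow> t i j s))"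

datatype tgen = TGen ix ix nat

lemma two_sided_ideal_fls:
  assumes I: "two_sided_ideal I"
  shows "two_sided_ideal {f :: 'a::ring_1 fls. \<forall>n. fls_nth f n \<in> I}"
  by (auto simp: two_sided_ideal_def fls_times_nth(1) two_sided_idealD[OF I]
      intro!: two_sided_ideal_sum[OF I])

lemma two_sided_ideal_fps:
  assumes I: "two_sided_ideal I"
  shows "two_sided_ideal {f :: 'a::ring_1 fps. \<forall>n. fps_nth f n \<in> I}"
  by (auto simp: two_sided_ideal_def fps_mult_nth two_sided_idealD[OF I]
      intro!: two_sided_ideal_sum[OF I])

lemma matrix_mult_in_ideal:
  assumes I: "two_sided_ideal I"
  shows "(\<And>i j. A $ i $ j \<in> I) \<Longrightarrow> (A ** B) $ i $ j \<in> I"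
    "(\<And>i j. B $ i $ j \<in> I) \<Longrightarrow> (A ** B) $ i $ j \<in> I"
  by (auto simp: matrix_matrix_mult_def two_sided_idealD[OF I] intro!: two_sided_ideal_sum[OF I])

lemma fls_nth_in_u: "fls_nth (in_u f) m = (if m < 0 then 0 else fls_const (fps_nth f (nat m)))"
  by (simp add: in_u_def)

lemma rtt_defect_in_ideal:
  fixes I :: "'a::ring_1 set"
  assumes I: "two_sided_ideal I" and t: "\<And>i j s. t i j s \<in> I"
  shows "fls_nth (fls_nth (rtt_defect (T_series t) $ a $ b) m) n \<in> I"
proof -
  define J where "J = {f. \<forall>m. fls_nth f m \<in> {g. \<forall>n. fls_nth g n \<in> I}}"
  have J: "two_sided_ideal J"
    unfolding J_def by (intro two_sided_ideal_fls I)
  let ?M = "\<lambda>A :: _^(ix \<times> ix)^(ix \<times> ix). \<forall>i j. A $ i $ j \<in> J"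
  have M: "?M (A + B)" "?M (A - B)" if "?M A" "?M B" for A B :: "_^(ix \<times> ix)^(ix \<times> ix)"
    using that two_sided_idealD[OF J] by auto
  have Mm: "?M (A ** B)" if "?M A \<or> ?M B" for A B :: "_^(ix \<times> ix)^(ix \<times> ix)"
    using that matrix_mult_in_ideal[OF J] by blast
  define A :: "'a fls fls^(ix \<times> ix)^(ix \<times> ix)" where "A = map_matrix in_u (T_series t) \<otimes>\<^sub>k mat 1 - mat 1"
  define B :: "'a fls fls^(ix \<times> ix)^(ix \<times> ix)" where "B = mat 1 \<otimes>\<^sub>k map_matrix in_v (T_series t) - mat 1"
  have T: "fps_nth (T_series t $ i $ j) r - (if r = 0 \<and> i = j then 1 else 0) \<in> I" for i j r
    by (simp add: T_series_def two_sided_idealD(1)[OF I] t split: nat.split)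
  have if_in_I: "(if P then x else 0) \<in> I" if "x \<in> I" for P x
    using that two_sided_idealD(1)[OF I] by simp
  have u: "in_u (T_series t $ i $ j) - (if i = j then 1 else 0) \<in> J" for i j
  proof -
    have "fls_nth (fls_nth (in_u (T_series t $ i $ j) - (if i = j then 1 else 0)) m) n =
        (if m \<ge> 0 \<and> n = 0 then fps_nth (T_series t $ i $ j) (nat m) - (if nat m = 0 \<and> i = j then 1 else 0)
         else 0)" for m n
      by (auto simp: fls_nth_in_u)
    then show ?thesis
      unfolding J_def mem_Collect_eq using if_in_I[OF T] by presburger
  qed
  have v: "in_v (T_series t $ i $ j) - (if i = j then 1 else 0) \<in> J" for i j
  proof -
    have "fls_nth (fls_nth (in_v (T_series t $ i $ j) - (if i = j then 1 else 0)) m) n =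
        (if m = 0 \<and> n \<ge> 0 then fps_nth (T_series t $ i $ j) (nat n) - (if nat n = 0 \<and> i = j then 1 else 0)
         else 0)" for m n
      by (auto simp: in_v_def)
    then show ?thesis
      unfolding J_def mem_Collect_eq using if_in_I[OF T] by presburger
  qed
  have "A $ (i, k) $ (j, l) = (if k = l then in_u (T_series t $ i $ j) - (if i = j then 1 else 0) else 0)"
    "B $ (i, k) $ (j, l) = (if i = j then in_v (T_series t $ k $ l) - (if k = l then 1 else 0) else 0)"
    for i j k l
    by (simp_all add: A_def B_def kron_def mat_def)
  moreover have "(if P then x else 0) \<in> J" if "x \<in> J" for P x
    using that two_sided_idealD(1)[OF J] by simp
  ultimately have A: "?M A" and B: "?M B"
    using u v by (simp_all only: split_paired_All) blast+
  have rdist: "(X + Y) ** Z = X ** Z + Y ** Z" for X Y Z :: "'a fls fls^(ix \<times> ix)^(ix \<times> ix)"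
    by (simp add: vec_eq_iff matrix_matrix_mult_def distrib_right sum.distrib)
  have "rtt_defect (T_series t) = R_uv ** (mat 1 + A) ** (mat 1 + B) - (mat 1 + B) ** (mat 1 + A) ** R_uv"
    by (simp add: rtt_defect_def A_def B_def Let_def)
  also have "R_uv ** (mat 1 + A) ** (mat 1 + B) = R_uv + R_uv ** A + R_uv ** B + R_uv ** A ** B"
    by (simp add: matrix_add_ldistrib rdist add.assoc)
  also have "(mat 1 + B) ** (mat 1 + A) ** R_uv = R_uv + A ** R_uv + B ** R_uv + B ** A ** R_uv"
    by (simp add: matrix_add_ldistrib rdist ac_simps)
  also have "(R_uv + R_uv ** A + R_uv ** B + R_uv ** A ** B) - (R_uv + A ** R_uv + B ** R_uv + B ** A ** R_uv)
      = (R_uv ** A + R_uv ** B + R_uv ** A ** B) - (A ** R_uv + B ** R_uv + B ** A ** R_uv)"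
    by (simp only: diff_conv_add_uminus minus_add_distrib add.assoc) (simp add: ac_simps)
  finally have eq: "rtt_defect (T_series t) =
      (R_uv ** A + R_uv ** B + R_uv ** A ** B) - (A ** R_uv + B ** R_uv + B ** A ** R_uv)" .
  have BA: "?M (B ** A)" by (rule Mm) (use B in blast)
  have "?M (R_uv ** A)" "?M (R_uv ** B)" "?M (R_uv ** A ** B)"
    "?M (A ** R_uv)" "?M (B ** R_uv)" "?M (B ** A ** R_uv)"
    by (rule Mm, use A B BA in blast)+
  then have "?M (rtt_defect (T_series t))"
    unfolding eq by (intro M(1) M(2)[of "_ + _ + _"]) assumption+
  then show ?thesis unfolding J_def by blast
qed

instantiation tgen :: presentation
begin

definition relators_tgen :: "tgen free_algebra set" where
  "relators_tgen =
     {fls_nth (fls_nth (rtt_defect (T_series (\<lambda>i j s. gen (TGen i j s))) $ a $ b) m) n | a b m n. True}"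

instance
proof
  fix r :: "tgen free_algebra"
  assume "r \<in> relators"
  then show "Poly_Mapping.lookup r 0 = 0"
    using rtt_defect_in_ideal[OF two_sided_ideal_augmentation, of "\<lambda>i j s. gen (TGen i j s)"]
    by (auto simp: relators_tgen_def)
qed

end

type_synonym X_sp2 = "tgen presented"

definition T_X :: "X_sp2 fps^ix^ix" where
  "T_X = T_series (\<lambda>i j s. pgen (TGen i j s))"


section \<open>The Yangian of \<open>sp\<^sub>2\<close>\<close>

text \<open>\<open>subst_lin s c f\<close> is \<open>f(s u + c)\<close> for \<open>s = 1\<close> or \<open>s = - 1\<close>.\<close>

definition recip_lin :: "int \<Rightarrow> int \<Rightarrow> 'a::ring_1 fps" where
  "recip_lin s c = fps_X * Abs_fps (\<lambda>k. of_int (s * (- (s * c)) ^ k))"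

lemma recip_lin:
  assumes "s * s = 1"
  shows "(of_int s + of_int c * fps_X) * recip_lin s c = (fps_X :: 'a::ring_1 fps)"
proof -
  define h :: "'a fps" where "h = Abs_fps (\<lambda>k. of_int (s * (- (s * c)) ^ k))"
  have of_int: "of_int n = (fps_const (of_int n) :: 'a fps)" for n
    by (cases n rule: int_diff_cases) (simp add: flip: fps_of_nat fps_const_sub)
  have "fps_nth ((of_int s + of_int c * fps_X) * h) n = fps_nth 1 n" for n
  proof (cases n)
    case 0
    then show ?thesis
      using assms by (simp add: of_int h_def fps_mult_nth flip: of_int_mult)
  next
    case (Suc m)
    have "fps_nth ((of_int s + of_int c * fps_X) * h) n = of_int s * fps_nth h n + of_int c * fps_nth h m"
      by (simp add: Suc of_int distrib_right mult.assoc)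
    also have "\<dots> = of_int (s * s * (- (s * c)) ^ Suc m + c * s * (- (s * c)) ^ m)"
      by (simp add: Suc h_def mult.assoc)
    also have "\<dots> = of_int 0"
      using assms by (intro arg_cong[where f = of_int]) simp
    finally show ?thesis by (simp add: Suc)
  qed
  then have "(of_int s + of_int c * fps_X) * h = 1"
    by (simp add: fps_eq_iff)
  moreover have "(of_int s + of_int c * fps_X) * (fps_X * h) = ((of_int s + of_int c * fps_X) * h) * fps_X"
    by (metis fps_mult_fps_X_commute mult.assoc)
  ultimately show ?thesis by (simp add: recip_lin_def h_def)
qed

definition subst_lin :: "int \<Rightarrow> int \<Rightarrow> 'a::ring_1 fps^ix^ix \<Rightarrow> 'a fps^ix^ix" where
  "subst_lin s c = map_matrix (\<lambda>f. fps_compose f (recip_lin s c))"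

text \<open>
  \<open>T(u) T(u+2)\<^sup>t\<close> is the scalar matrix \<open>z(u) I\<close>; \<open>z(u)\<close> is read off at the entry \<open>(-1, -1)\<close>.
\<close>

definition z_X :: "X_sp2 fps" where
  "z_X = (T_X ** sp_transpose (subst_lin 1 2 T_X)) $ N1 $ N1"

definition z_ideal :: "X_sp2 set" where
  "z_ideal = two_sided_ideal hull (range (fps_nth (z_X - 1)))"

lemma two_sided_ideal_z_ideal: "two_sided_ideal z_ideal"
  by (simp add: z_ideal_def two_sided_ideal_hull)

lift_definition aug_X :: "X_sp2 \<Rightarrow> complex" is "\<lambda>x. Poly_Mapping.lookup x 0"
  using lookup_relator_ideal_0 by (fastforce simp: lookup_minus)

lemma aug_X_simps [simp]:
  "aug_X 0 = 0" "aug_X 1 = 1" "aug_X (x + y) = aug_X x + aug_X y" "aug_X (x * y) = aug_X x * aug_X y"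
  "aug_X (x - y) = aug_X x - aug_X y" "aug_X (- x) = - aug_X x"
  by (transfer; simp add: lookup_add lookup_mult_0 lookup_minus)+

lemma aug_X_z_ideal: "x \<in> z_ideal \<Longrightarrow> aug_X x = 0"
proof -
  define I where "I = {x. aug_X x = 0}"
  have I: "two_sided_ideal I" by (simp add: two_sided_ideal_def I_def)
  define J where "J = {f. \<forall>n. fps_nth f n \<in> I}"
  have J: "two_sided_ideal J" unfolding J_def by (intro two_sided_ideal_fps I)
  have t: "pgen g \<in> I" for g :: tgen
    unfolding I_def pgen_def by (simp add: aug_X.abs_eq)
  have T: "T_X $ i $ j - (if i = j then 1 else 0) \<in> J" for i j
    by (auto simp: J_def T_X_def T_series_def t two_sided_idealD[OF I] split: nat.split)
  have S: "subst_lin 1 2 T_X $ i $ j - (if i = j then 1 else 0) \<in> J" for i j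
  proof -
    have "fps_compose (T_X $ i $ j - (if i = j then 1 else 0)) (recip_lin 1 2) \<in> J"
      using T[of i j]
      by (auto simp: J_def fps_compose_nth two_sided_idealD[OF I] simp del: fps_sub_nth
          intro!: two_sided_ideal_sum[OF I])
    then show ?thesis
      by (simp add: subst_lin_def fps_compose_sub_distrib if_distrib[of "\<lambda>f. fps_compose f _"]
          split: if_splits)
  qed
  define p q r s where "p = T_X $ N1 $ N1" "q = T_X $ N1 $ P1"
    "r = subst_lin 1 2 T_X $ P1 $ P1" "s = subst_lin 1 2 T_X $ P1 $ N1"
  have z: "z_X = p * r - q * s"
    by (simp add: z_X_def matrix_matrix_mult_def sp_transpose_def UNIV_ix p_q_r_s_def)
  have "p - 1 \<in> J" "q \<in> J" "r - 1 \<in> J"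
    using T[of N1 N1] T[of N1 P1] S[of P1 P1] by (simp_all add: p_q_r_s_def)
  moreover have "z_X - 1 = (p - 1) * r + (r - 1) - q * s"
    by (simp add: z algebra_simps)
  ultimately have "z_X - 1 \<in> J"
    by (simp only: two_sided_idealD[OF J])
  then have "range (fps_nth (z_X - 1)) \<subseteq> I" by (auto simp: J_def)
  then have "z_ideal \<subseteq> I" unfolding z_ideal_def by (rule hull_minimal) (rule I)
  then show "x \<in> z_ideal \<Longrightarrow> aug_X x = 0" by (auto simp: I_def)
qed

quotient_type Y_sp2 = X_sp2 / "\<lambda>x y. x - y \<in> z_ideal"
  by (rule two_sided_ideal_equivp[OF two_sided_ideal_z_ideal])

instantiation Y_sp2 :: complex_algebra_1
begin

lift_definition zero_Y_sp2 :: Y_sp2 is 0 .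
lift_definition one_Y_sp2 :: Y_sp2 is 1 .
lift_definition plus_Y_sp2 :: "Y_sp2 \<Rightarrow> Y_sp2 \<Rightarrow> Y_sp2" is "(+)"
  by (rule two_sided_ideal_cong[OF two_sided_ideal_z_ideal])
lift_definition minus_Y_sp2 :: "Y_sp2 \<Rightarrow> Y_sp2 \<Rightarrow> Y_sp2" is "(-)"
  by (rule two_sided_ideal_cong[OF two_sided_ideal_z_ideal])
lift_definition uminus_Y_sp2 :: "Y_sp2 \<Rightarrow> Y_sp2" is uminus
  by (rule two_sided_ideal_cong(4)[OF two_sided_ideal_z_ideal])
lift_definition times_Y_sp2 :: "Y_sp2 \<Rightarrow> Y_sp2 \<Rightarrow> Y_sp2" is "(*)"
  by (rule two_sided_ideal_cong[OF two_sided_ideal_z_ideal])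
lift_definition scaleC_Y_sp2 :: "complex \<Rightarrow> Y_sp2 \<Rightarrow> Y_sp2" is scaleC
proof -
  fix c and x y :: X_sp2
  assume "x - y \<in> z_ideal"
  then have "(c *\<^sub>C 1) * (x - y) \<in> z_ideal"
    by (rule two_sided_idealD(3)[OF two_sided_ideal_z_ideal])
  then show "c *\<^sub>C x - c *\<^sub>C y \<in> z_ideal"
    by (simp add: right_diff_distrib mult_scaleC_left)
qed

instance
proof
  show "(0 :: Y_sp2) \<noteq> 1"
    by transfer (auto dest!: aug_X_z_ideal)
qed (transfer; simp add: algebra_simps scaleC_add_right scaleC_add_left scaleC_scaleC scaleC_one
      mult_scaleC_left mult_scaleC_right two_sided_idealD(1)[OF two_sided_ideal_z_ideal])+

end

definition T_Y :: "Y_sp2 fps^ix^ix" where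
  "T_Y = T_series (\<lambda>i j s. abs_Y_sp2 (pgen (TGen i j s)))"


section \<open>The twisted Yangian and its Gauss decomposition\<close>

definition Sigma_Y :: "Y_sp2 fps^ix^ix" where
  "Sigma_Y = subst_lin 1 (- 1) T_Y ** mat2 1 0 0 (- 1) ** sp_transpose (subst_lin (- 1) 1 T_Y)"

definition Y_tw :: "Y_sp2 set" where
  "Y_tw = subalgebra hull {fps_nth (Sigma_Y $ i $ j) n | i j n. True}"

definition is_gauss :: "'a::ring_1 fps^ix^ix \<Rightarrow> 'a fps \<times> 'a fps \<times> 'a fps \<times> 'a fps \<Rightarrow> bool" where
  "is_gauss S = (\<lambda>(f, k, k1, e). S = mat2 1 0 f 1 ** mat2 k 0 0 k1 ** mat2 1 e 0 1)"

lemma is_gauss_iff: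
  "is_gauss S (f, k, k1, e) \<longleftrightarrow>
    S $ N1 $ N1 = k \<and> S $ N1 $ P1 = k * e \<and> S $ P1 $ N1 = f * k \<and> S $ P1 $ P1 = f * k * e + k1"
  by (auto simp: is_gauss_def vec_eq_iff matrix_matrix_mult_def UNIV_ix mat2_def all_ix)

lemma ex1_gauss:
  assumes "fps_nth (S $ N1 $ N1) 0 = (1 :: 'a::ring_1)"
  shows "\<exists>!x. is_gauss S x"
proof -
  define k where "k = S $ N1 $ N1"
  define h where "h = fps_right_inverse k 1"
  have kh: "k * h = 1" unfolding h_def by (rule fps_right_inverse) (simp add: k_def assms)
  have hk: "h * k = 1" unfolding h_def by (rule fps_left_inverse'[of 1]) (simp_all add: k_def assms)
  define x where "x = (S $ P1 $ N1 * h, k, S $ P1 $ P1 - S $ P1 $ N1 * h * S $ N1 $ P1, h * S $ N1 $ P1)"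
  show ?thesis
  proof (rule ex1I[of _ x])
    have "S $ P1 $ N1 * h * k = S $ P1 $ N1" "k * (h * S $ N1 $ P1) = S $ N1 $ P1"
      by (simp_all add: mult.assoc hk) (simp add: kh flip: mult.assoc)
    then show "is_gauss S x"
      unfolding x_def is_gauss_iff by (simp add: k_def[symmetric] mult.assoc)
  next
    fix y assume "is_gauss S y"
    then obtain f k' k1 e where y: "y = (f, k', k1, e)" and *: "S $ N1 $ N1 = k'"
      "S $ N1 $ P1 = k' * e" "S $ P1 $ N1 = f * k'" "S $ P1 $ P1 = f * k' * e + k1"
      by (cases y) (auto simp: is_gauss_iff)
    have k': "k' = k" using * by (simp add: k_def)
    have "h * (k * e) = e" using hk by (simp flip: mult.assoc)
    moreover have "f * k * h = f" by (simp add: mult.assoc kh)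
    ultimately show "y = x"
      using * unfolding y x_def k' by (simp add: mult.assoc)
  qed
qed

lemma Sigma_Y_N1_N1_0: "fps_nth (Sigma_Y $ N1 $ N1) 0 = 1"
  by (simp add: Sigma_Y_def matrix_matrix_mult_def UNIV_ix mat2_def subst_lin_def T_Y_def
      T_series_def sp_transpose_def fps_compose_nth)

lemmas ex1_gauss_Sigma_Y = ex1_gauss[OF Sigma_Y_N1_N1_0]

definition gauss_Y :: "Y_sp2 fps \<times> Y_sp2 fps \<times> Y_sp2 fps \<times> Y_sp2 fps" where
  "gauss_Y = (THE x. is_gauss Sigma_Y x)"

definition f_Y :: "Y_sp2 fps" where "f_Y = (case gauss_Y of (f, k, k1, e) \<Rightarrow> f)"
definition k_Y :: "Y_sp2 fps" where "k_Y = (case gauss_Y of (f, k, k1, e) \<Rightarrow> k)"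
definition k1_Y :: "Y_sp2 fps" where "k1_Y = (case gauss_Y of (f, k, k1, e) \<Rightarrow> k1)"
definition e_Y :: "Y_sp2 fps" where "e_Y = (case gauss_Y of (f, k, k1, e) \<Rightarrow> e)"

lemma is_gauss_Sigma_Y: "is_gauss Sigma_Y (f_Y, k_Y, k1_Y, e_Y)"
  using theI'[OF ex1_gauss_Sigma_Y]
  by (simp add: f_Y_def k_Y_def k1_Y_def e_Y_def gauss_Y_def split_beta)

lemma gauss_leading_terms: "fps_nth k_Y 0 = 1" "fps_nth e_Y 0 = 0" "fps_nth f_Y 0 = 0"
proof -
  have "fps_nth (Sigma_Y $ N1 $ P1) 0 = 0" "fps_nth (Sigma_Y $ P1 $ N1) 0 = 0"
    by (simp_all add: Sigma_Y_def matrix_matrix_mult_def UNIV_ix mat2_def subst_lin_def T_Y_def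
        T_series_def sp_transpose_def fps_compose_nth)
  then show "fps_nth k_Y 0 = 1" "fps_nth e_Y 0 = 0" "fps_nth f_Y 0 = 0"
    using is_gauss_Sigma_Y Sigma_Y_N1_N1_0 by (auto simp: is_gauss_iff)
qed

text \<open>The superscript \<open>(r)\<close> labels the coefficient of \<open>u\<^sup>-\<^sup>r\<^sup>-\<^sup>1\<close>.\<close>

definition f_coeff :: "nat \<Rightarrow> Y_sp2" where "f_coeff r = fps_nth f_Y (Suc r)"
definition k_coeff :: "nat \<Rightarrow> Y_sp2" where "k_coeff r = fps_nth k_Y (Suc r)"
definition e_coeff :: "nat \<Rightarrow> Y_sp2" where "e_coeff r = fps_nth e_Y (Suc r)"

end

theory Submission
  imports Defs
begin

text \<open>For sp_2 the partially transposed permutation is Q = 1 - P, so R(u) is a scalar multiple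
  of Yang's R-matrix 1 - 2P/u (\<open>rtt_defect_entry\<close>). A homomorphism out of
  \<open>Y_sp2\<close> is therefore the same thing as a matrix satisfying RTT relations of gl_2 type
  and one quantum determinant condition (\<open>Y_sp2_hom_of_yangian_matrix\<close>). Put S(w) =
  T(w) G T(-w)^t, so that Sigma(u) = S(u - 1), and let A, B, C, D be its entries, read row by row.
  The Gauss coefficients in the theorem are A_1, B_2 and C_2 (\<open>gauss_coeffs\<close>).

  The map exists and is onto. RTT at v = -u makes B and C even, and T(u) T(u+2)^t = 1 gives S(w)
  S(-w-2) = 1 (\<open>S_even\<close>, \<open>unitarity\<close>). The brackets of B_2 and C_2 with S
  (\<open>comm_B2\<close>, \<open>comm_C2\<close>) then yield [B_2, C_2] = -8 A_3 + 8 A_1 + 4 A_1^3.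
  Two further brackets with B_2 or with C_2 kill A_3 and A_1 and turn the cube into the right-hand
  side of the Serre relation (\<open>triple_comm_B2\<close>, \<open>triple_comm_C2\<close>). The
  same brackets, with unitarity, produce all coefficients of S from A_1, B_2, C_2
  (\<open>generated_coeffs\<close>).

  The map is injective. Filter the presented algebra by the number of letters E and F. Modulo lower
  degree the Serre relations force the elements \<open>e i\<close>, \<open>f i\<close>,
  \<open>h i\<close>, built by iterated brackets with H = [E, F], to have the brackets of e
  z^(2i+1), f z^(2i+1), h z^(2i) in the current algebra of sl_2 (\<open>current_relations\<close>,
  \<open>comm_e_e\<close>). Hence words in these letters can be reordered at the price of shorter
  words or words of lower weight (\<open>W_mset_cong\<close>). On the other side,
  \<open>Y_sp2\<close> acts on n sites through a product of L-operators 1 + M_s/(u - z_s), and the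
  top-degree part of the image of a word is the product of the operators given by the sum over s of
  g_s z_s^p, one for each letter g z^p (\<open>rep_exists\<close>, \<open>lead_W\<close>). As n
  grows, such products become independent up to reordering (\<open>words_independent\<close>): add a
  site in the state x and look at the terms where exactly one letter acts on it. So an element of
  the kernel can be rewritten by ever shorter and lower words until nothing is left
  (\<open>kernel_descent\<close>, \<open>kernel_trivial\<close>).\<close>

no_notation fps_nth (infixl \<open>$\<close> 75)

section \<open>Complex algebras and maps out of algebras given by generators and relations\<close>

section \<open>Algebras, commutators and homomorphisms\<close>

interpretation cvs: vector_space "scaleC :: complex \<Rightarrow> 'a \<Rightarrow> 'a::complex_algebra_1"
  by standard (simp_all add: scaleC_add_right scaleC_add_left scaleC_scaleC scaleC_one)

lemma scaleC_numeral: "numeral n *\<^sub>C x = numeral n * (x :: 'a::complex_algebra_1)"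
proof -
  have "of_nat m *\<^sub>C x = of_nat m * x" for m
    by (induction m) (simp_all add: scaleC_add_left scaleC_one distrib_right)
  from this[of "numeral n"] show ?thesis by simp
qed

lemma comm_add_left: "comm (x + y) z = comm x z + comm y z"
  and comm_add_right: "comm z (x + y) = comm z x + comm z y"
  and comm_diff_left: "comm (x - y) z = comm x z - comm y z"
  and comm_diff_right: "comm z (x - y) = comm z x - comm z y"
  and comm_minus_left: "comm (- x) z = - comm x z"
  and comm_minus_right: "comm z (- x) = - comm z x"
  and comm_zero_left [simp]: "comm 0 z = 0"
  and comm_zero_right [simp]: "comm z 0 = 0"
  and comm_one_left [simp]: "comm 1 z = 0"
  and comm_one_right [simp]: "comm z 1 = 0"
  and comm_self [simp]: "comm z z = 0"
  by (simp_all add: comm_def algebra_simps)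

lemma comm_mult_left: "comm (x * y) z = x * comm y z + comm x z * y"
  and comm_mult_right: "comm z (x * y) = x * comm z y + comm z x * y"
  by (simp_all add: comm_def algebra_simps)

lemma comm_swap: "comm y x = - comm x y"
  by (simp add: comm_def)

lemma comm_comm_left: "comm (comm x y) z = comm x (comm y z) - comm y (comm x z)"
  by (simp add: comm_def algebra_simps)

lemma comm_comm_right: "comm z (comm x y) = comm (comm z x) y + comm x (comm z y)"
  by (simp add: comm_def algebra_simps)

lemma comm_scaleC_left: "comm (c *\<^sub>C x) y = c *\<^sub>C comm x y"
  and comm_scaleC_right: "comm x (c *\<^sub>C y) = c *\<^sub>C comm x y"
  by (simp_all add: comm_def mult_scaleC_left mult_scaleC_right cvs.scale_right_diff_distrib)

lemma algebra_homD:
  assumes "algebra_hom \<phi>"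
  shows "\<phi> 1 = 1" "\<phi> (x + y) = \<phi> x + \<phi> y" "\<phi> (x * y) = \<phi> x * \<phi> y" "\<phi> (c *\<^sub>C x) = c *\<^sub>C \<phi> x"
    "\<phi> 0 = 0" "\<phi> (- x) = - \<phi> x" "\<phi> (x - y) = \<phi> x - \<phi> y"
proof -
  show *: "\<phi> 1 = 1" "\<phi> (x + y) = \<phi> x + \<phi> y" "\<phi> (x * y) = \<phi> x * \<phi> y" "\<phi> (c *\<^sub>C x) = c *\<^sub>C \<phi> x" for x y c
    using assms by (auto simp: algebra_hom_def)
  show 0: "\<phi> 0 = 0" using *(2)[of 0 0] by simp
  show m: "\<phi> (- x) = - \<phi> x" for x using *(2)[of x "- x"] 0 by (simp add: eq_neg_iff_add_eq_0 add.commute)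
  show "\<phi> (x - y) = \<phi> x - \<phi> y" using *(2)[of x "- y"] m by simp
qed

lemma algebra_hom_comm: "algebra_hom \<phi> \<Longrightarrow> \<phi> (comm x y) = comm (\<phi> x) (\<phi> y)"
  by (simp add: comm_def algebra_homD)

lemma algebra_hom_sum: "algebra_hom \<phi> \<Longrightarrow> \<phi> (sum f A) = (\<Sum>x\<in>A. \<phi> (f x))"
  by (induction A rule: infinite_finite_induct) (simp_all add: algebra_homD)

lemma algebra_hom_of_nat: "algebra_hom \<phi> \<Longrightarrow> \<phi> (of_nat n) = of_nat n"
  by (induction n) (simp_all add: algebra_homD)

lemma algebra_hom_of_int: "algebra_hom \<phi> \<Longrightarrow> \<phi> (of_int n) = of_int n"
  by (cases n rule: int_diff_cases) (simp add: algebra_homD algebra_hom_of_nat)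

lemma algebra_hom_compose: "algebra_hom \<phi> \<Longrightarrow> algebra_hom \<psi> \<Longrightarrow> algebra_hom (\<psi> \<circ> \<phi>)"
  by (simp add: algebra_hom_def)

lemma two_sided_ideal_ker: "algebra_hom \<phi> \<Longrightarrow> two_sided_ideal {x. \<phi> x = 0}"
  by (simp add: two_sided_ideal_def algebra_homD)

lemma subalgebra_hull: "subalgebra (subalgebra hull S)"
  by (rule hull_in) (auto simp: subalgebra_def)

lemma subalgebraD:
  assumes "subalgebra S"
  shows "1 \<in> S" "x \<in> S \<Longrightarrow> y \<in> S \<Longrightarrow> x + y \<in> S" "x \<in> S \<Longrightarrow> y \<in> S \<Longrightarrow> x * y \<in> S"
    "x \<in> S \<Longrightarrow> c *\<^sub>C x \<in> S" "0 \<in> S" "x \<in> S \<Longrightarrow> - x \<in> S" "x \<in> S \<Longrightarrow> y \<in> S \<Longrightarrow> x - y \<in> S"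
    "of_int n \<in> S" "numeral m \<in> S"
proof -
  show *: "1 \<in> S" "x \<in> S \<Longrightarrow> y \<in> S \<Longrightarrow> x + y \<in> S" "x \<in> S \<Longrightarrow> y \<in> S \<Longrightarrow> x * y \<in> S"
    "x \<in> S \<Longrightarrow> c *\<^sub>C x \<in> S" for x y c
    using assms by (auto simp: subalgebra_def)
  show 0: "0 \<in> S" using *(4)[OF *(1), of 0] by simp
  show m: "x \<in> S \<Longrightarrow> - x \<in> S" for x using *(4)[of x "- 1"] by (simp add: scaleC_one)
  show "x \<in> S \<Longrightarrow> y \<in> S \<Longrightarrow> x - y \<in> S" using *(2)[of x "- y"] m[of y] by simp
  have nat: "of_nat k \<in> S" for k by (induction k) (simp_all add: 0 * )
  show "of_int n \<in> S" using nat m by (cases n) (auto simp del: of_nat_Suc simp: of_nat_Suc[symmetric])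
  show "numeral m \<in> S" using nat[of "numeral m"] by simp
qed

lemma subalgebra_sum: "subalgebra S \<Longrightarrow> (\<And>i. i \<in> A \<Longrightarrow> f i \<in> S) \<Longrightarrow> sum f A \<in> S"
  by (induction A rule: infinite_finite_induct) (auto intro: subalgebraD)

lemma subalgebra_range:
  assumes "algebra_hom \<phi>"
  shows "subalgebra (range \<phi>)"
proof -
  note h = algebra_homD(1-4)[OF assms, symmetric]
  show ?thesis
    unfolding subalgebra_def by (subst h(1)) (auto simp: h(2-4) simp del: h(1))
qed

lemma subalgebra_vimage: "algebra_hom \<phi> \<Longrightarrow> subalgebra B \<Longrightarrow> subalgebra (\<phi> -` B)"
  by (simp add: subalgebra_def algebra_homD)

lemma subalgebra_equalizer:
  "algebra_hom \<phi> \<Longrightarrow> algebra_hom \<psi> \<Longrightarrow> subalgebra {x. \<phi> x = \<psi> x}"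
  by (simp add: subalgebra_def algebra_homD)


section \<open>Universal property of free and presented algebras\<close>

fun eval_word :: "('g \<Rightarrow> 'a::complex_algebra_1) \<Rightarrow> 'g free_monoid \<Rightarrow> 'a" where
  "eval_word g (Word ws) = prod_list (map g ws)"

lemma eval_word_0 [simp]: "eval_word g 0 = 1"
  by (simp add: zero_free_monoid_def)

lemma eval_word_add: "eval_word g (v + w) = eval_word g v * eval_word g w"
  by (cases v; cases w) simp

definition free_eval :: "('g \<Rightarrow> 'a::complex_algebra_1) \<Rightarrow> 'g free_algebra \<Rightarrow> 'a" where
  "free_eval g p = (\<Sum>w\<in>Poly_Mapping.keys p. Poly_Mapping.lookup p w *\<^sub>C eval_word g w)"

lemma free_eval_superset:
  "finite A \<Longrightarrow> Poly_Mapping.keys p \<subseteq> A \<Longrightarrow> free_eval g p = (\<Sum>w\<in>A. Poly_Mapping.lookup p w *\<^sub>C eval_word g w)"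
  unfolding free_eval_def by (rule sum.mono_neutral_left) (auto simp: in_keys_iff)

lemma free_eval_single [simp]: "free_eval g (Poly_Mapping.single w c) = c *\<^sub>C eval_word g w"
  by (simp add: free_eval_def)

lemma free_eval_add: "free_eval g (p + q) = free_eval g p + free_eval g q"
proof -
  let ?A = "Poly_Mapping.keys p \<union> Poly_Mapping.keys q"
  have "finite ?A" "Poly_Mapping.keys p \<subseteq> ?A" "Poly_Mapping.keys q \<subseteq> ?A" "Poly_Mapping.keys (p + q) \<subseteq> ?A"
    by (auto dest: set_mp[OF Poly_Mapping.keys_add])
  then show ?thesis
    by (simp add: free_eval_superset[of ?A] lookup_add scaleC_add_left sum.distrib)
qed

lemma free_eval_sum: "free_eval g (sum f A) = (\<Sum>x\<in>A. free_eval g (f x))"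
  by (induction A rule: infinite_finite_induct) (simp_all add: free_eval_add, simp_all add: free_eval_def)

lemma free_algebra_decomp:
  fixes p :: "'g free_algebra"
  shows "p = (\<Sum>w\<in>Poly_Mapping.keys p. Poly_Mapping.single w (Poly_Mapping.lookup p w))"
proof (rule poly_mapping_eqI)
  fix k
  show "Poly_Mapping.lookup p k = Poly_Mapping.lookup (\<Sum>w\<in>Poly_Mapping.keys p. Poly_Mapping.single w (Poly_Mapping.lookup p w)) k"
    by (simp add: lookup_sum lookup_single when_def in_keys_iff)
qed

lemma free_eval_mult: "free_eval g (p * q) = free_eval g p * free_eval g q"
proof -
  have "p * q = (\<Sum>v\<in>Poly_Mapping.keys p. \<Sum>w\<in>Poly_Mapping.keys q. Poly_Mapping.single (v + w) (Poly_Mapping.lookup p v * Poly_Mapping.lookup q w))"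
    by (subst free_algebra_decomp[of p], subst free_algebra_decomp[of q])
      (simp add: sum_product mult_single)
  then show ?thesis
    by (simp add: free_eval_sum eval_word_add)
      (simp add: free_eval_def sum_product mult_scaleC_left mult_scaleC_right scaleC_scaleC mult.commute)
qed

lemma algebra_hom_free_eval: "algebra_hom (free_eval g)"
proof -
  have "free_eval g 1 = 1"
    using free_eval_single[of g 0 1] by (simp add: scaleC_one)
  moreover have "free_eval g (c *\<^sub>C p) = c *\<^sub>C free_eval g p" for c p
    using free_eval_mult[of g "Poly_Mapping.single 0 c" p] mult_scaleC_left[of c 1 "free_eval g p"]
    by (simp add: scaleC_poly_mapping_conv_mult scaleC_complex_def)
  ultimately show ?thesis
    by (simp add: algebra_hom_def free_eval_add free_eval_mult)
qed

lemma free_eval_gen [simp]: "free_eval g (gen x) = g x"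
  by (simp add: gen_def scaleC_one)

lemma free_algebra_generated:
  fixes p :: "'g free_algebra"
  shows "p \<in> subalgebra hull (range gen)"
proof -
  let ?S = "subalgebra hull (range gen) :: 'g free_algebra set"
  note S = subalgebraD[OF subalgebra_hull]
  have word: "Poly_Mapping.single (Word ws) 1 \<in> ?S" for ws
  proof (induction ws)
    case Nil
    have "Poly_Mapping.single (Word []) 1 = (1 :: 'g free_algebra)" by (metis single_one zero_free_monoid_def)
    then show ?case by (simp add: S)
  next
    case (Cons x ws)
    have "Poly_Mapping.single (Word (x # ws)) 1 = gen x * Poly_Mapping.single (Word ws) 1"
      by (simp add: gen_def mult_single)
    moreover have "gen x \<in> ?S" by (simp add: hull_inc)
    ultimately show ?case using Cons by (simp add: S)
  qed
  have "Poly_Mapping.single w c \<in> ?S" for w c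
    using S(4)[OF word, of c] by (cases w) (simp add: scaleC_single scaleC_complex_def)
  then show ?thesis
    by (subst free_algebra_decomp) (auto intro: subalgebra_sum subalgebra_hull)
qed

lemma algebra_hom_abs_presented: "algebra_hom abs_presented"
  by (simp add: algebra_hom_def one_presented.abs_eq plus_presented.abs_eq times_presented.abs_eq
      scaleC_presented.abs_eq)

lemma abs_presented_eq_iff: "abs_presented p = abs_presented q \<longleftrightarrow> p - q \<in> relator_ideal"
  by (simp add: presented.abs_eq_iff)

lemma abs_presented_eq_0_iff: "abs_presented p = 0 \<longleftrightarrow> p \<in> relator_ideal"
  by (simp add: zero_presented_def abs_presented_eq_iff)

lemma abs_rep_presented: "abs_presented (rep_presented x) = x"
  by (rule Quotient3_abs_rep[OF Quotient3_presented])

lemma abs_presented_relator: "r \<in> relators \<Longrightarrow> abs_presented r = 0"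
  by (simp add: abs_presented_eq_0_iff relator_ideal_def hull_inc)

lemma presented_generated: "x \<in> subalgebra hull (range pgen)"
proof -
  have "subalgebra hull (range gen) \<subseteq> abs_presented -` (subalgebra hull (range pgen))"
    by (rule hull_minimal)
      (auto intro!: hull_inc simp: pgen_def[symmetric] subalgebra_vimage algebra_hom_abs_presented subalgebra_hull)
  then have "abs_presented (rep_presented x) \<in> subalgebra hull (range pgen)"
    using free_algebra_generated by blast
  then show ?thesis by (simp add: abs_rep_presented)
qed

lemma presented_hom_unique:
  assumes "algebra_hom \<phi>" "algebra_hom \<psi>" "\<And>g. \<phi> (pgen g) = \<psi> (pgen g)"
  shows "\<phi> = \<psi>"
proof
  fix x
  show "\<phi> x = \<psi> x"
    using presented_generated[of x] hull_minimal[of "range pgen" "{x. \<phi> x = \<psi> x}" subalgebra]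
      subalgebra_equalizer[OF assms(1,2)] assms(3) by blast
qed

lemma presented_hom_exists:
  assumes "\<And>r. r \<in> relators \<Longrightarrow> free_eval g r = 0"
  shows "\<exists>\<phi> :: 'g::presentation presented \<Rightarrow> 'a::complex_algebra_1. algebra_hom \<phi> \<and> (\<forall>x. \<phi> (pgen x) = g x)"
proof -
  \<comment> \<open>Evaluation of a chosen representative; the choice is harmless because the kernel
    of \<open>free_eval g\<close> is an ideal containing the relators.\<close>
  define \<phi> where "\<phi> = free_eval g \<circ> rep_presented"
  have ker: "free_eval g p = 0" if "p \<in> relator_ideal" for p
    using that hull_minimal[of relators "{p. free_eval g p = 0}" two_sided_ideal] assms
      two_sided_ideal_ker[OF algebra_hom_free_eval] unfolding relator_ideal_def by blast
  have abs: "\<phi> (abs_presented p) = free_eval g p" for p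
  proof -
    have "rep_presented (abs_presented p) - p \<in> relator_ideal"
      by (simp add: abs_rep_presented flip: abs_presented_eq_iff)
    from ker[OF this] show ?thesis
      by (simp add: \<phi>_def algebra_homD(7)[OF algebra_hom_free_eval])
  qed
  have "algebra_hom \<phi>"
    unfolding algebra_hom_def
  proof (intro conjI allI)
    fix x y :: "'g presented" and c
    obtain p q where [simp]: "x = abs_presented p" "y = abs_presented q" using abs_rep_presented[symmetric] by blast
    note h = algebra_homD[OF algebra_hom_abs_presented, symmetric]
      and e = algebra_homD[OF algebra_hom_free_eval[of g]]
    show "\<phi> 1 = 1" using abs[of 1] by (simp add: e flip: h(1))
    show "\<phi> (x + y) = \<phi> x + \<phi> y" by (simp add: abs h(2) e)
    show "\<phi> (x * y) = \<phi> x * \<phi> y" by (simp add: abs h(3) e)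
    show "\<phi> (c *\<^sub>C x) = c *\<^sub>C \<phi> x" by (simp add: abs h(4) e)
  qed
  moreover have "\<phi> (pgen x) = g x" for x
    by (simp add: pgen_def abs)
  ultimately show ?thesis by blast
qed

lemma algebra_hom_abs_Y_sp2: "algebra_hom abs_Y_sp2"
  by (simp add: algebra_hom_def one_Y_sp2.abs_eq plus_Y_sp2.abs_eq times_Y_sp2.abs_eq scaleC_Y_sp2.abs_eq)

lemma abs_Y_sp2_eq_0: "x \<in> z_ideal \<Longrightarrow> abs_Y_sp2 x = 0"
  by (simp add: zero_Y_sp2_def Y_sp2.abs_eq_iff)

lemma abs_rep_Y_sp2: "abs_Y_sp2 (rep_Y_sp2 x) = x"
  by (rule Quotient3_abs_rep[OF Quotient3_Y_sp2])

lemma Y_sp2_hom_exists: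
  assumes \<rho>: "algebra_hom \<rho>" and z: "\<And>n. \<rho> (fps_nth (z_X - 1) n) = 0"
  shows "\<exists>\<phi>. algebra_hom \<phi> \<and> (\<forall>x. \<phi> (abs_Y_sp2 x) = \<rho> x)"
proof -
  define \<phi> where "\<phi> = \<rho> \<circ> rep_Y_sp2"
  have ker: "\<rho> p = 0" if "p \<in> z_ideal" for p
    using that hull_minimal[of "range (fps_nth (z_X - 1))" "{p. \<rho> p = 0}" two_sided_ideal] z
      two_sided_ideal_ker[OF \<rho>] unfolding z_ideal_def by blast
  have abs: "\<phi> (abs_Y_sp2 p) = \<rho> p" for p
  proof -
    have "rep_Y_sp2 (abs_Y_sp2 p) - p \<in> z_ideal"
      by (simp add: abs_rep_Y_sp2 flip: Y_sp2.abs_eq_iff)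
    from ker[OF this] show ?thesis
      by (simp add: \<phi>_def algebra_homD(7)[OF \<rho>])
  qed
  have "algebra_hom \<phi>"
    unfolding algebra_hom_def
  proof (intro conjI allI)
    fix x y :: Y_sp2 and c
    obtain p q where [simp]: "x = abs_Y_sp2 p" "y = abs_Y_sp2 q" using abs_rep_Y_sp2[symmetric] by blast
    note h = algebra_homD[OF algebra_hom_abs_Y_sp2, symmetric]
      and e = algebra_homD[OF \<rho>]
    show "\<phi> 1 = 1" using abs[of 1] by (simp add: e flip: h(1))
    show "\<phi> (x + y) = \<phi> x + \<phi> y" by (simp add: abs h(2) e)
    show "\<phi> (x * y) = \<phi> x * \<phi> y" by (simp add: abs h(3) e)
    show "\<phi> (c *\<^sub>C x) = c *\<^sub>C \<phi> x" by (simp add: abs h(4) e)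
  qed
  then show ?thesis using abs by blast
qed


section \<open>Integral substitutions and the RTT relations in coefficient form\<close>

section \<open>Substitution of integral series\<close>

text \<open>
  Composition of power series over a noncommutative ring is multiplicative only if the inner
  series has central coefficients; all substitutions below have integral inner series.
\<close>

definition of_int_fps :: "int fps \<Rightarrow> 'a::ring_1 fps" where
  "of_int_fps c = Abs_fps (\<lambda>n. of_int (fps_nth c n))"

lemma of_int_fps_nth [simp]: "fps_nth (of_int_fps c) n = of_int (fps_nth c n)"
  by (simp add: of_int_fps_def)

lemma of_int_fps_simps:
  "of_int_fps 0 = 0" "of_int_fps 1 = 1" "of_int_fps (c + d) = of_int_fps c + of_int_fps d"
  "of_int_fps (- c) = - of_int_fps c" "of_int_fps (c * d) = of_int_fps c * of_int_fps d"
  "of_int_fps (c ^ n) = of_int_fps c ^ n" "of_int_fps fps_X = fps_X"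
proof -
  show 1: "of_int_fps 1 = 1" and 2: "of_int_fps (c * d) = of_int_fps c * of_int_fps d" for c d
    by (simp_all add: fps_eq_iff fps_mult_nth)
  show "of_int_fps (c ^ n) = of_int_fps c ^ n" by (induction n) (simp_all add: 1 2)
qed (simp_all add: fps_eq_iff)

lemma recip_lin_of_int_fps: "recip_lin s c = of_int_fps (recip_lin s c)"
  by (simp add: recip_lin_def of_int_fps_simps fps_eq_iff)

lemma recip_lin_nth_0 [simp]: "fps_nth (recip_lin s c) 0 = 0"
  by (simp add: recip_lin_def)

lemma of_int_fps_central: "x * of_int_fps c = of_int_fps c * x"
proof (rule fps_ext)
  fix n
  have "fps_nth (x * of_int_fps c) n = (\<Sum>i=0..n. of_int (fps_nth c (n - i)) * fps_nth x i)"
    by (simp add: fps_mult_nth mult_of_int_commute)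
  also have "\<dots> = fps_nth (of_int_fps c * x) n"
    unfolding fps_mult_nth of_int_fps_nth
    by (rule sum.reindex_bij_witness[of _ "\<lambda>i. n - i" "\<lambda>i. n - i"]) auto
  finally show "fps_nth (x * of_int_fps c) n = fps_nth (of_int_fps c * x) n" .
qed

abbreviation fps_subst :: "'a::ring_1 fps \<Rightarrow> int fps \<Rightarrow> 'a fps" (infixl \<open>oi\<close> 72) where
  "f oi c \<equiv> fps_compose f (of_int_fps c)"

lemma fps_subst_nth: "fps_nth (f oi c) n = (\<Sum>i=0..n. fps_nth f i * of_int (fps_nth (c ^ i) n))"
  by (simp add: fps_compose_nth flip: of_int_fps_simps)

lemma int_fps_power_nth_eq_0: "fps_nth (c::int fps) 0 = 0 \<Longrightarrow> n < i \<Longrightarrow> fps_nth (c ^ i) n = 0"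
  by (metis startsby_zero_power_prefix)

lemma fps_subst_nth_le:
  assumes "fps_nth c 0 = 0" "n \<le> N"
  shows "fps_nth (f oi c) n = (\<Sum>i\<le>N. fps_nth f i * of_int (fps_nth (c ^ i) n))"
  unfolding fps_subst_nth using assms
  by (intro sum.mono_neutral_left) (auto simp: int_fps_power_nth_eq_0)

lemma of_int_mult_shuffle: "x * of_int a * (y * of_int b) = x * y * (of_int (a * b) :: 'a::ring_1)"
  by (metis mult.assoc mult_of_int_commute of_int_mult)

text \<open>Integers commute with all coefficients, so the computation is the commutative one: terms
  are sorted by k = i + j, and those with k > n vanish because c has no constant term.\<close>

lemma fps_subst_mult:
  fixes f g :: "'a::ring_1 fps"
  assumes c: "fps_nth c 0 = 0"
  shows "(f * g) oi c = (f oi c) * (g oi c)"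
proof (rule fps_ext)
  fix n
  let ?t = "\<lambda>i j. fps_nth f i * fps_nth g j * of_int (fps_nth (c ^ (i + j)) n) :: 'a"
  have "fps_nth ((f oi c) * (g oi c)) n =
      (\<Sum>m=0..n. (\<Sum>i\<le>n. fps_nth f i * of_int (fps_nth (c ^ i) m)) * (\<Sum>j\<le>n. fps_nth g j * of_int (fps_nth (c ^ j) (n - m))))"
    unfolding fps_mult_nth by (intro sum.cong) (simp_all add: fps_subst_nth_le[OF c, of _ n])
  also have "\<dots> = (\<Sum>m=0..n. \<Sum>i\<le>n. \<Sum>j\<le>n. fps_nth f i * fps_nth g j * of_int (fps_nth (c ^ i) m * fps_nth (c ^ j) (n - m)))"
    unfolding sum_product of_int_mult_shuffle ..
  also have "\<dots> = (\<Sum>i\<le>n. \<Sum>j\<le>n. \<Sum>m=0..n. fps_nth f i * fps_nth g j * of_int (fps_nth (c ^ i) m * fps_nth (c ^ j) (n - m)))"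
    by (subst sum.swap) (intro sum.cong refl sum.swap)
  also have "\<dots> = (\<Sum>i\<le>n. \<Sum>j\<le>n. ?t i j)"
    by (simp add: power_add fps_mult_nth sum_distrib_left)
  also have "\<dots> = (\<Sum>i\<le>n. \<Sum>k\<in>{i..n}. ?t i (k - i))"
  proof (rule sum.cong[OF refl])
    fix i assume "i \<in> {..n}"
    then have i: "i \<le> n" by simp
    have "(\<Sum>j\<le>n. ?t i j) = (\<Sum>j\<le>n - i. ?t i j)"
    proof (intro sum.mono_neutral_right ballI)
      fix j assume "j \<in> {..n} - {..n - i}"
      then have "n < i + j" by auto
      then show "?t i j = 0" by (simp add: int_fps_power_nth_eq_0[OF c])
    qed auto
    also have "\<dots> = (\<Sum>k\<in>{i..n}. ?t i (k - i))" 
      using i by (intro sum.reindex_bij_witness[of _ "\<lambda>k. k - i" "\<lambda>j. j + i"]) auto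
    finally show "(\<Sum>j\<le>n. ?t i j) = (\<Sum>k\<in>{i..n}. ?t i (k - i))" .
  qed
  also have "\<dots> = (\<Sum>k\<le>n. \<Sum>i\<le>k. ?t i (k - i))"
    unfolding sum.Sigma[OF finite_atMost, simplified]
    by (subst (1 2) sum.Sigma, simp_all)
      (intro sum.reindex_bij_witness[of _ "\<lambda>(k, i). (i, k)" "\<lambda>(i, k). (k, i)"], auto)
  also have "\<dots> = fps_nth ((f * g) oi c) n"
    by (simp add: fps_subst_nth_le[OF c order_refl] fps_mult_nth sum_distrib_right atMost_atLeast0)
  finally show "fps_nth ((f * g) oi c) n = fps_nth ((f oi c) * (g oi c)) n" by simp
qed

lemma fps_subst_assoc:
  fixes f :: "'a::ring_1 fps"
  assumes c: "fps_nth c 0 = 0" and d: "fps_nth d 0 = 0"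
  shows "f oi c oi d = f oi (fps_compose c d)"
proof (rule fps_ext)
  fix n
  have cd: "fps_nth (fps_compose c d) 0 = 0" using c by simp
  have "fps_nth (f oi c oi d) n =
     (\<Sum>i\<le>n. (\<Sum>j\<le>n. fps_nth f j * of_int (fps_nth (c ^ j) i)) * of_int (fps_nth (d ^ i) n))"
    unfolding fps_subst_nth_le[OF d order_refl]
    by (intro sum.cong refl) (simp add: fps_subst_nth_le[OF c, of _ n])
  also have "\<dots> = (\<Sum>j\<le>n. \<Sum>i\<le>n. fps_nth f j * of_int (fps_nth (c ^ j) i * fps_nth (d ^ i) n))"
    unfolding sum_distrib_right by (subst sum.swap) (simp add: mult.assoc)
  also have "\<dots> = (\<Sum>j\<le>n. fps_nth f j * of_int (fps_nth (fps_compose (c ^ j) d) n))"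
    by (simp add: fps_compose_nth sum_distrib_left atMost_atLeast0)
  also have "\<dots> = fps_nth (f oi (fps_compose c d)) n"
    by (simp add: fps_subst_nth_le[OF cd order_refl] fps_compose_power[OF d])
  finally show "fps_nth (f oi c oi d) n = fps_nth (f oi (fps_compose c d)) n" .
qed

lemma fps_subst_uminus_nth: "fps_nth (f oi (- c)) n = fps_nth (Abs_fps (\<lambda>i. (- 1) ^ i * fps_nth f i) oi c) n"
  by (simp add: fps_subst_nth power_minus[of c] mult.assoc)
    (rule sum.cong, simp_all add: mult_of_int_commute[of "fps_nth (c ^ _) n"] minus_one_power_iff fps_neg_nth)

lemma fps_subst_of_int: "of_int_fps h oi c = of_int_fps (fps_compose h c)"
  by (simp add: fps_eq_iff fps_compose_nth flip: of_int_fps_simps(6))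

lemma fps_subst_in_subalgebra:
  assumes "subalgebra B" "\<And>i. fps_nth f i \<in> B"
  shows "fps_nth (f oi c) n \<in> B"
  unfolding fps_subst_nth using assms by (intro subalgebra_sum subalgebraD) auto

definition fps_map :: "('a \<Rightarrow> 'b) \<Rightarrow> 'a fps \<Rightarrow> 'b fps" where
  "fps_map \<phi> f = Abs_fps (\<lambda>n. \<phi> (fps_nth f n))"

lemma fps_map_nth [simp]: "fps_nth (fps_map \<phi> f) n = \<phi> (fps_nth f n)"
  by (simp add: fps_map_def)

lemma fps_map_hom:
  assumes "algebra_hom \<phi>"
  shows "fps_map \<phi> (f + g) = fps_map \<phi> f + fps_map \<phi> g" "fps_map \<phi> (f * g) = fps_map \<phi> f * fps_map \<phi> g"
    "fps_map \<phi> (f - g) = fps_map \<phi> f - fps_map \<phi> g" "fps_map \<phi> (- f) = - fps_map \<phi> f"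
    "fps_map \<phi> 1 = 1" "fps_map \<phi> 0 = 0" "fps_map \<phi> (f oi c) = fps_map \<phi> f oi c"
  by (simp_all add: fps_eq_iff fps_mult_nth fps_subst_nth algebra_homD[OF assms] algebra_hom_sum[OF assms]
      algebra_hom_of_int[OF assms])


section \<open>The ternary relation by coefficients\<close>

lemma var_u_central: "x * var_u = var_u * (x :: 'a::ring_1 fls fls)"
  by (simp only: var_u_def fls_X_inv_times_conv_shift)

lemma var_v_central: "x * var_v = var_v * (x :: 'a::ring_1 fls fls)"
  by (rule fls_eqI) (simp only: var_v_def fls_mult_const_nth fls_X_inv_times_conv_shift)

text \<open>The RTT relation of Yang's R-matrix 1 - 2P/(u - v), cleared of its denominator.\<close>

definition rtt_rel :: "('a::ring_1 fps^ix^ix) \<Rightarrow> ix \<Rightarrow> ix \<Rightarrow> ix \<Rightarrow> ix \<Rightarrow> 'a fls fls" where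
  "rtt_rel T i j k l = (var_u - var_v) * comm (in_u (T $ i $ j)) (in_v (T $ k $ l))
     - 2 * (in_u (T $ k $ j) * in_v (T $ i $ l) - in_v (T $ k $ j) * in_u (T $ i $ l))"

text \<open>The coefficient of u^-r v^-s in \<open>rtt_rel\<close>, see \<open>nth_rtt_rel\<close>;
  a factor u or v moves the index up by one.\<close>

definition rtt_coeff :: "('a::ring_1 fps^ix^ix) \<Rightarrow> ix \<Rightarrow> ix \<Rightarrow> ix \<Rightarrow> ix \<Rightarrow> nat \<Rightarrow> nat \<Rightarrow> 'a" where
  "rtt_coeff T i j k l r s = comm (fps_nth (T $ i $ j) (Suc r)) (fps_nth (T $ k $ l) s)
     - comm (fps_nth (T $ i $ j) r) (fps_nth (T $ k $ l) (Suc s))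
     - 2 * (fps_nth (T $ k $ j) r * fps_nth (T $ i $ l) s - fps_nth (T $ k $ j) s * fps_nth (T $ i $ l) r)"

lemma perm_P_entry: "perm_P $ (i, k) $ (j, l) = (if i = l \<and> k = j then 1 else 0)"
  by (cases i; cases j; cases k; cases l) (simp_all add: perm_P_def UNIV_ix mat_unit_def kron_def)

text \<open>For 2 x 2 matrices the partial transpose is Q = 1 - P. This special feature of rank one
  reduces R to Yang's R-matrix.\<close>

lemma perm_Q_entry: "perm_Q $ (i, k) $ (j, l) =
    (if i = j \<and> k = l then 1 else 0) - (if i = l \<and> k = j then 1 else (0 :: 'a::ring_1))"
  by (cases i; cases j; cases k; cases l) (simp_all add: perm_Q_def UNIV_ix mat_unit_def kron_def sp_transpose_def)

lemma UNIV_ix2: "(UNIV :: (ix \<times> ix) set) = {(N1, N1), (N1, P1), (P1, N1), (P1, P1)}"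
  by (auto intro: ix.exhaust)

lemma R_uv_entry: "R_uv $ (i, k) $ (j, l) =
    (if i = j \<and> k = l then 1 + recip_uv 2 else 0) - (if i = l \<and> k = j then recip_uv 0 + recip_uv 2 else 0)"
  by (cases i; cases j; cases k; cases l)
    (simp_all add: R_uv_def matrix_matrix_mult_def UNIV_ix2 perm_P_entry perm_Q_entry mat_def)

text \<open>Inverses of central elements are central, and u - v - c is central.\<close>

lemma recip_uv_central: "x * recip_uv c = recip_uv c * (x :: 'a::ring_1 fls fls)"
proof -
  let ?d = "var_u - var_v - of_nat c :: 'a fls fls"
  have d: "x * ?d = ?d * x" for x
    by (simp add: algebra_simps var_u_central var_v_central mult_of_nat_commute)
  have "x * recip_uv c = recip_uv c * ?d * x * recip_uv c"
    by (simp add: recip_uv_inverse)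
  also have "\<dots> = recip_uv c * x * (?d * recip_uv c)"
    by (simp only: mult.assoc d)
      (simp only: mult.assoc d flip: mult.assoc)
  finally show ?thesis by (simp add: recip_uv_inverse)
qed

lemma matrix_mult_ix2: "(A ** B) $ (i, k) $ (j, l) =
   A $ (i, k) $ (N1, N1) * B $ (N1, N1) $ (j, l) + A $ (i, k) $ (N1, P1) * B $ (N1, P1) $ (j, l) +
   A $ (i, k) $ (P1, N1) * B $ (P1, N1) $ (j, l) + A $ (i, k) $ (P1, P1) * B $ (P1, P1) $ (j, l)"
  for A B :: "'a::ring_1^(ix \<times> ix)^(ix \<times> ix)"
  by (simp add: matrix_matrix_mult_def UNIV_ix2 add.assoc)

text \<open>The identity 1/D + 1/(D-2) = 2 (1 + 1/(D-2))/D, without assuming commutativity. It shows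
  that the two scalar coefficients of R are proportional.\<close>

lemma partial_fractions:
  fixes D p q :: "'a::ring_1"
  assumes "D * p = 1" "q * (D - 2) = 1"
  shows "p + q = (1 + q) * p * 2"
proof -
  have "q - 2 * (q * p) = q * (D - 2) * p"
    using assms(1) by (simp add: left_diff_distrib right_diff_distrib mult.assoc mult_2 distrib_left distrib_right)
  then have "q - 2 * (q * p) = p" by (simp add: assms(2))
  then have "q = p + 2 * (q * p)" by (simp add: diff_eq_eq)
  then show ?thesis by (simp add: distrib_right mult_2 mult_2_right) (metis add.assoc)
qed

text \<open>Since Q = 1 - P, the matrix R(u-v) is X - Y P with scalars X and Y, and
  \<open>partial_fractions\<close> gives Y = 2X/(u-v). The scalar X/(u-v) then factors out of the
  whole relation.\<close>

lemma rtt_defect_entry: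
  fixes T :: "'a::ring_1 fps^ix^ix"
  shows "rtt_defect T $ (i, k) $ (j, l) = (1 + recip_uv 2) * recip_uv 0 * rtt_rel T i j k l"
proof -
  let ?r0 = "recip_uv 0 :: 'a fls fls" and ?r2 = "recip_uv 2 :: 'a fls fls"
  let ?D = "var_u - var_v :: 'a fls fls"
  let ?U = "\<lambda>i j. in_u (T $ i $ j)" and ?V = "\<lambda>k l. in_v (T $ k $ l)"
  have r0: "?r0 * ?D = 1" and r2: "?r2 * (?D - 2) = 1" and r0': "?D * ?r0 = 1"
    using recip_uv_inverse[of 0] recip_uv_inverse[of 2] by simp_all
  note r = partial_fractions[OF r0' r2]
  define X Y where X: "X = 1 + ?r2" and Y: "Y = ?r0 + ?r2"
  have c: "z * X = X * z" "z * Y = Y * z" "z * (X * w) = X * (z * w)" "z * (Y * w) = Y * (z * w)" for z w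
    by (simp_all add: X Y distrib_left distrib_right recip_uv_central flip: mult.assoc)
  have "rtt_defect T $ (i, k) $ (j, l) = X * comm (?U i j) (?V k l) - Y * (?U k j * ?V i l - ?V k j * ?U i l)"
    unfolding rtt_defect_def Let_def comm_def
    by (cases i; cases j; cases k; cases l;
        simp add: matrix_mult_ix2 R_uv_entry kron_def mat_def map_matrix_def X[symmetric] Y[symmetric];
        simp add: algebra_simps c)
  also have "\<dots> = X * ?r0 * (?D * comm (?U i j) (?V k l) - 2 * (?U k j * ?V i l - ?V k j * ?U i l))"
    unfolding right_diff_distrib[of "X * ?r0"] Y r X[symmetric]
    by (simp add: mult.assoc r0 flip: mult.assoc[of ?r0 ?D])
  finally show ?thesis unfolding X rtt_rel_def .
qed


abbreviation unit_lead :: "'a::ring_1 fps^ix^ix \<Rightarrow> bool" where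
  "unit_lead T \<equiv> \<forall>i j. fps_nth (T $ i $ j) 0 = (if i = j then 1 else 0)"

lemma nth_var_mult:
  "fls_nth (fls_nth ((var_u - var_v) * x) m) n = fls_nth (fls_nth x (m + 1)) n - fls_nth (fls_nth x m) (n + 1)"
  unfolding var_u_def var_v_def left_diff_distrib fls_minus_nth fls_mult_const_nth
    fls_X_inv_times_conv_shift(1) fls_shift_nth ..

lemma nth_in_u_in_v:
  "fls_nth (fls_nth (in_u f * in_v g) m) n = (if m < 0 \<or> n < 0 then 0 else fps_nth f (nat m) * fps_nth g (nat n))"
  "fls_nth (fls_nth (in_v g * in_u f) m) n = (if m < 0 \<or> n < 0 then 0 else fps_nth g (nat n) * fps_nth f (nat m))"
  by (simp_all add: in_v_def fls_nth_in_u)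

lemma nth_rtt_rel:
  assumes T: "unit_lead T"
  shows "fls_nth (fls_nth (rtt_rel T i j k l) m) n = (if m < 0 \<or> n < 0 then 0 else rtt_coeff T i j k l (nat m) (nat n))"
proof -
  have two: "fls_nth (fls_nth (2 * x) m) n = 2 * fls_nth (fls_nth x m) n" for x :: "'a fls fls"
    by (simp add: mult_2)
  have nat: "nat (m + 1) = Suc (nat m)" if "m \<ge> 0" for m :: int using that by simp
  \<comment> \<open>Among the negative indices only -1 needs care: a factor u or v brings in a
    constant term of T there, which is 0 or 1 and drops out of the commutator.\<close>
  have m: "m \<ge> 0 \<or> m = - 1 \<or> m < - 1" and n: "n \<ge> 0 \<or> n = - 1 \<or> n < - 1" by auto
  show ?thesis
    unfolding rtt_rel_def fls_minus_nth nth_var_mult two comm_def nth_in_u_in_v rtt_coeff_def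
    using m n by (elim disjE) (auto simp: nat T nth_in_u_in_v)
qed

text \<open>The scalar factor in \<open>rtt_defect_entry\<close> is (D-1)/(D(D-2)) with D = u - v, a
  unit among the iterated Laurent series, so it does not affect membership in an ideal. The ideal I
  is kept general because the result serves both the relator ideal and kernels of
  evaluations.\<close>

lemma rtt_ideal_iff:
  assumes I: "two_sided_ideal I" and T: "unit_lead T"
  shows "(\<forall>a b m n. fls_nth (fls_nth (rtt_defect T $ a $ b) m) n \<in> I) \<longleftrightarrow> (\<forall>i j k l r s. rtt_coeff T i j k l r s \<in> I)"
proof -
  define J where "J = {f. \<forall>m. fls_nth f m \<in> {g. \<forall>n. fls_nth g n \<in> I}}"
  have J: "two_sided_ideal J" unfolding J_def by (intro two_sided_ideal_fls I)
  let ?D = "var_u - var_v :: 'a fls fls" and ?p = "(1 + recip_uv 2) * recip_uv 0 :: 'a fls fls"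
  have r: "recip_uv 1 * (?D - 1) = 1" "(?D - 1) * recip_uv 1 = 1" "(?D - 2) * recip_uv 2 = 1" "recip_uv 2 * (?D - 2) = 1"
    "?D * recip_uv 0 = 1"
    using recip_uv_inverse[of 1] recip_uv_inverse[of 2] recip_uv_inverse(1)[of 0] by simp_all
  have "(?D - 2) * (1 + recip_uv 2) = ?D - 1"
    using r(3) by (simp add: distrib_left)
  moreover have "?D * (recip_uv 1 * (?D - 2)) * ?p = ?D * (recip_uv 1 * ((?D - 2) * (1 + recip_uv 2))) * recip_uv 0"
    by (simp only: mult.assoc)
  ultimately have q: "?D * (recip_uv 1 * (?D - 2)) * ?p = 1"
    by (simp only: r mult_1_right)
  have "rtt_defect T $ (i, k) $ (j, l) \<in> J \<longleftrightarrow> rtt_rel T i j k l \<in> J" for i j k l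
    unfolding rtt_defect_entry
    using two_sided_idealD(3)[OF J, of "?p * rtt_rel T i j k l" "?D * (recip_uv 1 * (?D - 2))"]
      two_sided_idealD(3)[OF J, of "rtt_rel T i j k l" ?p]
    by (auto simp: q simp del: One_nat_def simp flip: mult.assoc[of _ ?p])
  moreover have "rtt_rel T i j k l \<in> J \<longleftrightarrow> (\<forall>r s. rtt_coeff T i j k l r s \<in> I)" for i j k l
  proof
    assume "rtt_rel T i j k l \<in> J"
    then have "fls_nth (fls_nth (rtt_rel T i j k l) (int r)) (int s) \<in> I" for r s by (simp add: J_def)
    then show "\<forall>r s. rtt_coeff T i j k l r s \<in> I" by (simp add: nth_rtt_rel[OF T])
  qed (simp add: J_def nth_rtt_rel[OF T] two_sided_idealD(1)[OF I])
  ultimately have "(\<forall>i k j l. rtt_defect T $ (i, k) $ (j, l) \<in> J) \<longleftrightarrow> (\<forall>i j k l r s. rtt_coeff T i j k l r s \<in> I)"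
    by blast
  then show ?thesis by (simp add: J_def split_paired_All)
qed

lemma rtt_rel_eq_0_iff:
  assumes T: "unit_lead T"
  shows "(\<forall>i j k l. rtt_rel T i j k l = 0) \<longleftrightarrow> (\<forall>i j k l r s. rtt_coeff T i j k l r s = 0)"
proof
  assume L: "\<forall>i j k l. rtt_rel T i j k l = 0"
  show "\<forall>i j k l r s. rtt_coeff T i j k l r s = 0"
  proof (intro allI)
    fix i j k l r s
    show "rtt_coeff T i j k l r s = 0"
      using nth_rtt_rel[OF T, of i j k l "int r" "int s"] L by simp
  qed
qed (auto intro!: fls_eqI simp: nth_rtt_rel[OF T])

section \<open>Matrices over an algebra that correspond to homomorphisms out of
  \<open>Y_sp2\<close>\<close>

definition yangian_matrix :: "'a::ring_1 fps^ix^ix \<Rightarrow> bool" where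
  "yangian_matrix T \<longleftrightarrow> unit_lead T \<and> (\<forall>i j k l r s. rtt_coeff T i j k l r s = 0) \<and>
     (T ** sp_transpose (subst_lin 1 2 T)) $ N1 $ N1 = 1"

lemma rtt_coeff_map:
  assumes "algebra_hom \<phi>"
  shows "rtt_coeff (map_matrix (fps_map \<phi>) T) i j k l r s = \<phi> (rtt_coeff T i j k l r s)"
  by (simp add: rtt_coeff_def map_matrix_def algebra_homD[OF assms] algebra_hom_comm[OF assms] mult_2)

lemma unit_lead_T_series: "unit_lead (T_series t)"
  by (simp add: T_series_def)

lemma unit_lead_eq_T_series: "unit_lead T \<Longrightarrow> T = T_series (\<lambda>i j s. fps_nth (T $ i $ j) (Suc s))"
  by (auto simp: vec_eq_iff fps_eq_iff T_series_def split: nat.split)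

lemma map_T_series:
  assumes "algebra_hom \<phi>"
  shows "map_matrix (fps_map \<phi>) (T_series t) = T_series (\<lambda>i j s. \<phi> (t i j s))"
  by (simp add: vec_eq_iff fps_eq_iff T_series_def map_matrix_def algebra_homD[OF assms] split: nat.split)

lemma subst_lin_nth: "subst_lin s c T $ i $ j = T $ i $ j oi recip_lin s c"
  unfolding subst_lin_def map_matrix_def by (subst recip_lin_of_int_fps) simp

lemma qdet_map:
  assumes "algebra_hom \<phi>"
  shows "fps_map \<phi> ((T ** sp_transpose (subst_lin 1 2 T)) $ N1 $ N1) =
    (map_matrix (fps_map \<phi>) T ** sp_transpose (subst_lin 1 2 (map_matrix (fps_map \<phi>) T))) $ N1 $ N1"
  by (simp add: matrix_matrix_mult_def sp_transpose_def UNIV_ix subst_lin_nth map_matrix_def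
      fps_map_hom[OF assms])

lemma yangian_matrix_T_Y: "yangian_matrix T_Y"
proof -
  have T_X: "T_X = map_matrix (fps_map abs_presented) (T_series (\<lambda>i j s. gen (TGen i j s)))"
    by (simp add: T_X_def map_T_series algebra_hom_abs_presented pgen_def)
  have T_Y: "T_Y = map_matrix (fps_map abs_Y_sp2) T_X"
    by (simp add: T_X_def T_Y_def map_T_series algebra_hom_abs_Y_sp2)
  have "\<forall>a b m n. fls_nth (fls_nth (rtt_defect (T_series (\<lambda>i j s. gen (TGen i j s))) $ a $ b) m) n \<in> relator_ideal"
    unfolding relator_ideal_def by (intro allI hull_inc) (unfold relators_tgen_def, blast)
  then have "rtt_coeff (T_series (\<lambda>i j s. gen (TGen i j s))) i j k l r s \<in> relator_ideal" for i j k l r s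
    using rtt_ideal_iff[OF two_sided_ideal_relator_ideal unit_lead_T_series] by blast
  then have rtt: "rtt_coeff T_Y i j k l r s = 0" for i j k l r s
    unfolding T_Y T_X rtt_coeff_map[OF algebra_hom_abs_presented] rtt_coeff_map[OF algebra_hom_abs_Y_sp2]
    by (simp add: abs_presented_eq_0_iff[THEN iffD2] algebra_homD(5)[OF algebra_hom_abs_Y_sp2])
  have "fps_map abs_Y_sp2 (z_X - 1) = 0"
  proof (rule fps_ext)
    fix n
    have "fps_nth (z_X - 1) n \<in> z_ideal"
      unfolding z_ideal_def by (rule hull_inc) simp
    then show "fps_nth (fps_map abs_Y_sp2 (z_X - 1)) n = fps_nth 0 n"
      unfolding fps_map_nth by (simp only: abs_Y_sp2_eq_0 fps_zero_nth)
  qed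
  then have "fps_map abs_Y_sp2 z_X = 1"
    by (simp add: fps_map_hom[OF algebra_hom_abs_Y_sp2])
  then have "(T_Y ** sp_transpose (subst_lin 1 2 T_Y)) $ N1 $ N1 = 1"
    unfolding z_X_def qdet_map[OF algebra_hom_abs_Y_sp2] T_Y[symmetric] .
  then show ?thesis
    unfolding yangian_matrix_def using rtt by (simp add: T_Y_def unit_lead_T_series)
qed

text \<open>The generators go to the coefficients of T. The RTT relators die by
  \<open>rtt_ideal_iff\<close> for the kernel of the evaluation, and z(u) - 1 dies by the last
  clause of \<open>yangian_matrix\<close>. So a representation of \<open>Y_sp2\<close> is obtained
  from any such matrix.\<close>

lemma Y_sp2_hom_of_yangian_matrix:
  fixes T :: "'a::complex_algebra_1 fps^ix^ix"
  assumes "yangian_matrix T"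
  shows "\<exists>\<phi>. algebra_hom \<phi> \<and> map_matrix (fps_map \<phi>) T_Y = T"
proof -
  have T: "unit_lead T" and rtt: "\<And>i j k l r s. rtt_coeff T i j k l r s = 0"
    and qdet: "(T ** sp_transpose (subst_lin 1 2 T)) $ N1 $ N1 = 1"
    using assms by (auto simp: yangian_matrix_def)
  define g where "g x = (case x of TGen i j s \<Rightarrow> fps_nth (T $ i $ j) (Suc s))" for x
  note ev = algebra_hom_free_eval[of g]
  have map_gen: "map_matrix (fps_map (free_eval g)) (T_series (\<lambda>i j s. gen (TGen i j s))) = T"
    by (simp add: map_T_series[OF ev] g_def flip: unit_lead_eq_T_series[OF T])
  have "\<forall>i j k l r s. rtt_coeff (T_series (\<lambda>i j s. gen (TGen i j s))) i j k l r s \<in> {x. free_eval g x = 0}"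
    using rtt unfolding map_gen[symmetric] rtt_coeff_map[OF ev] by simp
  then have "free_eval g r = 0" if "r \<in> relators" for r
    using that unfolding rtt_ideal_iff[OF two_sided_ideal_ker[OF ev] unit_lead_T_series, symmetric]
    by (auto simp: relators_tgen_def)
  then obtain \<rho> :: "X_sp2 \<Rightarrow> 'a" where \<rho>: "algebra_hom \<rho>" and \<rho>_gen: "\<And>x. \<rho> (pgen x) = g x"
    using presented_hom_exists[of g] by blast
  have \<rho>_T: "map_matrix (fps_map \<rho>) T_X = T"
    by (simp add: T_X_def map_T_series[OF \<rho>] \<rho>_gen g_def flip: unit_lead_eq_T_series[OF T])
  have "fps_map \<rho> (z_X - 1) = 0"
    using qdet unfolding fps_map_hom[OF \<rho>] z_X_def qdet_map[OF \<rho>] \<rho>_T by simp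
  then have "\<rho> (fps_nth (z_X - 1) n) = 0" for n
    by (metis fps_map_nth fps_zero_nth)
  from Y_sp2_hom_exists[OF \<rho> this] obtain \<phi> where \<phi>: "algebra_hom \<phi>" and \<phi>_abs: "\<And>x. \<phi> (abs_Y_sp2 x) = \<rho> x"
    by blast
  have "map_matrix (fps_map \<phi>) T_Y = T"
    using \<rho>_T by (simp add: T_X_def T_Y_def map_T_series[OF \<rho>] map_T_series[OF \<phi>] \<phi>_abs)
  with \<phi> show ?thesis by blast
qed


section \<open>The RTT relations along one-parameter substitutions\<close>

section \<open>Specialising the spectral parameters\<close>

text \<open>The two-variable series with coefficients \<open>F r s\<close>, evaluated at u^-1 = p
  and v^-1 = q. The finite ranges suffice when p and q have no constant term.\<close>

definition double_subst :: "int fps \<Rightarrow> int fps \<Rightarrow> (nat \<Rightarrow> nat \<Rightarrow> 'a::ring_1) \<Rightarrow> 'a fps" where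
  "double_subst p q F = Abs_fps (\<lambda>n. \<Sum>r\<le>n. \<Sum>s\<le>n. F r s * of_int (fps_nth (p ^ r * q ^ s) n))"

lemma power_mult_nth_eq_0:
  fixes p q :: "int fps"
  assumes "fps_nth p 0 = 0" "fps_nth q 0 = 0" "n < r + s"
  shows "fps_nth (p ^ r * q ^ s) n = 0"
  unfolding fps_mult_nth
proof (intro sum.neutral ballI)
  fix i assume "i \<in> {0..n}"
  then have "i < r \<or> n - i < s" using assms(3) by auto
  then show "fps_nth (p ^ r) i * fps_nth (q ^ s) (n - i) = 0"
    using assms(1,2) by (auto simp: int_fps_power_nth_eq_0)
qed

lemma double_subst_nth_le:
  fixes F :: "nat \<Rightarrow> nat \<Rightarrow> 'a::ring_1"
  assumes p: "fps_nth p 0 = 0" and q: "fps_nth q 0 = 0" and n: "n \<le> N"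
  shows "fps_nth (double_subst p q F) n = (\<Sum>r\<le>N. \<Sum>s\<le>N. F r s * of_int (fps_nth (p ^ r * q ^ s) n))"
proof -
  have z: "F r s * of_int (fps_nth (p ^ r * q ^ s) n) = 0" if "n < r \<or> n < s" for r s
    using that power_mult_nth_eq_0[OF p q, of n r s] by auto
  have "fps_nth (double_subst p q F) n = (\<Sum>r\<le>n. \<Sum>s\<le>N. F r s * of_int (fps_nth (p ^ r * q ^ s) n))"
    unfolding double_subst_def fps_nth_Abs_fps
    by (intro sum.cong refl sum.mono_neutral_left) (use n z in auto)
  also have "\<dots> = (\<Sum>r\<le>N. \<Sum>s\<le>N. F r s * of_int (fps_nth (p ^ r * q ^ s) n))"
    by (intro sum.mono_neutral_left) (use n z in \<open>auto intro!: sum.neutral\<close>)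
  finally show ?thesis .
qed

lemma subst_mult_subst:
  fixes f g :: "'a::ring_1 fps"
  assumes p: "fps_nth p 0 = 0" and q: "fps_nth q 0 = 0"
  shows "(f oi p) * (g oi q) = double_subst p q (\<lambda>r s. fps_nth f r * fps_nth g s)"
proof (rule fps_ext)
  fix n
  have "fps_nth ((f oi p) * (g oi q)) n =
      (\<Sum>m=0..n. (\<Sum>r\<le>n. fps_nth f r * of_int (fps_nth (p ^ r) m)) * (\<Sum>s\<le>n. fps_nth g s * of_int (fps_nth (q ^ s) (n - m))))"
    unfolding fps_mult_nth by (intro sum.cong) (simp_all add: fps_subst_nth_le[OF p, of _ n] fps_subst_nth_le[OF q, of _ n])
  also have "\<dots> = (\<Sum>m=0..n. \<Sum>r\<le>n. \<Sum>s\<le>n. fps_nth f r * fps_nth g s * of_int (fps_nth (p ^ r) m * fps_nth (q ^ s) (n - m)))"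
    unfolding sum_product of_int_mult_shuffle ..
  also have "\<dots> = (\<Sum>r\<le>n. \<Sum>s\<le>n. \<Sum>m=0..n. fps_nth f r * fps_nth g s * of_int (fps_nth (p ^ r) m * fps_nth (q ^ s) (n - m)))"
    by (subst sum.swap) (intro sum.cong refl sum.swap)
  also have "\<dots> = fps_nth (double_subst p q (\<lambda>r s. fps_nth f r * fps_nth g s)) n"
    by (simp add: double_subst_def fps_mult_nth sum_distrib_left)
  finally show "fps_nth ((f oi p) * (g oi q)) n = fps_nth (double_subst p q (\<lambda>r s. fps_nth f r * fps_nth g s)) n" .
qed

lemma double_subst_swap: "double_subst p q F = double_subst q p (\<lambda>s r. F r s)"
  unfolding double_subst_def by (rule fps_ext, simp, subst sum.swap) (simp add: mult.commute)

lemma double_subst_diff: "double_subst p q (\<lambda>r s. F r s - G r s) = double_subst p q F - double_subst p q G"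
  by (simp add: double_subst_def fps_eq_iff left_diff_distrib sum_subtractf)

lemma double_subst_add: "double_subst p q (\<lambda>r s. F r s + G r s) = double_subst p q F + double_subst p q G"
  by (simp add: double_subst_def fps_eq_iff distrib_right sum.distrib)

lemma mult_double_subst:
  fixes F :: "nat \<Rightarrow> nat \<Rightarrow> 'a::ring_1"
  assumes p: "fps_nth p 0 = 0" and q: "fps_nth q 0 = 0"
  shows "of_int_fps p * double_subst p q F = double_subst p q (\<lambda>r s. case r of 0 \<Rightarrow> 0 | Suc r \<Rightarrow> F r s)"
proof (rule fps_ext)
  fix n
  have shuffle: "of_int a * (x * of_int b) = x * of_int (a * b)" for x :: 'a and a b
    by (metis mult.assoc mult_of_int_commute of_int_mult)
  have "fps_nth (of_int_fps p * double_subst p q F) n =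
      (\<Sum>m=0..n. of_int (fps_nth p m) * (\<Sum>r\<le>n. \<Sum>s\<le>n. F r s * of_int (fps_nth (p ^ r * q ^ s) (n - m))))"
    unfolding fps_mult_nth[of "of_int_fps p"] of_int_fps_nth
    by (intro sum.cong) (simp_all add: double_subst_nth_le[OF p q, of _ n] del: fps_mult_nth)
  also have "\<dots> = (\<Sum>m=0..n. \<Sum>r\<le>n. \<Sum>s\<le>n. F r s * of_int (fps_nth p m * fps_nth (p ^ r * q ^ s) (n - m)))"
    by (simp only: sum_distrib_left shuffle)
  also have "\<dots> = (\<Sum>r\<le>n. \<Sum>s\<le>n. \<Sum>m=0..n. F r s * of_int (fps_nth p m * fps_nth (p ^ r * q ^ s) (n - m)))"
    by (subst sum.swap) (intro sum.cong refl sum.swap)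
  also have "\<dots> = (\<Sum>r\<le>n. \<Sum>s\<le>n. F r s * of_int (fps_nth (p ^ Suc r * q ^ s) n))"
    by (simp add: fps_mult_nth[of p] sum_distrib_left mult.assoc)
  also have "\<dots> = (\<Sum>r\<le>Suc n. \<Sum>s\<le>Suc n. (case r of 0 \<Rightarrow> 0 | Suc r \<Rightarrow> F r s) * of_int (fps_nth (p ^ r * q ^ s) n))"
  proof -
    have "F r (Suc n) * of_int (fps_nth (p ^ Suc r * q ^ Suc n) n) = 0" for r
      using power_mult_nth_eq_0[OF p q, of n "Suc r" "Suc n"] by simp
    then have "(\<Sum>r\<le>n. \<Sum>s\<le>n. F r s * of_int (fps_nth (p ^ Suc r * q ^ s) n)) =
        (\<Sum>r\<le>n. \<Sum>s\<le>Suc n. F r s * of_int (fps_nth (p ^ Suc r * q ^ s) n))"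
      by (simp only: sum.atMost_Suc add_0_right)
    then show ?thesis
      by (intro trans[OF _ sum.atMost_Suc_shift[symmetric]]) simp
  qed
  also have "\<dots> = fps_nth (double_subst p q (\<lambda>r s. case r of 0 \<Rightarrow> 0 | Suc r \<Rightarrow> F r s)) n"
    by (simp add: double_subst_nth_le[OF p q, of n "Suc n"])
  finally show "fps_nth (of_int_fps p * double_subst p q F) n =
      fps_nth (double_subst p q (\<lambda>r s. case r of 0 \<Rightarrow> 0 | Suc r \<Rightarrow> F r s)) n" .
qed

lemma mult_double_subst':
  assumes p: "fps_nth p 0 = 0" and q: "fps_nth q 0 = 0"
  shows "of_int_fps q * double_subst p q F = double_subst p q (\<lambda>r s. case s of 0 \<Rightarrow> 0 | Suc s \<Rightarrow> F r s)"
  using mult_double_subst[OF q p, of "\<lambda>s r. F r s"] by (simp add: double_subst_swap[of q p])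

text \<open>With p = 1/u and q = 1/v one has u - v = (q - p)/(pq). After multiplication by pq both
  sides are values of \<open>double_subst\<close>, whose coefficients agree by the coefficient form
  of RTT.\<close>

lemma rtt_subst:
  fixes T :: "'a::ring_1 fps^ix^ix"
  assumes T: "unit_lead T" and rtt: "\<And>i j k l r s. rtt_coeff T i j k l r s = 0"
    and p: "fps_nth p 0 = 0" and q: "fps_nth q 0 = 0"
  shows "(of_int_fps q - of_int_fps p) * comm (T $ i $ j oi p) (T $ k $ l oi q) =
    of_int_fps p * (of_int_fps q * (2 * ((T $ k $ j oi p) * (T $ i $ l oi q) - (T $ k $ j oi q) * (T $ i $ l oi p))))"
proof -
  let ?t = "\<lambda>i j r. fps_nth (T $ i $ j) r"
  note [simp] = mult_double_subst[OF p q] mult_double_subst'[OF p q]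
  have rev: "(f oi q) * (g oi p) = double_subst p q (\<lambda>r s. fps_nth f s * fps_nth g r)" for f g :: "'a fps"
    by (simp add: subst_mult_subst[OF q p] double_subst_swap[of q p])
  have c: "comm (T $ i $ j oi p) (T $ k $ l oi q) = double_subst p q (\<lambda>r s. comm (?t i j r) (?t k l s))"
    unfolding comm_def rev subst_mult_subst[OF p q] double_subst_diff ..
  have d: "2 * ((T $ k $ j oi p) * (T $ i $ l oi q) - (T $ k $ j oi q) * (T $ i $ l oi p)) =
      double_subst p q (\<lambda>r s. 2 * (?t k j r * ?t i l s - ?t k j s * ?t i l r))"
    unfolding rev subst_mult_subst[OF p q] mult_2 double_subst_add double_subst_diff ..
  show ?thesis
    unfolding c d left_diff_distrib
    apply (simp flip: double_subst_diff)
    apply (rule arg_cong[where f = "double_subst p q"])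
    using rtt T by (auto simp: fun_eq_iff rtt_coeff_def split: nat.split)
qed


text \<open>The intended reading: x = w^-1, T = T(w), N = T(-w), S = T G N^t, while t and s are the
  coefficients of w^-1 and w^-2 in T, and a, b are those of S_{-1,-1} at w^-1 and of S_{-1,1} at
  w^-2. Each commutator follows from the Leibniz rule and from moving every t to the left of T and
  N. Free symbols are used because the result is needed again with both indices negated.\<close>

lemma reflection_aux:
  fixes T N t s :: "ix \<Rightarrow> ix \<Rightarrow> 'a::ring_1" and x :: 'a
  assumes x: "\<And>y. y * x = x * y"
    and tT: "\<And>i j k l. comm (t i j) (T k l) = 2 * ((if k = j then T i l else 0) - (if i = l then T k j else 0))"
    and tN: "\<And>i j k l. comm (t i j) (N k l) = 2 * ((if k = j then N i l else 0) - (if i = l then N k j else 0))"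
    and sT: "\<And>i j k l. x * comm (s i j) (T k l) = comm (t i j) (T k l) + x * (2 * (t k j * T i l - T k j * t i l))"
    and sN: "\<And>i j k l. x * comm (s i j) (N k l) = x * (2 * (t k j * N i l - N k j * t i l)) - comm (t i j) (N k l)"
    and tr: "t P1 P1 = - t N1 N1"
    and b: "b = t N1 N1 * t N1 P1 + t N1 P1 * t N1 N1 - 2 * s N1 P1"
    and a: "a = 2 * t N1 N1"
    and S: "S N1 N1 = T N1 N1 * N P1 P1 + T N1 P1 * N P1 N1" "S N1 P1 = - (T N1 N1 * N N1 P1) - T N1 P1 * N N1 N1"
      "S P1 N1 = T P1 N1 * N P1 P1 + T P1 P1 * N P1 N1" "S P1 P1 = - (T P1 N1 * N N1 P1) - T P1 P1 * N N1 N1"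
  shows "x * comm b (S N1 N1) = - 4 * ((1 + x) * S N1 P1 + x * S N1 P1 * a)"
    "x * comm b (S N1 P1) = 0"
    "x * comm b (S P1 P1) = - 4 * ((1 + x) * S N1 P1 - x * a * S N1 P1)"
    "x * comm b (S P1 N1) = - 4 * ((1 + x) * (S N1 N1 + S P1 P1) - x * (a * S N1 N1 - S P1 P1 * a))"
proof -
  have mT: "T k l * t i j = t i j * T k l - comm (t i j) (T k l)"
    "N k l * t i j = t i j * N k l - comm (t i j) (N k l)" for i j k l
    by (simp_all add: comm_def)
  have mT': "T k l * (t i j * y) = t i j * (T k l * y) - comm (t i j) (T k l) * y"
    "N k l * (t i j * y) = t i j * (N k l * y) - comm (t i j) (N k l) * y" for i j k l y
    by (simp_all add: comm_def algebra_simps)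
  have x': "T k l * x = x * T k l" "N k l * x = x * N k l" "t k l * x = x * t k l"
    "T k l * (x * y) = x * (T k l * y)" "N k l * (x * y) = x * (N k l * y)" "t k l * (x * y) = x * (t k l * y)" for k l y
    by (simp_all add: x) (simp_all add: x flip: mult.assoc)
  have xb: "x * comm b y = x * (t N1 N1 * comm (t N1 P1) y + comm (t N1 N1) y * t N1 P1 + t N1 P1 * comm (t N1 N1) y
     + comm (t N1 P1) y * t N1 N1) - (x * comm (s N1 P1) y + x * comm (s N1 P1) y)" for y
    by (simp add: b comm_def algebra_simps mult_2)
  have bT: "x * comm b (T k l) = x * (t N1 N1 * comm (t N1 P1) (T k l) + comm (t N1 N1) (T k l) * t N1 P1 + t N1 P1 * comm (t N1 N1) (T k l)
     + comm (t N1 P1) (T k l) * t N1 N1) - 2 * (comm (t N1 P1) (T k l) + x * (2 * (t k P1 * T N1 l - T k P1 * t N1 l)))" for k l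
    unfolding xb sT by (simp add: mult_2)
  have bN: "x * comm b (N k l) = x * (t N1 N1 * comm (t N1 P1) (N k l) + comm (t N1 N1) (N k l) * t N1 P1 + t N1 P1 * comm (t N1 N1) (N k l)
     + comm (t N1 P1) (N k l) * t N1 N1) - 2 * (x * (2 * (t k P1 * N N1 l - N k P1 * t N1 l)) - comm (t N1 P1) (N k l))" for k l
    unfolding xb sN by (simp add: mult_2)
  have prod: "x * comm b (T k l * N m n) = T k l * (x * comm b (N m n)) + (x * comm b (T k l)) * N m n" for k l m n
    by (simp add: comm_mult_right distrib_left x' mult.assoc)
  have four: "4 * y = (y + y) + (y + y)" for y :: 'a
  proof -
    have "4 * y = 2 * (2 * y)" by (simp flip: mult.assoc)
    then show ?thesis by (simp only: mult_2)
  qed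
  note rules = S comm_add_right comm_diff_right comm_minus_right distrib_left[of x] right_diff_distrib[of x] prod bT bN a tr tT tN
  note norm = distrib_left distrib_right left_diff_distrib right_diff_distrib mult.assoc mT mT' x' tT tN tr mult_2 mult_2_right
  have num: "y * (4 * z) = 4 * (y * z)" for y z :: 'a
    by (metis mult.assoc mult_of_nat_commute of_nat_numeral)
  show "x * comm b (S N1 P1) = 0"
    by (simp add: rules, simp add: norm, simp add: num)
  show "x * comm b (S N1 N1) = - 4 * ((1 + x) * S N1 P1 + x * S N1 P1 * a)"
    by (simp add: rules four, (simp add: norm)?, (simp add: algebra_simps)?)
  show "x * comm b (S P1 P1) = - 4 * ((1 + x) * S N1 P1 - x * a * S N1 P1)"
    by (simp add: rules four, (simp add: norm)?, (simp add: algebra_simps)?)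
  show "x * comm b (S P1 N1) = - 4 * ((1 + x) * (S N1 N1 + S P1 P1) - x * (a * S N1 N1 - S P1 P1 * a))"
    by (simp add: rules four, (simp add: norm)?, (simp add: algebra_simps)?)
qed


section \<open>Unitarity and parity of S(w), and its brackets with B_2 and C_2\<close>

section \<open>The matrix \<open>S(w) = T(w) G T(-w)\<^sup>t\<close>\<close>

lemma fps_subst_X: "f oi fps_X = f"
proof (rule fps_ext)
  fix n
  have "fps_nth (f oi fps_X) n = (\<Sum>i=0..n. if n = i then fps_nth f i else 0)"
    unfolding fps_subst_nth fps_X_power_nth by (intro sum.cong) auto
  then show "fps_nth (f oi fps_X) n = fps_nth f n" by simp
qed

lemma fps_subst_minus_X_nth: "fps_nth (f oi (- fps_X)) n = (- 1) ^ n * fps_nth f n"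
  by (simp only: fps_subst_uminus_nth fps_subst_X fps_nth_Abs_fps)

lemma fps_X_cancel: "fps_X * f = fps_X * g \<Longrightarrow> f = (g :: 'a::ring_1 fps)"
proof (rule fps_ext)
  fix n assume "fps_X * f = fps_X * g"
  then have "fps_nth (fps_X * f) (Suc n) = fps_nth (fps_X * g) (Suc n)" by simp
  then show "fps_nth f n = fps_nth g n" by simp
qed

lemma two_cancel: "2 * x = 2 * y \<Longrightarrow> x = (y :: 'a::complex_algebra_1)"
proof -
  assume "2 * x = 2 * y"
  then have "2 *\<^sub>C x = 2 *\<^sub>C y" by (simp add: scaleC_numeral)
  then show ?thesis by (simp add: cvs.scale_left_imp_eq)
qed

lemma fps_two_cancel: "2 * f = 2 * g \<Longrightarrow> f = (g :: 'a::complex_algebra_1 fps)"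
proof (rule fps_ext)
  fix n assume "2 * f = 2 * g"
  then have "fps_nth (f + f) n = fps_nth (g + g) n" by (simp add: mult_2)
  then have "2 * fps_nth f n = 2 * fps_nth g n" by (simp add: mult_2)
  then show "fps_nth f n = fps_nth g n" by (rule two_cancel)
qed

lemma eq_fps_X_mult_self: "f = fps_X * f \<Longrightarrow> f = (0 :: 'a::ring_1 fps)"
proof (rule fps_ext)
  fix n assume f: "f = fps_X * f"
  show "fps_nth f n = fps_nth 0 n"
  proof (induction n)
    case 0 show ?case by (subst f) simp
  next
    case (Suc n) then show ?case by (subst f) simp
  qed
qed

abbreviation msubst :: "int fps \<Rightarrow> 'a::ring_1 fps^ix^ix \<Rightarrow> 'a fps^ix^ix" where
  "msubst c M \<equiv> map_matrix (\<lambda>f. f oi c) M"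

lemma map_matrix_nth [simp]: "map_matrix f M $ i $ j = f (M $ i $ j)"
  by (simp add: map_matrix_def)

lemma subst_lin_eq_msubst: "subst_lin s c T = msubst (recip_lin s c) T"
  by (simp add: vec_eq_iff subst_lin_nth)

lemma msubst_mult: "fps_nth c 0 = 0 \<Longrightarrow> msubst c (A ** B) = msubst c A ** msubst c B"
  by (simp add: vec_eq_iff matrix_matrix_mult_def fps_subst_mult fps_compose_sum_distrib)

lemma msubst_sp_transpose: "fps_nth c 0 = 0 \<Longrightarrow> msubst c (sp_transpose A) = sp_transpose (msubst c A)"
proof -
  have "(ix_sign i * ix_sign j * f) oi c = ix_sign i * ix_sign j * (f oi c)" for i j and f :: "'a fps"
    by (cases i; cases j) (simp_all add: fps_compose_uminus)
  then show ?thesis by (simp add: vec_eq_iff sp_transpose_def)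
qed

lemma msubst_msubst: "fps_nth c 0 = 0 \<Longrightarrow> fps_nth d 0 = 0 \<Longrightarrow> msubst d (msubst c A) = msubst (fps_compose c d) A"
  by (simp add: vec_eq_iff fps_subst_assoc)

lemma mat_ix_entry: "(mat x :: 'a::zero^ix^ix) $ i $ j = (if i = j then x else 0)"
  by (simp add: mat_def)

lemma mat_eq_ix: "A = B \<longleftrightarrow> A $ N1 $ N1 = B $ N1 $ N1 \<and> A $ N1 $ P1 = B $ N1 $ P1 \<and>
    A $ P1 $ N1 = B $ P1 $ N1 \<and> A $ P1 $ P1 = B $ P1 $ P1"
  by (auto simp: vec_eq_iff all_ix)

lemma mult_ix: "(A ** B) $ i $ j = A $ i $ N1 * B $ N1 $ j + A $ i $ P1 * B $ P1 $ j"
  for A B :: "'a::ring_1^ix^ix"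
  by (simp add: matrix_matrix_mult_def UNIV_ix)

lemma sp_transpose_entries:
  "sp_transpose A $ N1 $ N1 = A $ P1 $ P1" "sp_transpose A $ N1 $ P1 = - A $ N1 $ P1"
  "sp_transpose A $ P1 $ N1 = - A $ P1 $ N1" "sp_transpose A $ P1 $ P1 = A $ N1 $ N1"
  by (simp_all add: sp_transpose_def)

text \<open>The constant term of A is the identity matrix, so the n-th coefficient of A C is that of
  C plus terms in lower coefficients of C.\<close>

lemma unit_lead_left_cancel:
  fixes A :: "'a::ring_1 fps^ix^ix"
  assumes A: "unit_lead A" and AC: "A ** C = 0"
  shows "C = 0"
proof -
  have "\<forall>i j. fps_nth (C $ i $ j) n = 0" for n
  proof (induction n rule: less_induct)
    case (less n)
    show ?case
    proof (intro allI)
      fix i j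
      have "0 = fps_nth ((A ** C) $ i $ j) n" using AC by simp
      also have "\<dots> = (\<Sum>k\<in>UNIV. \<Sum>m=0..n. fps_nth (A $ i $ k) m * fps_nth (C $ k $ j) (n - m))"
        by (simp add: matrix_matrix_mult_def fps_sum_nth fps_mult_nth)
      also have "\<dots> = (\<Sum>k\<in>UNIV. fps_nth (A $ i $ k) 0 * fps_nth (C $ k $ j) n)"
      proof (intro sum.cong refl)
        fix k
        have "(\<Sum>m=0..n. fps_nth (A $ i $ k) m * fps_nth (C $ k $ j) (n - m)) =
            (\<Sum>m\<in>{0}. fps_nth (A $ i $ k) m * fps_nth (C $ k $ j) (n - m))"
          by (rule sum.mono_neutral_right) (auto simp: less)
        then show "(\<Sum>m=0..n. fps_nth (A $ i $ k) m * fps_nth (C $ k $ j) (n - m)) = fps_nth (A $ i $ k) 0 * fps_nth (C $ k $ j) n"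
          by simp
      qed
      also have "\<dots> = fps_nth (C $ i $ j) n"
        using A by (cases i) (simp_all add: UNIV_ix)
      finally show "fps_nth (C $ i $ j) n = 0" by simp
    qed
  qed
  then show ?thesis by (simp add: vec_eq_iff fps_eq_iff)
qed

lemma unit_lead_inverse_commute:
  fixes A :: "'a::ring_1 fps^ix^ix"
  assumes A: "unit_lead A" and AB: "A ** B = mat 1"
  shows "B ** A = mat 1"
proof -
  have "A ** (B ** A - mat 1) = A ** B ** A - A"
    by (simp add: mat_eq_ix mult_ix mat_ix_entry algebra_simps)
  also have "\<dots> = 0" by (simp add: AB)
  finally have "B ** A - mat 1 = 0" by (rule unit_lead_left_cancel[OF A])
  then show ?thesis by simp
qed

lemma recip_lin_1_2: "(1 + 2 * fps_X) * recip_lin 1 2 = (fps_X :: 'a::ring_1 fps)"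
  using recip_lin[of 1 2, where ?'a = 'a] by simp

lemma recip_lin_minus: "recip_lin (- s) (- c) = - recip_lin s c"
  by (simp add: recip_lin_def fps_eq_iff)

text \<open>Substituting -u-2 into u+2 gives -u.\<close>

lemma recip_lin_compose: "fps_compose (recip_lin 1 2) (recip_lin (- 1) (- 2)) = (- fps_X :: int fps)"
proof -
  let ?r = "recip_lin 1 2 :: int fps" and ?p = "recip_lin (- 1) (- 2) :: int fps"
  have p: "?p = - ?r" by (rule recip_lin_minus)
  have "fps_compose ((1 + 2 * fps_X) * ?r) ?p = ?p" by (simp add: recip_lin_1_2)
  then have "(1 + 2 * ?p) * fps_compose ?r ?p = ?p"
    unfolding fps_compose_mult_distrib[OF recip_lin_nth_0] fps_compose_add_distrib
    by (simp add: fps_compose_mult_distrib)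
  moreover have "(1 + 2 * ?p) * (- fps_X) = ?p"
    using recip_lin_1_2[where ?'a = int] unfolding p by (simp add: algebra_simps)
  ultimately have "(1 + 2 * ?p) * (fps_compose ?r ?p - - fps_X) = 0"
    by (simp only: right_diff_distrib diff_self)
  moreover have "fps_nth (1 + 2 * ?p) 0 \<noteq> 0" by simp
  ultimately have "fps_compose ?r ?p - - fps_X = 0" by (metis fps_zero_nth mult_eq_0_iff)
  then show ?thesis by (simp only: right_minus_eq)
qed

locale yangian =
  fixes T :: "'a::complex_algebra_1 fps^ix^ix"
  assumes Y: "yangian_matrix T"
begin

lemma unit_lead: "unit_lead T" and rtt: "rtt_coeff T i j k l r s = 0"
  using Y by (auto simp: yangian_matrix_def)

text \<open>\<open>T'\<close> is T(u+2) and \<open>N\<close> is T(-u).\<close>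

abbreviation "T' \<equiv> msubst (recip_lin 1 2) T"
abbreviation "N \<equiv> msubst (- fps_X) T"

text \<open>RTT at v = u + 2, where u - v = -2 cancels the factor 2 on the right. The rest of the
  proof cancels u^-1, 1/(u+2) and 2.\<close>

lemma comm_T_T': "comm (T $ i $ j) (T' $ k $ l) = T' $ k $ j * T $ i $ l - T $ k $ j * T' $ i $ l"
proof -
  let ?R = "of_int_fps (recip_lin 1 2) :: 'a fps"
  let ?Z = "T $ k $ j * T' $ i $ l - T' $ k $ j * T $ i $ l"
  have R: "?R = recip_lin 1 2" by (rule recip_lin_of_int_fps[symmetric])
  have RX: "?R * x = x * ?R" for x by (rule of_int_fps_central[symmetric])
  have Reg: "?R + 2 * (fps_X * ?R) = fps_X"
    using recip_lin_1_2[where ?'a = 'a] by (simp add: R distrib_right mult.assoc)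
  then have RmX: "?R - fps_X = - (2 * (fps_X * ?R))"
    by (metis add_diff_cancel_left' diff_add_cancel minus_diff_eq)
  have "(?R - fps_X) * comm (T $ i $ j) (T' $ k $ l) = fps_X * (?R * (2 * ?Z))"
    using rtt_subst[OF unit_lead rtt, of fps_X "recip_lin 1 2" i j k l]
    unfolding fps_subst_X by (simp add: of_int_fps_simps)
  moreover have "2 * (fps_X * ?R) * f = fps_X * (?R * (2 * f))" for f
    by (simp only: mult_2 distrib_left distrib_right mult.assoc)
  ultimately have "fps_X * (?R * (2 * (comm (T $ i $ j) (T' $ k $ l) + ?Z))) = fps_X * 0"
    unfolding RmX distrib_left[of _ _ ?Z] distrib_left[of _ "_ * _"] by (metis (no_types) add.right_inverse minus_mult_left mult_zero_right)
  then have "?R * (2 * (comm (T $ i $ j) (T' $ k $ l) + ?Z)) = 0" by (rule fps_X_cancel)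
  then have "(1 + 2 * fps_X) * (?R * (2 * (comm (T $ i $ j) (T' $ k $ l) + ?Z))) = 0" by simp
  then have "fps_X * (2 * (comm (T $ i $ j) (T' $ k $ l) + ?Z)) = fps_X * 0"
    by (simp add: R recip_lin_1_2 flip: mult.assoc)
  then have "2 * (comm (T $ i $ j) (T' $ k $ l) + ?Z) = 2 * 0"
    by (metis fps_X_cancel mult_zero_right)
  then have "comm (T $ i $ j) (T' $ k $ l) + ?Z = 0" by (rule fps_two_cancel)
  then show ?thesis by (simp add: algebra_simps eq_neg_iff_add_eq_0)
qed

text \<open>The hypothesis controls only the (-1,-1) entry. The commutators at v = u + 2 make the
  off-diagonal entries vanish and the two diagonal entries agree.\<close>

lemma T_T'_transpose: "T ** sp_transpose T' = mat 1"
proof -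
  note c = comm_T_T'[unfolded comm_def]
  let ?T = "\<lambda>i j. T $ i $ j" and ?U = "\<lambda>i j. T' $ i $ j"
  have q: "?T N1 N1 * ?U P1 P1 - ?T N1 P1 * ?U P1 N1 = 1"
    using Y by (simp add: yangian_matrix_def subst_lin_eq_msubst mult_ix sp_transpose_entries)
  have row: "?T i N1 * ?U i P1 = ?T i P1 * ?U i N1" for i
  proof (rule fps_two_cancel)
    have "?T i N1 * ?U i P1 + ?T i N1 * ?U i P1 = ?U i N1 * ?T i P1 + ?U i P1 * ?T i N1"
      using c[of i N1 i P1] by (simp add: algebra_simps)
    moreover have "?T i P1 * ?U i N1 + ?T i P1 * ?U i N1 = ?U i N1 * ?T i P1 + ?U i P1 * ?T i N1"
      using c[of i P1 i N1] by (simp add: algebra_simps)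
    ultimately show "2 * (?T i N1 * ?U i P1) = 2 * (?T i P1 * ?U i N1)" by (simp add: mult_2)
  qed
  have "?T N1 N1 * ?U P1 P1 + ?T P1 N1 * ?U N1 P1 = ?U P1 P1 * ?T N1 N1 + ?U P1 N1 * ?T N1 P1"
    using c[of N1 N1 P1 P1] by (simp add: algebra_simps)
  moreover have "?T N1 P1 * ?U P1 N1 + ?T P1 P1 * ?U N1 N1 = ?U P1 P1 * ?T N1 N1 + ?U P1 N1 * ?T N1 P1"
    using c[of N1 P1 P1 N1] by (simp add: algebra_simps)
  ultimately have "?T P1 P1 * ?U N1 N1 - ?T P1 N1 * ?U N1 P1 = ?T N1 N1 * ?U P1 P1 - ?T N1 P1 * ?U P1 N1"
    by (simp add: algebra_simps)
  with q row show ?thesis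
    by (simp add: mat_eq_ix mult_ix sp_transpose_entries mat_ix_entry algebra_simps)
qed

lemma T'_transpose_T: "sp_transpose T' ** T = mat 1"
  by (rule unit_lead_inverse_commute[OF unit_lead T_T'_transpose])

text \<open>For the generating matrix this is Sigma in the variable w = u - 1, see
  \<open>Sigma_Y_eq\<close>; in w the symmetries are those of w -> -w.\<close>

definition S :: "'a fps^ix^ix" where
  "S = T ** mat2 1 0 0 (- 1) ** sp_transpose N"

lemma S_entries:
  "S $ N1 $ N1 = T $ N1 $ N1 * N $ P1 $ P1 + T $ N1 $ P1 * N $ P1 $ N1"
  "S $ N1 $ P1 = - (T $ N1 $ N1 * N $ N1 $ P1) - T $ N1 $ P1 * N $ N1 $ N1"
  "S $ P1 $ N1 = T $ P1 $ N1 * N $ P1 $ P1 + T $ P1 $ P1 * N $ P1 $ N1"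
  "S $ P1 $ P1 = - (T $ P1 $ N1 * N $ N1 $ P1) - T $ P1 $ P1 * N $ N1 $ N1"
  by (simp_all add: S_def mult_ix mat2_def sp_transpose_entries)

text \<open>The product T(w) G T(-w)^t T(-w-2) G T(w+2)^t collapses from the inside: the two middle
  factors cancel, then G^2 = 1, then T(w) T(w+2)^t = 1.\<close>

lemma unitarity: "S ** msubst (recip_lin (- 1) (- 2)) S = mat 1"
proof -
  let ?p = "recip_lin (- 1) (- 2) :: int fps"
  let ?G = "mat2 1 0 0 (- 1) :: 'a fps^ix^ix"
  have G: "msubst ?p ?G = ?G"
    by (simp add: mat_eq_ix mat2_def fps_compose_uminus)
  have GG: "?G ** ?G = mat 1"
    by (simp add: mat_eq_ix mat2_def mult_ix mat_ix_entry)
  have m1: "msubst ?p (mat 1 :: 'a fps^ix^ix) = mat 1"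
    by (simp add: mat_eq_ix mat_ix_entry)
  have N: "msubst ?p N = T'"
    by (simp add: msubst_msubst fps_compose_uminus recip_lin_minus[of 1 2, simplified])
  have "msubst ?p (sp_transpose T' ** T) = sp_transpose (msubst ?p T') ** msubst ?p T"
    by (simp add: msubst_mult msubst_sp_transpose)
  also have "msubst ?p T' = N"
    by (simp add: msubst_msubst recip_lin_compose)
  finally have NT: "sp_transpose N ** msubst ?p T = mat 1"
    unfolding T'_transpose_T m1 by simp
  have "msubst ?p S = msubst ?p T ** ?G ** sp_transpose T'"
    unfolding S_def msubst_mult[OF recip_lin_nth_0] msubst_sp_transpose[OF recip_lin_nth_0] G N ..
  then have "S ** msubst ?p S = T ** ?G ** (sp_transpose N ** msubst ?p T) ** ?G ** sp_transpose T'"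
    unfolding S_def by (simp add: matrix_mul_assoc)
  also have "\<dots> = T ** (?G ** ?G) ** sp_transpose T'"
    unfolding NT by (simp add: matrix_mul_assoc)
  also have "\<dots> = mat 1" unfolding GG by (simp add: T_T'_transpose)
  finally show ?thesis .
qed

text \<open>RTT at v = -u, where u - v = 2u.\<close>

lemma comm_T_N: "comm (T $ i $ j) (N $ k $ l) = fps_X * (T $ k $ j * N $ i $ l - N $ k $ j * T $ i $ l)"
proof -
  let ?Z = "T $ k $ j * N $ i $ l - N $ k $ j * T $ i $ l"
  have "(- fps_X - fps_X) * comm (T $ i $ j) (N $ k $ l) = fps_X * (- fps_X * (2 * ?Z))"
    using rtt_subst[OF unit_lead rtt, of fps_X "- fps_X" i j k l]
    unfolding fps_subst_X by (simp add: of_int_fps_simps)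
  then have "fps_X * (2 * comm (T $ i $ j) (N $ k $ l)) = fps_X * (2 * (fps_X * ?Z))"
    by (simp add: mult_2 algebra_simps)
  then show ?thesis by (blast dest: fps_X_cancel fps_two_cancel)
qed

lemma N_N: "N $ i $ j oi (- fps_X) = T $ i $ j"
  by (simp add: fps_subst_assoc fps_compose_uminus fps_subst_X)

lemma S_minus:
  "S $ N1 $ P1 oi (- fps_X) = - (N $ N1 $ N1 * T $ N1 $ P1) - N $ N1 $ P1 * T $ N1 $ N1"
  "S $ P1 $ N1 oi (- fps_X) = N $ P1 $ N1 * T $ P1 $ P1 + N $ P1 $ P1 * T $ P1 $ N1"
  "S $ P1 $ P1 oi (- fps_X) = - (N $ P1 $ N1 * T $ N1 $ P1) - N $ P1 $ P1 * T $ N1 $ N1"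
  unfolding S_entries fps_compose_sub_distrib fps_compose_add_distrib fps_compose_uminus
  by (simp_all add: fps_subst_mult N_N[simplified] )

text \<open>By \<open>comm_T_N\<close> the difference d of S(w) and S(-w) in these positions
  satisfies d = w^-1 d, hence vanishes.\<close>

lemma S_even: "S $ N1 $ P1 oi (- fps_X) = S $ N1 $ P1" "S $ P1 $ N1 oi (- fps_X) = S $ P1 $ N1"
proof -
  note c = comm_T_N[unfolded comm_def]
  have "S $ N1 $ P1 - S $ N1 $ P1 oi (- fps_X) = fps_X * (S $ N1 $ P1 - S $ N1 $ P1 oi (- fps_X))"
    unfolding S_minus unfolding S_entries using c[of N1 N1 N1 P1] c[of N1 P1 N1 N1]
    by (simp add: algebra_simps)
  then show "S $ N1 $ P1 oi (- fps_X) = S $ N1 $ P1"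
    using eq_fps_X_mult_self by (metis eq_iff_diff_eq_0)
  have "S $ P1 $ N1 - S $ P1 $ N1 oi (- fps_X) = fps_X * (S $ P1 $ N1 - S $ P1 $ N1 oi (- fps_X))"
    unfolding S_minus unfolding S_entries using c[of P1 N1 P1 P1] c[of P1 P1 P1 N1]
    by (simp add: algebra_simps)
  then show "S $ P1 $ N1 oi (- fps_X) = S $ P1 $ N1"
    using eq_fps_X_mult_self by (metis eq_iff_diff_eq_0)
qed

text \<open>The diagonal counterpart of \<open>S_even\<close>, again from RTT at v = -u. Read at odd
  and even orders it becomes \<open>A_D_odd\<close> and \<open>A_D_even\<close>.\<close>

lemma S_diagonal_symmetry:
  "S $ N1 $ N1 + S $ P1 $ P1 oi (- fps_X) = fps_X * (S $ P1 $ P1 oi (- fps_X) - S $ P1 $ P1)"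
proof -
  note c = comm_T_N[unfolded comm_def]
  show ?thesis
    unfolding S_minus unfolding S_entries using c[of N1 N1 P1 P1] c[of N1 P1 P1 N1]
    by (simp add: algebra_simps)
qed

end


lemma sign_power_commute: "(- 1) ^ n * x * y = (- 1) ^ n * (x * y)" "x * ((- 1) ^ n * y) = (- 1) ^ n * (x * (y::'b::ring_1))"
  by (simp_all add: minus_one_power_iff)

lemma comm_sign: "comm x ((- 1) ^ n * y) = (- 1) ^ n * comm x (y :: 'b::ring_1)"
  by (simp add: minus_one_power_iff comm_minus_right)

lemma comm_fps_const_nth: "fps_nth (comm (fps_const x) f) n = comm x (fps_nth f n)"
  by (simp add: comm_def)

lemma two_mult_nth: "fps_nth (2 * f) n = 2 * (fps_nth f n :: 'b::ring_1)"
  by (simp add: mult_2)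

lemma nth_X_mult: "fps_nth (fps_X * (f :: 'b::ring_1 fps)) n = (case n of 0 \<Rightarrow> 0 | Suc m \<Rightarrow> fps_nth f m)"
  by (simp split: nat.split)

lemma fps_const_combine: "fps_const x * fps_const y + fps_const y * fps_const x - 2 * fps_const z = fps_const (x * y + y * x - 2 * (z::'b::ring_1))"
  "2 * fps_const z = fps_const (2 * z)"
  by (simp_all only: mult_2 fps_const_add fps_const_sub fps_const_mult)

lemma coeff_X_mult: "fps_X * comm (fps_const x) f = g \<Longrightarrow> comm x (fps_nth f n) = fps_nth g (Suc n)"
  by (drule arg_cong[where f = "\<lambda>f. fps_nth f (Suc n)"]) (simp add: comm_fps_const_nth)

lemma four_mult_nth: "fps_nth (- 4 * f) n = - 4 * (fps_nth f n :: 'b::ring_1)"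
proof -
  have "4 * f = 2 * (2 * f)" "4 * fps_nth f n = 2 * (2 * fps_nth f n)" by (simp_all flip: mult.assoc)
  then show ?thesis by (simp add: two_mult_nth)
qed

lemma X_central: "f * fps_X = fps_X * (f :: 'b::ring_1 fps)"
  by (rule fps_mult_fps_X_commute[symmetric])

context yangian
begin

abbreviation "A n \<equiv> fps_nth (S $ N1 $ N1) n"
abbreviation "B n \<equiv> fps_nth (S $ N1 $ P1) n"
abbreviation "C n \<equiv> fps_nth (S $ P1 $ N1) n"
abbreviation "D n \<equiv> fps_nth (S $ P1 $ P1) n"
abbreviation "\<tau> i j \<equiv> fps_nth (T $ i $ j) 1"
abbreviation "\<sigma> i j \<equiv> fps_nth (T $ i $ j) 2"

lemma N_nth: "fps_nth (N $ i $ j) n = (- 1) ^ n * fps_nth (T $ i $ j) n"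
  by (simp only: map_matrix_nth fps_subst_minus_X_nth)

lemma comm_tau: "comm (\<tau> i j) (fps_nth (T $ k $ l) n) =
    2 * ((if k = j then fps_nth (T $ i $ l) n else 0) - (if i = l then fps_nth (T $ k $ j) n else 0))"
  using rtt[of i j k l 0 n] unit_lead
  by (cases i; cases j; cases k; cases l; simp add: rtt_coeff_def eq_neg_iff_add_eq_0)

lemma comm_sigma: "comm (\<sigma> i j) (fps_nth (T $ k $ l) n) = comm (\<tau> i j) (fps_nth (T $ k $ l) (Suc n)) +
    2 * (\<tau> k j * fps_nth (T $ i $ l) n - fps_nth (T $ k $ j) n * \<tau> i l)"
  using rtt[of i j k l 1 n] by (simp add: rtt_coeff_def numeral_2_eq_2 algebra_simps)

text \<open>The coefficient of w^-1 in T(w) T(w+2)^t = 1; the shift by 2 is invisible at this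
  order.\<close>

lemma tau_trace: "\<tau> P1 P1 = - \<tau> N1 N1"
proof -
  have "fps_nth ((T ** sp_transpose T') $ N1 $ N1) 1 = 0"
    unfolding T_T'_transpose by (simp add: mat_ix_entry)
  moreover have "fps_nth (T' $ i $ j) 1 = \<tau> i j" "fps_nth (T' $ i $ j) 0 = fps_nth (T $ i $ j) 0" for i j
    by (simp_all add: fps_subst_nth recip_lin_def)
  ultimately show ?thesis
    using unit_lead by (simp add: mult_ix sp_transpose_entries fps_mult_nth eq_neg_iff_add_eq_0)
qed

lemma comm_tau_T: "comm (fps_const (\<tau> i j)) (T $ k $ l) =
    2 * ((if k = j then T $ i $ l else 0) - (if i = l then T $ k $ j else 0))"
  by (rule fps_ext) (simp only: comm_fps_const_nth comm_tau two_mult_nth, simp)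

lemma comm_tau_N: "comm (fps_const (\<tau> i j)) (N $ k $ l) =
    2 * ((if k = j then N $ i $ l else 0) - (if i = l then N $ k $ j else 0))"
proof (rule fps_ext)
  fix n
  show "fps_nth (comm (fps_const (\<tau> i j)) (N $ k $ l)) n =
      fps_nth (2 * ((if k = j then N $ i $ l else 0) - (if i = l then N $ k $ j else 0))) n"
    unfolding comm_fps_const_nth N_nth comm_sign comm_tau two_mult_nth fps_sub_nth if_distrib[of "\<lambda>f. fps_nth f n"]
    by (simp add: minus_one_power_iff)
qed

lemma comm_sigma_T: "fps_X * comm (fps_const (\<sigma> i j)) (T $ k $ l) = comm (fps_const (\<tau> i j)) (T $ k $ l) +
    fps_X * (2 * (fps_const (\<tau> k j) * T $ i $ l - T $ k $ j * fps_const (\<tau> i l)))"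
proof (rule fps_ext)
  fix n
  show "fps_nth (fps_X * comm (fps_const (\<sigma> i j)) (T $ k $ l)) n = fps_nth (comm (fps_const (\<tau> i j)) (T $ k $ l) +
    fps_X * (2 * (fps_const (\<tau> k j) * T $ i $ l - T $ k $ j * fps_const (\<tau> i l)))) n"
    unfolding fps_add_nth nth_X_mult comm_fps_const_nth two_mult_nth comm_sigma
    using unit_lead by (cases n) simp_all
qed

lemma comm_sigma_N: "fps_X * comm (fps_const (\<sigma> i j)) (N $ k $ l) =
    fps_X * (2 * (fps_const (\<tau> k j) * N $ i $ l - N $ k $ j * fps_const (\<tau> i l))) - comm (fps_const (\<tau> i j)) (N $ k $ l)"
proof (rule fps_ext)
  fix n
  show "fps_nth (fps_X * comm (fps_const (\<sigma> i j)) (N $ k $ l)) n =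
      fps_nth (fps_X * (2 * (fps_const (\<tau> k j) * N $ i $ l - N $ k $ j * fps_const (\<tau> i l))) - comm (fps_const (\<tau> i j)) (N $ k $ l)) n"
    unfolding fps_sub_nth nth_X_mult comm_fps_const_nth two_mult_nth N_nth comm_sign comm_sigma
    using unit_lead
    by (cases n) (simp_all add: N_nth[simplified] sign_power_commute, simp add: minus_one_power_iff algebra_simps)
qed

lemma S_low:
  "A 0 = 1" "D 0 = - 1" "B 0 = 0" "C 0 = 0" "B 1 = 0" "C 1 = 0" "A 1 = 2 * \<tau> N1 N1" "D 1 = 2 * \<tau> N1 N1"
  "B 2 = \<tau> N1 N1 * \<tau> N1 P1 + \<tau> N1 P1 * \<tau> N1 N1 - 2 * \<sigma> N1 P1"
  "C 2 = 2 * \<sigma> P1 N1 + \<tau> P1 N1 * \<tau> N1 N1 + \<tau> N1 N1 * \<tau> P1 N1"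
proof -
  have e: "fps_nth (f * g) 1 = fps_nth f 0 * fps_nth g 1 + fps_nth f 1 * fps_nth g 0"
    "fps_nth (f * g) 2 = fps_nth f 0 * fps_nth g 2 + fps_nth f 1 * fps_nth g 1 + fps_nth f 2 * fps_nth g 0" for f g :: "'a fps"
    by (simp_all add: fps_mult_nth numeral_2_eq_2)
  note r = S_entries fps_add_nth fps_sub_nth fps_neg_nth fps_mult_nth_0 e N_nth
  show "A 0 = 1" "D 0 = - 1" "B 0 = 0" "C 0 = 0" "B 1 = 0" "C 1 = 0" "A 1 = 2 * \<tau> N1 N1" "D 1 = 2 * \<tau> N1 N1"
    "B 2 = \<tau> N1 N1 * \<tau> N1 P1 + \<tau> N1 P1 * \<tau> N1 N1 - 2 * \<sigma> N1 P1"
    "C 2 = 2 * \<sigma> P1 N1 + \<tau> P1 N1 * \<tau> N1 N1 + \<tau> N1 N1 * \<tau> P1 N1"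
    unfolding r using unit_lead tau_trace by (simp_all add: mult_2)
qed

text \<open>The coefficient of w^-(n+1) in \<open>reflection_aux\<close>.\<close>

lemma comm_B2:
  "comm (B 2) (A n) = - 4 * (B (Suc n) + B n + B n * A 1)"
  "comm (B 2) (B n) = 0"
  "comm (B 2) (D n) = - 4 * (B (Suc n) + B n - A 1 * B n)"
  "comm (B 2) (C n) = - 4 * (A (Suc n) + D (Suc n) + A n + D n - A 1 * A n + D n * A 1)"
proof -
  have x: "fps_nth (fps_X * f * fps_const c) (Suc n) = fps_nth f n * c" "fps_nth (fps_X * fps_const c * f) (Suc n) = c * fps_nth f n"
     for f :: "'a fps" and c by (simp_all add: mult.assoc)
  note R = reflection_aux[of fps_X "\<lambda>i j. fps_const (\<tau> i j)" "\<lambda>i j. T $ i $ j" "\<lambda>i j. N $ i $ j"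
    "\<lambda>i j. fps_const (\<sigma> i j)" "fps_const (B 2)" "fps_const (A 1)" "\<lambda>i j. S $ i $ j",
    OF X_central comm_tau_T comm_tau_N comm_sigma_T comm_sigma_N _ _ _ S_entries]
  have tr: "fps_const (\<tau> P1 P1) = - fps_const (\<tau> N1 N1)" by (simp only: tau_trace fps_const_neg)
  have b: "fps_const (B 2) = fps_const (\<tau> N1 N1) * fps_const (\<tau> N1 P1) + fps_const (\<tau> N1 P1) * fps_const (\<tau> N1 N1) - 2 * fps_const (\<sigma> N1 P1)"
    unfolding S_low(9) by (rule fps_const_combine(1)[symmetric])
  have a: "fps_const (A 1) = 2 * fps_const (\<tau> N1 N1)" unfolding S_low(7) fps_const_combine(2) ..
  note R = R[OF tr b a]
  show "comm (B 2) (A n) = - 4 * (B (Suc n) + B n + B n * A 1)"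
    using coeff_X_mult[OF R(1), of n] unfolding four_mult_nth by (simp add: distrib_right x)
  show "comm (B 2) (B n) = 0"
    using coeff_X_mult[OF R(2), of n] by simp
  show "comm (B 2) (D n) = - 4 * (B (Suc n) + B n - A 1 * B n)"
    using coeff_X_mult[OF R(3), of n] unfolding four_mult_nth by (simp add: distrib_right x)
  show "comm (B 2) (C n) = - 4 * (A (Suc n) + D (Suc n) + A n + D n - A 1 * A n + D n * A 1)"
    using coeff_X_mult[OF R(4), of n] unfolding four_mult_nth by (simp add: distrib_right distrib_left x algebra_simps)
qed

text \<open>Negating all indices turns G into -G, hence S into -S with its indices negated. So
  \<open>reflection_aux\<close> applies again, with -C_2 in place of b and -A_1 in place of
  a.\<close>

lemma comm_C2:
  "comm (C 2) (D n) = 4 * (C (Suc n) + C n - C n * A 1)"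
  "comm (C 2) (C n) = 0"
  "comm (C 2) (A n) = 4 * (C (Suc n) + C n + A 1 * C n)"
  "comm (C 2) (B n) = 4 * (A (Suc n) + D (Suc n) + A n + D n + A 1 * D n - A n * A 1)"
proof -
  have x: "fps_nth (fps_X * f * fps_const c) (Suc n) = fps_nth f n * c" "fps_nth (fps_X * fps_const c * f) (Suc n) = c * fps_nth f n"
     for f :: "'a fps" and c by (simp_all add: mult.assoc)
  have neg: "(ix_neg k = ix_neg j) = (k = j)" for k j by (cases k; cases j) simp_all
  note R = reflection_aux[of fps_X "\<lambda>i j. fps_const (\<tau> (ix_neg i) (ix_neg j))" "\<lambda>i j. T $ ix_neg i $ ix_neg j" "\<lambda>i j. N $ ix_neg i $ ix_neg j"
    "\<lambda>i j. fps_const (\<sigma> (ix_neg i) (ix_neg j))" "fps_const (- C 2)" "fps_const (- A 1)" "\<lambda>i j. - S $ ix_neg i $ ix_neg j",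
    unfolded ix_neg.simps,
    OF X_central comm_tau_T[of "ix_neg _" "ix_neg _" "ix_neg _" "ix_neg _", unfolded neg]
       comm_tau_N[of "ix_neg _" "ix_neg _" "ix_neg _" "ix_neg _", unfolded neg] comm_sigma_T comm_sigma_N]
  have tr: "fps_const (\<tau> N1 N1) = - fps_const (\<tau> P1 P1)" unfolding tau_trace by simp
  have b: "fps_const (- C 2) = fps_const (\<tau> P1 P1) * fps_const (\<tau> P1 N1) + fps_const (\<tau> P1 N1) * fps_const (\<tau> P1 P1) - 2 * fps_const (\<sigma> P1 N1)"
    unfolding fps_const_combine(1) S_low(10) tau_trace by (simp add: algebra_simps)
  have a: "fps_const (- A 1) = 2 * fps_const (\<tau> P1 P1)" unfolding S_low(7) fps_const_combine(2) tau_trace by simp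
  note R = R[OF tr b a]
  have s: "- S $ P1 $ P1 = T $ P1 $ P1 * N $ N1 $ N1 + T $ P1 $ N1 * N $ N1 $ P1"
    "- S $ P1 $ N1 = - (T $ P1 $ P1 * N $ P1 $ N1) - T $ P1 $ N1 * N $ P1 $ P1"
    "- S $ N1 $ P1 = T $ N1 $ P1 * N $ N1 $ N1 + T $ N1 $ N1 * N $ N1 $ P1"
    "- S $ N1 $ N1 = - (T $ N1 $ P1 * N $ P1 $ N1) - T $ N1 $ N1 * N $ P1 $ P1"
    unfolding S_entries by simp_all
  note R = R[OF s]
  have c: "comm (- x) (fps_nth (- f) n) = comm x (fps_nth f n)" for x and f :: "'a fps"
    by (simp add: comm_minus_left comm_minus_right)
  show "comm (C 2) (D n) = 4 * (C (Suc n) + C n - C n * A 1)"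
    using coeff_X_mult[OF R(1), of n] unfolding four_mult_nth c by (simp add: distrib_right x algebra_simps del: fps_const_neg)
  show "comm (C 2) (C n) = 0"
    using coeff_X_mult[OF R(2), of n] unfolding c by simp
  show "comm (C 2) (A n) = 4 * (C (Suc n) + C n + A 1 * C n)"
    using coeff_X_mult[OF R(3), of n] unfolding four_mult_nth c by (simp add: distrib_right x algebra_simps)
  show "comm (C 2) (B n) = 4 * (A (Suc n) + D (Suc n) + A n + D n + A 1 * D n - A n * A 1)"
    using coeff_X_mult[OF R(4), of n] unfolding four_mult_nth c by (simp add: distrib_right distrib_left x algebra_simps)
qed

end


section \<open>The Serre relations for A_1, B_2, C_2, and generation by these three elements\<close>

lemma four_cancel: "4 * x = 4 * y \<Longrightarrow> x = (y :: 'a::complex_algebra_1)"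
proof -
  assume "4 * x = 4 * y"
  moreover have "4 * z = 2 * (2 * z)" for z :: 'a by (simp flip: mult.assoc)
  ultimately show ?thesis by (metis two_cancel)
qed

lemma comm_numeral_mult: "comm x (numeral n * y) = numeral n * comm x (y :: 'a::complex_algebra_1)"
  by (simp add: comm_scaleC_right flip: scaleC_numeral)

text \<open>Since b a = (a + c) b, each bracket with b takes a difference with step c. The second
  difference of the cube is 6 c^2 (a + c), and (a + c) b b = b a b.\<close>

lemma double_comm_cube:
  fixes a b :: "'a::complex_algebra_1"
  assumes "comm b a = c *\<^sub>C b"
  shows "comm b (comm b (a * a * a)) = (6 * c * c) *\<^sub>C (b * a * b)"
proof -
  have ab: "a * b = b * a - c *\<^sub>C b"
    using assms by (simp add: comm_def algebra_simps)
  have ab': "a * (b * y) = b * (a * y) - c *\<^sub>C (b * y)" for y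
    using arg_cong[OF ab, of "\<lambda>z. z * y"] by (simp add: left_diff_distrib mult.assoc mult_scaleC_left)
  show ?thesis
    by (simp add: comm_mult_right assms comm_add_right comm_scaleC_right mult_scaleC_left mult_scaleC_right
        distrib_left distrib_right scaleC_scaleC mult.assoc)
      (simp add: ab ab' right_diff_distrib left_diff_distrib mult.assoc mult_scaleC_right mult_scaleC_left
        cvs.scale_right_diff_distrib scaleC_scaleC mult.assoc scaleC_add_right algebra_simps flip: cvs.scale_left_distrib)
qed

context yangian
begin

lemma B_C_odd: "odd n \<Longrightarrow> B n = 0" "odd n \<Longrightarrow> C n = 0"
proof -
  have "fps_nth (S $ N1 $ P1 oi (- fps_X)) n = B n" "fps_nth (S $ P1 $ N1 oi (- fps_X)) n = C n"
    by (simp_all only: S_even)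
  then show "odd n \<Longrightarrow> B n = 0" "odd n \<Longrightarrow> C n = 0"
    unfolding fps_subst_minus_X_nth using two_cancel[of "B n" 0] two_cancel[of "C n" 0]
    by (simp_all add: mult_2 add_eq_0_iff2)
qed

lemma A_D_odd: "odd n \<Longrightarrow> A n = D n"
  and A_D_even: "even n \<Longrightarrow> A (Suc (Suc n)) + D (Suc (Suc n)) = - 2 * D (Suc n)"
proof -
  have e: "fps_nth (S $ N1 $ N1) m + (- 1) ^ m * D m = (case m of 0 \<Rightarrow> 0 | Suc m \<Rightarrow> (- 1) ^ m * D m - D m)" for m
    using arg_cong[OF S_diagonal_symmetry, of "\<lambda>f. fps_nth f m"]
    unfolding fps_add_nth nth_X_mult fps_sub_nth fps_subst_minus_X_nth .
  show "A n = D n" if "odd n"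
    using e[of n] that by (auto elim!: oddE)
  show "A (Suc (Suc n)) + D (Suc (Suc n)) = - 2 * D (Suc n)" if "even n"
    using e[of "Suc (Suc n)"] that by (simp add: mult_2)
qed

text \<open>The argument -w-2 of the second factor in \<open>unitarity\<close>.\<close>

abbreviation (input) "inv_pt \<equiv> recip_lin (- 1) (- 2) :: int fps"

lemma unitarity_coeff:
  "(\<Sum>i=0..n. A i * fps_nth (S $ N1 $ N1 oi inv_pt) (n - i)) + (\<Sum>i=0..n. B i * fps_nth (S $ P1 $ N1 oi inv_pt) (n - i)) =
    (if n = 0 then 1 else 0)"
  using arg_cong[OF unitarity, of "\<lambda>M. fps_nth (M $ N1 $ N1) n"]
  by (simp add: mult_ix mat_ix_entry fps_mult_nth)

lemma A_2: "2 * A 2 = A 1 * A 1 - 2 * A 1"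
proof -
  have p: "fps_nth inv_pt (Suc 0) = - 1" "fps_nth inv_pt 2 = 2" "fps_nth (inv_pt ^ 2) 2 = 1"
    by (simp_all add: recip_lin_def power2_eq_square fps_mult_nth numeral_2_eq_2)
  have "fps_nth (S $ N1 $ N1 oi inv_pt) 1 = - A 1" "fps_nth (S $ N1 $ N1 oi inv_pt) 2 = 2 * A 1 + A 2"
    "fps_nth (S $ N1 $ N1 oi inv_pt) 0 = 1" "fps_nth (S $ P1 $ N1 oi inv_pt) 0 = 0"
    using S_low p by (simp_all add: fps_subst_nth numeral_2_eq_2 mult_2_right mult_2)
  then show ?thesis
    using unitarity_coeff[of 2] S_low B_C_odd(1)[of 1]
    by (simp add: numeral_2_eq_2 mult_2 algebra_simps)
qed

lemma comm_B2_A1: "comm (B 2) (A 1) = - 4 * B 2"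
  using comm_B2(1)[of 1] B_C_odd(1)[of 1] by (simp add: numeral_2_eq_2)

lemma comm_C2_A1: "comm (C 2) (A 1) = 4 * C 2"
  using comm_C2(3)[of 1] B_C_odd(2)[of 1] by (simp add: numeral_2_eq_2)

text \<open>The case n = 2 of \<open>comm_B2\<close>, with D_2 and D_3 expressed through A by the
  diagonal symmetry and A_2 removed by \<open>A_2\<close>. What matters is the shape: a multiple of
  A_3, which two further brackets annihilate, plus a polynomial in A_1.\<close>

lemma comm_B2_C2: "comm (B 2) (C 2) = - 8 * A 3 + 8 * A 1 + 4 * (A 1 * A 1 * A 1)"
proof -
  have 3: "D 3 = A 3" "D 1 = A 1" using A_D_odd[of 3] A_D_odd[of 1] by simp_all
  have 2: "D 2 = - 2 * A 1 - A 2" using A_D_even[of 0] 3 by (simp add: numeral_2_eq_2 algebra_simps)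
  have "A 1 * A 2 + A 2 * A 1 = A 1 * A 1 * A 1 - 2 * (A 1 * A 1)"
  proof (rule two_cancel)
    have "2 * (A 1 * A 2 + A 2 * A 1) = A 1 * (2 * A 2) + 2 * A 2 * A 1" by (simp add: mult_2 algebra_simps)
    also have "\<dots> = 2 * (A 1 * A 1 * A 1 - 2 * (A 1 * A 1))" unfolding A_2 by (simp add: mult_2 mult_2_right algebra_simps)
    finally show "2 * (A 1 * A 2 + A 2 * A 1) = 2 * (A 1 * A 1 * A 1 - 2 * (A 1 * A 1))" .
  qed
  then have e: "A 2 * A 1 = A 1 * A 1 * A 1 - 2 * (A 1 * A 1) - A 1 * A 2" by (simp add: algebra_simps)
  have "A 3 + D 3 + A 2 + D 2 - A 1 * A 2 + D 2 * A 1 = 2 * A 3 - 2 * A 1 - A 1 * A 1 * A 1"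
    unfolding 3 2 using e by (simp add: mult_2 algebra_simps)
  then have "comm (B 2) (C 2) = - 4 * (2 * A 3 - 2 * A 1 - A 1 * A 1 * A 1)"
    using comm_B2(4)[of 2] by (simp add: numeral_3_eq_3 numeral_2_eq_2)
  also have "\<dots> = - 8 * A 3 + 8 * A 1 + 4 * (A 1 * A 1 * A 1)"
    by (simp add: right_diff_distrib flip: mult.assoc)
  finally show ?thesis .
qed

text \<open>Since B_3 = 0, [B_2, A_3] = -4 B_4 commutes with B_2, and so does [B_2, A_1] = -4 B_2.
  Only 4 A_1^3 survives, with coefficient 4 times 96 by \<open>double_comm_cube\<close>.\<close>

lemma triple_comm_B2: "comm (B 2) (comm (B 2) (comm (B 2) (C 2))) = 384 *\<^sub>C (B 2 * A 1 * B 2)"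
proof -
  have B3: "comm (B 2) (A 3) = - 4 * B 4"
  proof -
    have "B 3 = 0" "Suc 3 = 4" by (simp_all add: B_C_odd(1))
    then show ?thesis using comm_B2(1)[of 3] by simp
  qed
  have "comm (B 2) (comm (B 2) (A 3)) = 0" "comm (B 2) (comm (B 2) (A 1)) = 0"
    unfolding B3 comm_B2_A1 by (simp_all add: comm_numeral_mult comm_minus_right comm_B2(2))
  moreover have "comm (B 2) (comm (B 2) (A 1 * A 1 * A 1)) = 96 *\<^sub>C (B 2 * A 1 * B 2)"
    using double_comm_cube[of "B 2" "A 1" "- 4"] comm_B2_A1 by (simp add: scaleC_numeral)
  ultimately show ?thesis
    unfolding comm_B2_C2
    by (simp add: comm_add_right comm_diff_right comm_scaleC_right scaleC_scaleC flip: scaleC_numeral)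
      (simp add: scaleC_complex_def)
qed

lemma triple_comm_C2: "comm (C 2) (comm (C 2) (comm (B 2) (C 2))) = 384 *\<^sub>C (C 2 * A 1 * C 2)"
proof -
  have C3: "comm (C 2) (A 3) = 4 * C 4"
  proof -
    have "C 3 = 0" "Suc 3 = 4" by (simp_all add: B_C_odd(2))
    then show ?thesis using comm_C2(3)[of 3] by simp
  qed
  have "comm (C 2) (comm (C 2) (A 3)) = 0" "comm (C 2) (comm (C 2) (A 1)) = 0"
    unfolding C3 comm_C2_A1 by (simp_all add: comm_numeral_mult comm_C2(2))
  moreover have "comm (C 2) (comm (C 2) (A 1 * A 1 * A 1)) = 96 *\<^sub>C (C 2 * A 1 * C 2)"
    using double_comm_cube[of "C 2" "A 1" "4"] comm_C2_A1 by (simp add: scaleC_numeral)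
  ultimately show ?thesis
    unfolding comm_B2_C2
    by (simp add: comm_add_right comm_diff_right comm_scaleC_right scaleC_scaleC flip: scaleC_numeral)
      (simp add: scaleC_complex_def)
qed

text \<open>Induction on n: the brackets [B_2, A_m], [C_2, A_m] and [B_2, C_m] give B, C and A + D
  at index m + 1. To separate A from D, use A_n = D_n for odd n and unitarity for even n.\<close>

lemma generated_coeffs:
  assumes Q: "subalgebra Q" and gens: "A 1 \<in> Q" "B 2 \<in> Q" "C 2 \<in> Q"
  shows "fps_nth (S $ i $ j) n \<in> Q"
proof -
  note QD = subalgebraD[OF Q]
  have comm: "x \<in> Q \<Longrightarrow> y \<in> Q \<Longrightarrow> comm x y \<in> Q" for x y
    unfolding comm_def by (intro QD)
  have four: "x \<in> Q" if "4 * x \<in> Q" for x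
    using QD(4)[OF that, of "1/4"] by (simp add: scaleC_one scaleC_scaleC flip: scaleC_numeral)
  have two: "x \<in> Q" if "x + x \<in> Q" for x
  proof -
    have "(1/2) *\<^sub>C (x + x) = (1/2 + 1/2) *\<^sub>C x" by (simp only: scaleC_add_right scaleC_add_left)
    then show ?thesis using QD(4)[OF that, of "1/2"] by (simp add: scaleC_one)
  qed
  have diff: "x \<in> Q" if "x + y \<in> Q" "y \<in> Q" for x y using QD(7)[OF that] by simp
  have "A n \<in> Q \<and> B n \<in> Q \<and> C n \<in> Q \<and> D n \<in> Q" for n
  proof (induction n rule: less_induct)
    case (less n)
    show ?case
    proof (cases n)
      case 0
      then show ?thesis using S_low QD by simp
    next
      case (Suc m)
      have m: "A m \<in> Q" "B m \<in> Q" "C m \<in> Q" "D m \<in> Q" using less Suc by auto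
      have B: "B n \<in> Q"
      proof -
        have "4 * (B n + B m + B m * A 1) = - comm (B 2) (A m)" unfolding comm_B2(1) Suc by simp
        then have "B n + B m + B m * A 1 \<in> Q" using comm[OF gens(2) m(1)] four QD(6) by metis
        then show ?thesis using diff[OF _ m(2)] diff[OF _ QD(3)[OF m(2) gens(1)]] by blast
      qed
      have C: "C n \<in> Q"
      proof -
        have "4 * (C n + C m + A 1 * C m) = comm (C 2) (A m)" unfolding comm_C2(3) Suc by simp
        then have "C n + C m + A 1 * C m \<in> Q" using comm[OF gens(3) m(1)] four by metis
        then show ?thesis using diff[OF _ m(3)] diff[OF _ QD(3)[OF gens(1) m(3)]] by blast
      qed
      have AD: "A n + D n \<in> Q"
      proof -
        have "4 * (A n + D n + (A m + D m - A 1 * A m + D m * A 1)) = - comm (B 2) (C m)"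
          unfolding comm_B2(4) Suc by (simp add: algebra_simps)
        then have "A n + D n + (A m + D m - A 1 * A m + D m * A 1) \<in> Q"
          using comm[OF gens(2) m(3)] four QD(6) by metis
        moreover have "A m + D m - A 1 * A m + D m * A 1 \<in> Q"
          by (rule QD(2)[OF QD(7)[OF QD(2)[OF m(1,4)] QD(3)[OF gens(1) m(1)]] QD(3)[OF m(4) gens(1)]])
        ultimately show ?thesis by (rule diff)
      qed
      have A: "A n \<in> Q"
      proof (cases "odd n")
        case True
        then have "A n + A n \<in> Q" using AD by (simp add: A_D_odd)
        then show ?thesis by (rule two)
      next
        case False
        have sub: "fps_nth (S $ k $ N1 oi inv_pt) l \<in> Q" if "l < n \<or> k = P1" "l \<le> n" for k l
        proof -
          have "fps_nth (S $ k $ N1) i \<in> Q" if "i \<le> l" for i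
            using less[of i] C that \<open>l < n \<or> k = P1\<close> \<open>l \<le> n\<close> by (cases k; cases "i = n") auto
          then show ?thesis unfolding fps_subst_nth by (intro subalgebra_sum[OF Q] QD) auto
        qed
        \<comment> \<open>For even n the substitution w -> -w-2 keeps the sign of A_n, so A_n enters
          the unitarity relation once from each factor and the two do not cancel.\<close>
        have "fps_nth (inv_pt ^ n) n = (- 1) ^ n"
          by (subst startsby_zero_power_nth_same) (simp_all add: recip_lin_def)
        then have top: "fps_nth (S $ N1 $ N1 oi inv_pt) n = (\<Sum>i=0..<n. A i * of_int (fps_nth (inv_pt ^ i) n)) + A n"
          using False unfolding fps_subst_nth by (simp add: sum.last_plus add.commute)
        have split: "(\<Sum>i=0..n. A i * fps_nth (S $ N1 $ N1 oi inv_pt) (n - i)) =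
            fps_nth (S $ N1 $ N1 oi inv_pt) n + (\<Sum>i=1..<n. A i * fps_nth (S $ N1 $ N1 oi inv_pt) (n - i)) + A n"
        proof -
          have "{0..n} = insert 0 (insert n {1..<n})" using Suc by auto
          then show ?thesis using Suc S_low by (simp add: add_ac)
        qed
        let ?L = "(\<Sum>i=0..<n. A i * of_int (fps_nth (inv_pt ^ i) n)) + (\<Sum>i=1..<n. A i * fps_nth (S $ N1 $ N1 oi inv_pt) (n - i)) +
          (\<Sum>i=0..n. B i * fps_nth (S $ P1 $ N1 oi inv_pt) (n - i))"
        have "(A n + A n) + ?L = 0"
          using unitarity_coeff[of n] Suc unfolding split top by (simp add: add_ac)
        then have eq: "A n + A n = - ?L" by (simp only: eq_neg_iff_add_eq_0)
        have L: "?L \<in> Q"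
        proof (intro QD subalgebra_sum[OF Q])
          show "B i \<in> Q" if "i \<in> {0..n}" for i using less[of i] B that by (cases "i = n") auto
        qed (use less sub in auto)
        have "A n + A n \<in> Q" unfolding eq by (rule QD(6)[OF L])
        then show ?thesis by (rule two)
      qed
      then have "D n \<in> Q" using AD diff[of "D n" "A n"] by (simp add: add.commute)
      then show ?thesis using A B C by blast
    qed
  qed
  then show ?thesis by (cases i; cases j) auto
qed

end

section \<open>Passage from S to Sigma and its Gauss coefficients\<close>

interpretation Y: yangian T_Y
  by standard (rule yangian_matrix_T_Y)

lemma Sigma_Y_eq: "Sigma_Y = msubst (recip_lin 1 (- 1)) Y.S"
proof -
  have G: "msubst (recip_lin 1 (- 1)) (mat2 1 0 0 (- 1)) = (mat2 1 0 0 (- 1) :: Y_sp2 fps^ix^ix)"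
    by (simp add: mat_eq_ix mat2_def fps_compose_uminus)
  have "msubst (recip_lin 1 (- 1)) Y.N = subst_lin (- 1) 1 T_Y"
    by (simp add: subst_lin_eq_msubst msubst_msubst fps_compose_uminus recip_lin_minus[of 1 "- 1", simplified])
  then show ?thesis
    by (simp add: Sigma_Y_def Y.S_def msubst_mult msubst_sp_transpose G subst_lin_eq_msubst)
qed

text \<open>B and C start at order w^-2, so their leading coefficients change neither under the
  shift w = u - 1 nor when the factor k(u), with constant term 1, is split off. Superscript 1 is the
  order u^-2.\<close>

lemma gauss_coeffs: "k_coeff 0 = Y.A 1" "e_coeff 1 = Y.B 2" "f_coeff 1 = Y.C 2"
proof -
  let ?r = "recip_lin 1 (- 1) :: int fps"
  have r: "fps_nth ?r (Suc 0) = 1" "fps_nth (?r ^ 2) 2 = 1" 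
    by (simp_all add: recip_lin_def power2_eq_square fps_mult_nth numeral_2_eq_2)
  have 1: "fps_nth (f oi ?r) 1 = fps_nth f 1" for f :: "Y_sp2 fps"
    using r by (simp add: fps_subst_nth)
  have 2: "fps_nth (f oi ?r) 2 = fps_nth f 2" if "fps_nth f 1 = 0" for f :: "Y_sp2 fps"
    using r that by (simp add: fps_subst_nth numeral_2_eq_2)
  have g: "k_Y = Sigma_Y $ N1 $ N1" "k_Y * e_Y = Sigma_Y $ N1 $ P1" "f_Y * k_Y = Sigma_Y $ P1 $ N1"
    using is_gauss_Sigma_Y by (simp_all add: is_gauss_iff)
  show "k_coeff 0 = Y.A 1"
    using 1[of "Y.S $ N1 $ N1"] by (simp add: k_coeff_def g Sigma_Y_eq)
  have "fps_nth (k_Y * e_Y) 1 = fps_nth e_Y 1" "fps_nth (f_Y * k_Y) 1 = fps_nth f_Y 1"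
    using gauss_leading_terms by (simp_all add: fps_mult_nth)
  then have 0: "fps_nth e_Y 1 = 0" "fps_nth f_Y 1 = 0"
    unfolding g(2,3) Sigma_Y_eq map_matrix_nth 1 Y.S_low by simp_all
  have "fps_nth (k_Y * e_Y) 2 = fps_nth e_Y 2" "fps_nth (f_Y * k_Y) 2 = fps_nth f_Y 2"
    using gauss_leading_terms 0 by (simp_all add: fps_mult_nth numeral_2_eq_2)
  then show "e_coeff 1 = Y.B 2" "f_coeff 1 = Y.C 2"
    unfolding g(2,3) Sigma_Y_eq map_matrix_nth 2[OF Y.S_low(5)] 2[OF Y.S_low(6)] e_coeff_def f_coeff_def
    by (simp_all add: numeral_2_eq_2)
qed

text \<open>Coefficients of Sigma are integral combinations of those of S, so
  \<open>generated_coeffs\<close> bounds \<open>Y_tw\<close> from above. Conversely the three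
  generators are themselves low coefficients of Sigma.\<close>

lemma Y_tw_eq: "Y_tw = subalgebra hull {Y.A 1, Y.B 2, Y.C 2}"
proof
  let ?Q = "subalgebra hull {Y.A 1, Y.B 2, Y.C 2}"
  have "fps_nth (Sigma_Y $ i $ j) n \<in> ?Q" for i j n
    unfolding Sigma_Y_eq map_matrix_nth
    by (rule fps_subst_in_subalgebra[OF subalgebra_hull], rule Y.generated_coeffs[OF subalgebra_hull]; rule hull_inc; simp)
  then show "Y_tw \<subseteq> ?Q"
    unfolding Y_tw_def by (intro hull_minimal subalgebra_hull) auto
  have \<Sigma>: "fps_nth (Sigma_Y $ i $ j) n \<in> Y_tw" for i j n
    unfolding Y_tw_def by (rule hull_inc) blast
  have "Y.A 1 \<in> Y_tw" "Y.B 2 \<in> Y_tw" "Y.C 2 \<in> Y_tw"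
  proof -
    let ?r = "recip_lin 1 (- 1) :: int fps"
    have r: "fps_nth ?r (Suc 0) = 1" "fps_nth (?r ^ 2) 2 = 1" 
      by (simp_all add: recip_lin_def power2_eq_square fps_mult_nth numeral_2_eq_2)
    have "fps_nth (Sigma_Y $ N1 $ N1) 1 = Y.A 1" "fps_nth (Sigma_Y $ N1 $ P1) 2 = Y.B 2"
      "fps_nth (Sigma_Y $ P1 $ N1) 2 = Y.C 2"
      unfolding Sigma_Y_eq map_matrix_nth using r Y.S_low by (simp_all add: fps_subst_nth numeral_2_eq_2)
    then show "Y.A 1 \<in> Y_tw" "Y.B 2 \<in> Y_tw" "Y.C 2 \<in> Y_tw" using \<Sigma> by metis+
  qed
  then show "?Q \<subseteq> Y_tw"
    unfolding Y_tw_def by (intro hull_minimal subalgebra_hull) auto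
qed

text \<open>The normalisation is fixed by 384/8^4 = 12/(2 * 8^2): both sides of each Serre relation
  acquire the coefficient -3/32.\<close>

lemma relations_hold:
  assumes g: "g Gk = (- 1 / 2) *\<^sub>C Y.A 1" "g GE = (1 / 8) *\<^sub>C Y.C 2" "g GF = (- 1 / 8) *\<^sub>C Y.B 2"
    and r: "r \<in> relators"
  shows "free_eval g r = 0"
proof -
  note h = algebra_homD[OF algebra_hom_free_eval[of g]] algebra_hom_comm[OF algebra_hom_free_eval[of g]]
  have num: "free_eval g (numeral n) = numeral n" for n
    using algebra_hom_of_nat[OF algebra_hom_free_eval[of g], of "numeral n"] by simp
  have a: "comm (Y.A 1) (Y.B 2) = 4 *\<^sub>C Y.B 2" "comm (Y.A 1) (Y.C 2) = (- 4) *\<^sub>C Y.C 2"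
    unfolding comm_swap[of "Y.A 1"] Y.comm_B2_A1 Y.comm_C2_A1 by (simp_all add: scaleC_numeral)
  have t: "comm (Y.C 2) (comm (Y.C 2) (comm (Y.B 2) (Y.C 2))) = 384 *\<^sub>C (Y.C 2 * (Y.A 1 * Y.C 2))"
    "comm (Y.B 2) (comm (Y.B 2) (comm (Y.B 2) (Y.C 2))) = 384 *\<^sub>C (Y.B 2 * (Y.A 1 * Y.B 2))"
    using Y.triple_comm_C2 Y.triple_comm_B2 by (simp_all add: mult.assoc)
  consider "r = comm (gen Gk) (gen GE) - 2 * gen GE" | "r = comm (gen Gk) (gen GF) - (- 2 * gen GF)"
    | "r = comm (gen GE) (comm (gen GE) (comm (gen GF) (gen GE))) - 12 * (gen GE * gen Gk * gen GE)"
    | "r = comm (gen GF) (comm (gen GF) (comm (gen GF) (gen GE))) - 12 * (gen GF * gen Gk * gen GF)"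
    using r by (auto simp: relators_ygen_def Let_def)
  then show ?thesis
    by cases (simp_all only: h num free_eval_gen g comm_scaleC_left comm_scaleC_right a t mult_scaleC_left
        mult_scaleC_right scaleC_scaleC mult.assoc minus_mult_left[symmetric],
        simp_all add: scaleC_scaleC flip: scaleC_numeral, simp_all add: scaleC_complex_def)
qed


section \<open>Brackets in the associated graded algebra: a twisted current algebra of sl_2\<close>

section \<open>A filtered form of the Serre relations\<close>

text \<open>
  \<open>V n\<close> is the part of filtration degree less than \<open>n\<close>.  Modulo lower degree the elements
  \<open>e i\<close>, \<open>f i\<close>, \<open>h i\<close> multiply like \<open>e z\<^sup>2\<^sup>i\<^sup>+\<^sup>1\<close>, \<open>f z\<^sup>2\<^sup>i\<^sup>+\<^sup>1\<close>, \<open>h z\<^sup>2\<^sup>i\<close> in the current algebra of \<open>sl\<^sub>2\<close>.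
\<close>

locale filtered_serre =
  fixes V :: "nat \<Rightarrow> 'a::complex_algebra_1 set" and k E F :: 'a
  assumes V_subspace: "cvs.subspace (V n)"
    and V_mono: "m \<le> n \<Longrightarrow> V m \<subseteq> V n"
    and V_mult_left: "x \<in> V (Suc m) \<Longrightarrow> y \<in> V n \<Longrightarrow> x * y \<in> V (m + n)"
    and V_mult_right: "x \<in> V m \<Longrightarrow> y \<in> V (Suc n) \<Longrightarrow> x * y \<in> V (m + n)"
    and k_V: "k \<in> V 1" and E_V: "E \<in> V 2" and F_V: "F \<in> V 2"
    and k_E: "comm k E = 2 *\<^sub>C E" and k_F: "comm k F = (- 2) *\<^sub>C F"
    and serre_E: "comm E (comm E (comm F E)) \<in> V 4"
    and serre_F: "comm F (comm F (comm F E)) \<in> V 4"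
begin

abbreviation "H \<equiv> comm E F"

primrec e :: "nat \<Rightarrow> 'a" where
  "e 0 = E" | "e (Suc i) = (1 / 2) *\<^sub>C comm H (e i)"

primrec f :: "nat \<Rightarrow> 'a" where
  "f 0 = F" | "f (Suc i) = (- 1 / 2) *\<^sub>C comm H (f i)"

definition h :: "nat \<Rightarrow> 'a" where
  "h i = (case i of 0 \<Rightarrow> k | Suc i \<Rightarrow> comm E (f i))"

lemma h_simps: "h 0 = k" "h (Suc i) = comm E (f i)" "h (Suc 0) = H"
  by (simp_all add: h_def)

lemma H_e: "comm H (e i) = 2 *\<^sub>C e (Suc i)" and H_f: "comm H (f i) = (- 2) *\<^sub>C f (Suc i)"
  by (simp_all add: scaleC_scaleC scaleC_one)

declare e.simps(2) [simp del] f.simps(2) [simp del]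

lemma V_add: "x \<in> V n \<Longrightarrow> y \<in> V n \<Longrightarrow> x + y \<in> V n"
  and V_diff: "x \<in> V n \<Longrightarrow> y \<in> V n \<Longrightarrow> x - y \<in> V n"
  and V_minus: "x \<in> V n \<Longrightarrow> - x \<in> V n"
  and V_scale: "x \<in> V n \<Longrightarrow> c *\<^sub>C x \<in> V n"
  and V_0 [simp]: "0 \<in> V n"
  using V_subspace by (simp_all add: cvs.subspace_add cvs.subspace_diff cvs.subspace_neg cvs.subspace_scale cvs.subspace_0)

lemma V_scale_iff: "c \<noteq> 0 \<Longrightarrow> c *\<^sub>C x \<in> V n \<longleftrightarrow> x \<in> V n"
  using V_scale[of "c *\<^sub>C x" n "1 / c"] V_scale[of x n c] by (auto simp: scaleC_scaleC scaleC_one)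

text \<open>Degree at most m combined with degree less than n gives degree less than m + n.
  Throughout, \<open>Suc\<close> in the index of V marks a non-strict bound.\<close>

lemma V_comm_left: "x \<in> V (Suc m) \<Longrightarrow> y \<in> V n \<Longrightarrow> comm x y \<in> V (m + n)"
  unfolding comm_def using V_mult_left[of x m y n] V_mult_right[of y n x m] by (simp add: V_diff add.commute)

lemma V_comm_right: "x \<in> V m \<Longrightarrow> y \<in> V (Suc n) \<Longrightarrow> comm x y \<in> V (m + n)"
  using V_comm_left[of y n x m] comm_swap[of x y] by (simp add: V_minus add.commute)

text \<open>Equality up to filtration degree less than \<open>d\<close>.\<close>

definition eqv :: "nat \<Rightarrow> 'a \<Rightarrow> 'a \<Rightarrow> bool" where
  "eqv d x y \<longleftrightarrow> x - y \<in> V d"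

lemma eqv_refl [simp]: "eqv d x x"
  and eqv_sym: "eqv d x y \<Longrightarrow> eqv d y x"
  and eqv_trans [trans]: "eqv d x y \<Longrightarrow> eqv d y z \<Longrightarrow> eqv d x z"
  and eqv_eq_trans [trans]: "eqv d x y \<Longrightarrow> y = z \<Longrightarrow> eqv d x z" "x = y \<Longrightarrow> eqv d y z \<Longrightarrow> eqv d x z"
  and eqv_add: "eqv d x y \<Longrightarrow> eqv d x' y' \<Longrightarrow> eqv d (x + x') (y + y')"
  and eqv_diff: "eqv d x y \<Longrightarrow> eqv d x' y' \<Longrightarrow> eqv d (x - x') (y - y')"
  and eqv_minus: "eqv d x y \<Longrightarrow> eqv d (- x) (- y)"
  and eqv_scale: "eqv d x y \<Longrightarrow> eqv d (c *\<^sub>C x) (c *\<^sub>C y)"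
proof -
  show "eqv d x y \<Longrightarrow> eqv d y x" unfolding eqv_def by (metis V_minus minus_diff_eq)
  show "eqv d x y \<Longrightarrow> eqv d y z \<Longrightarrow> eqv d x z"
    unfolding eqv_def by (metis V_add diff_add_cancel add_diff_eq)
  show "eqv d x y \<Longrightarrow> eqv d x' y' \<Longrightarrow> eqv d (x + x') (y + y')"
    unfolding eqv_def by (metis V_add add_diff_add)
  show "eqv d x y \<Longrightarrow> eqv d x' y' \<Longrightarrow> eqv d (x - x') (y - y')"
    unfolding eqv_def using V_diff[of "x - y" d "x' - y'"] by (simp add: algebra_simps)
  show "eqv d x y \<Longrightarrow> eqv d (- x) (- y)"
    unfolding eqv_def using V_minus[of "x - y" d] by simp
  show "eqv d x y \<Longrightarrow> eqv d (c *\<^sub>C x) (c *\<^sub>C y)"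
    unfolding eqv_def using V_scale[of "x - y" d c] by (simp add: cvs.scale_right_diff_distrib)
qed (simp_all add: eqv_def)

lemma eqv_scale_cancel: "c \<noteq> 0 \<Longrightarrow> eqv d (c *\<^sub>C x) (c *\<^sub>C y) \<Longrightarrow> eqv d x y"
  by (simp add: eqv_def V_scale_iff flip: cvs.scale_right_diff_distrib)

lemma eqv_mono: "eqv d x y \<Longrightarrow> d \<le> d' \<Longrightarrow> eqv d' x y"
  unfolding eqv_def using V_mono by blast

lemma eqv_comm_left: "z \<in> V (Suc n) \<Longrightarrow> eqv d x y \<Longrightarrow> d' = n + d \<Longrightarrow> eqv d' (comm z x) (comm z y)"
  unfolding eqv_def using V_comm_left[of z n "x - y" d] by (simp add: comm_diff_right)

lemma eqv_comm_right: "z \<in> V (Suc n) \<Longrightarrow> eqv d x y \<Longrightarrow> d' = d + n \<Longrightarrow> eqv d' (comm x z) (comm y z)"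
  unfolding eqv_def using V_comm_right[of "x - y" d z n] by (simp add: comm_diff_left)

lemma E_V': "E \<in> V (Suc 1)" and F_V': "F \<in> V (Suc 1)"
  using E_V F_V by (simp_all add: numeral_2_eq_2)

lemma H_V: "H \<in> V (Suc 2)"
  using V_comm_left[of E 1 F 2] E_V F_V by (simp add: numeral_2_eq_2)

lemma e_V: "e i \<in> V (Suc (2 * i + 1))"
proof (induction i)
  case (Suc i)
  have "(1 / 2) *\<^sub>C comm H (e i) \<in> V (2 + Suc (2 * i + 1))"
    by (rule V_scale[OF V_comm_left[OF H_V Suc]])
  then show ?case by (simp add: e.simps)
qed (use E_V in \<open>simp add: numeral_2_eq_2\<close>)

lemma f_V: "f i \<in> V (Suc (2 * i + 1))"
proof (induction i)
  case (Suc i)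
  have "(- 1 / 2) *\<^sub>C comm H (f i) \<in> V (2 + Suc (2 * i + 1))"
    by (rule V_scale[OF V_comm_left[OF H_V Suc]])
  then show ?case by (simp add: f.simps)
qed (use F_V in \<open>simp add: numeral_2_eq_2\<close>)

lemma h_V: "h i \<in> V (Suc (2 * i))"
proof (cases i)
  case (Suc j)
  then show ?thesis
    using V_comm_left[of E 1 "f j" "Suc (2 * j + 1)"] E_V f_V[of j] by (simp add: h_simps numeral_2_eq_2)
qed (use k_V in \<open>simp add: h_simps\<close>)

lemma k_e: "comm k (e i) = 2 *\<^sub>C e i" and k_f: "comm k (f i) = (- 2) *\<^sub>C f i" and k_h: "comm k (h i) = 0"
proof -
  have H: "comm k H = 0"
    by (simp add: comm_comm_right k_E k_F comm_scaleC_left comm_scaleC_right comm_minus_right)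
  show "comm k (e i) = 2 *\<^sub>C e i"
    by (induction i) (simp_all add: k_E e.simps comm_comm_right[of k H] comm_scaleC_right comm_minus_right H cvs.scale_left_commute)
  show kf: "comm k (f i) = (- 2) *\<^sub>C f i" for i
    by (induction i) (simp_all add: k_F f.simps comm_comm_right[of k H] comm_scaleC_right comm_minus_right H cvs.scale_left_commute)
  show "comm k (h i) = 0"
    by (cases i) (simp_all add: h_simps comm_comm_right[of k E] kf k_E comm_scaleC_left comm_scaleC_right comm_minus_right)
qed

text \<open>The Serre relations in the form used below: the counterparts of [e z^3, e z] = 0 and
  [f z^3, f z] = 0.\<close>

lemma e_1_0: "eqv 4 (comm (e 1) (e 0)) 0" and f_1_0: "eqv 4 (comm (f 1) (f 0)) 0"
proof -
  have "comm (e 1) (e 0) = (- 1 / 2) *\<^sub>C comm E (comm E (comm F E))"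
    by (simp add: e.simps comm_scaleC_left, subst comm_swap, subst comm_swap[of _ E], subst comm_swap[of E F])
      (simp add: comm_minus_right)
  then show "eqv 4 (comm (e 1) (e 0)) 0" using V_scale[OF serre_E] by (simp only: eqv_def diff_0_right)
  have "comm (f 1) (f 0) = (1 / 2) *\<^sub>C comm F (comm F (comm F E))"
    by (simp add: f.simps comm_scaleC_left, subst comm_swap, subst comm_swap[of _ F], subst comm_swap[of E F])
      (simp add: comm_minus_right comm_scaleC_right)
  then show "eqv 4 (comm (f 1) (f 0)) 0" using V_scale[OF serre_F] by (simp only: eqv_def diff_0_right)
qed

text \<open>By the Jacobi identity, passing from \<open>e j\<close> to [H, \<open>e j\<close>]/2
  costs only a bracket with [H, \<open>h m\<close>], which is negligible.\<close>

lemma he_step: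
  assumes "eqv (2 + 2 * m) (comm H (h m)) 0"
    and "eqv (2 * m + 2 * j + 1) (comm (h m) (e j)) (2 *\<^sub>C e (m + j))"
  shows "eqv (2 * m + 2 * Suc j + 1) (comm (h m) (e (Suc j))) (2 *\<^sub>C e (m + Suc j))"
proof (rule eqv_scale_cancel[of 2])
  have "2 *\<^sub>C comm (h m) (e (Suc j)) = comm (h m) (comm H (e j))"
    by (simp add: H_e comm_scaleC_right)
  also have "\<dots> = comm H (comm (h m) (e j)) - comm (comm H (h m)) (e j)"
    by (simp add: comm_comm_left[of H "h m" "e j"])
  also have "eqv (2 * m + 2 * Suc j + 1) \<dots> (comm H (2 *\<^sub>C e (m + j)) - comm 0 (e j))"
    by (intro eqv_diff eqv_comm_left[OF H_V assms(2)] eqv_comm_right[OF e_V assms(1)]) simp_all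
  also have "\<dots> = 2 *\<^sub>C 2 *\<^sub>C e (m + Suc j)"
    by (simp add: comm_scaleC_right H_e)
  finally show "eqv (2 * m + 2 * Suc j + 1) (2 *\<^sub>C comm (h m) (e (Suc j))) (2 *\<^sub>C 2 *\<^sub>C e (m + Suc j))" .
qed simp

lemma hf_step:
  assumes "eqv (2 + 2 * m) (comm H (h m)) 0"
    and "eqv (2 * m + 2 * j + 1) (comm (h m) (f j)) ((- 2) *\<^sub>C f (m + j))"
  shows "eqv (2 * m + 2 * Suc j + 1) (comm (h m) (f (Suc j))) ((- 2) *\<^sub>C f (m + Suc j))"
proof (rule eqv_scale_cancel[of "- 2"])
  have "(- 2) *\<^sub>C comm (h m) (f (Suc j)) = comm (h m) (comm H (f j))"
    by (simp only: H_f comm_scaleC_right)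
  also have "\<dots> = comm H (comm (h m) (f j)) - comm (comm H (h m)) (f j)"
    by (simp add: comm_comm_left[of H "h m" "f j"])
  also have "eqv (2 * m + 2 * Suc j + 1) \<dots> (comm H ((- 2) *\<^sub>C f (m + j)) - comm 0 (f j))"
    by (intro eqv_diff eqv_comm_left[OF H_V assms(2)] eqv_comm_right[OF f_V assms(1)]) simp_all
  also have "\<dots> = (- 2) *\<^sub>C (- 2) *\<^sub>C f (m + Suc j)"
    by (simp only: comm_scaleC_right H_f comm_zero_left diff_0_right add_Suc_right)
  finally show "eqv (2 * m + 2 * Suc j + 1) ((- 2) *\<^sub>C comm (h m) (f (Suc j))) ((- 2) *\<^sub>C (- 2) *\<^sub>C f (m + Suc j))" .
qed simp

lemma ef_difference: "comm (e (Suc i)) (f j) - comm (e i) (f (Suc j)) = (1 / 2) *\<^sub>C comm H (comm (e i) (f j))"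
  by (simp add: comm_comm_right[of H] H_e H_f comm_scaleC_left comm_scaleC_right comm_minus_right cvs.scale_right_diff_distrib
      scaleC_scaleC scaleC_one) 

text \<open>
  Since \<open>h (n + 1) = [e i, f j]\<close> for every splitting \<open>i + j = n\<close>, applying \<open>[H, -]\<close> shows that the
  differences \<open>[e (i + 1), f j] - [e i, f (j + 1)]\<close> are all equal to \<open>\<delta> = [H, h (n + 1)] / 2\<close>,
  while evaluating \<open>[H, h (n + 1)]\<close> by the Jacobi identity gives \<open>- 2 (n + 1) \<delta>\<close>; hence \<open>\<delta> = 0\<close>.
\<close>

lemma current_relations:
  "(\<forall>i j. i + j \<le> n \<longrightarrow> eqv (2 * i + 2 * j + 2) (comm (e i) (f j)) (h (Suc (i + j)))) \<and>
   (\<forall>m. m \<le> Suc n \<longrightarrow> eqv (2 + 2 * m) (comm H (h m)) 0) \<and>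
   (\<forall>m j. 1 \<le> m \<longrightarrow> m + j \<le> Suc n \<longrightarrow> eqv (2 * m + 2 * j + 1) (comm (h m) (e j)) (2 *\<^sub>C e (m + j)) \<and>
     eqv (2 * m + 2 * j + 1) (comm (h m) (f j)) ((- 2) *\<^sub>C f (m + j)))"
proof (induction n)
  case 0
  have "comm H k = 0" using k_h[of 1] comm_swap[of H k] by (simp add: h_simps)
  then have D: "comm H (h m) = 0" if "m \<le> 1" for m
    using that by (cases m) (simp_all add: h_simps)
  have *: "m = Suc 0 \<and> j = 0" if "Suc 0 \<le> m" "m + j \<le> Suc 0" for m j using that by simp
  then show ?case
    using D H_e[of 0] H_f[of 0] by (auto simp: h_simps dest!: *)
next
  case (Suc n)
  then have B: "\<And>i j. i + j \<le> n \<Longrightarrow> eqv (2 * i + 2 * j + 2) (comm (e i) (f j)) (h (Suc (i + j)))"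
    and D: "\<And>m. m \<le> Suc n \<Longrightarrow> eqv (2 + 2 * m) (comm H (h m)) 0"
    and Ce: "\<And>m j. 1 \<le> m \<Longrightarrow> m + j \<le> Suc n \<Longrightarrow> eqv (2 * m + 2 * j + 1) (comm (h m) (e j)) (2 *\<^sub>C e (m + j))"
    and Cf: "\<And>m j. 1 \<le> m \<Longrightarrow> m + j \<le> Suc n \<Longrightarrow> eqv (2 * m + 2 * j + 1) (comm (h m) (f j)) ((- 2) *\<^sub>C f (m + j))"
    by blast+
  \<comment> \<open>Neighbouring splittings of n + 1 differ by half of
    [H, \<open>h (n + 1)\<close>], which is already known to be negligible; the splitting with i = 0
    is the definition of h.\<close>
  have B1: "eqv (2 * n + 4) (comm (e i) (f j)) (h (Suc (Suc n)))" if "i + j = Suc n" for i j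
    using that
  proof (induction i arbitrary: j)
    case 0
    then show ?case by (simp add: h_simps)
  next
    case (Suc i)
    have "eqv (2 * n + 4) ((1 / 2) *\<^sub>C comm H (comm (e i) (f j))) ((1 / 2) *\<^sub>C comm H (h (Suc (i + j))))"
      using Suc.prems by (intro eqv_scale eqv_comm_left[OF H_V B]) simp_all
    also have "eqv (2 * n + 4) \<dots> ((1 / 2) *\<^sub>C 0)"
      using Suc.prems by (intro eqv_scale eqv_mono[OF D]) simp_all
    finally have "eqv (2 * n + 4) (comm (e (Suc i)) (f j) - comm (e i) (f (Suc j))) 0"
      by (simp add: ef_difference)
    then have "eqv (2 * n + 4) (comm (e (Suc i)) (f j)) (comm (e i) (f (Suc j)))"
      by (simp add: eqv_def)
    also have "eqv (2 * n + 4) \<dots> (h (Suc (Suc n)))" using Suc by simp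
    finally show ?case .
  qed
  have B': "eqv (2 * i + 2 * j + 2) (comm (e i) (f j)) (h (Suc (i + j)))" if "i + j \<le> Suc n" for i j
  proof (cases "i + j \<le> n")
    case False
    with that have ij: "i + j = Suc n" by simp
    show ?thesis unfolding ij by (rule eqv_mono[OF B1[OF ij]]) (use ij in simp)
  qed (rule B)
  have C1: "eqv (2 * m + 2 * Suc j + 1) (comm (h m) (e (Suc j))) (2 *\<^sub>C e (m + Suc j))"
    "eqv (2 * m + 2 * Suc j + 1) (comm (h m) (f (Suc j))) ((- 2) *\<^sub>C f (m + Suc j))"
    if "1 \<le> m" "m + Suc j \<le> Suc (Suc n)" for m j
    using that by (intro he_step hf_step D Ce Cf; simp)+
  have h2: "eqv (2 * n + 4) (h (Suc (Suc n))) (comm (e 1) (f n))" "eqv (2 * n + 4) (h (Suc (Suc n))) (comm (e n) (f 1))"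
    using B1 by (auto intro: eqv_sym)
  have C11: "eqv (2 * n + 5) (comm (h (Suc n)) (e 1)) (2 *\<^sub>C e (Suc (Suc n)))"
    "eqv (2 * n + 5) (comm (h (Suc n)) (f 1)) ((- 2) *\<^sub>C f (Suc (Suc n)))"
    using C1[of "Suc n" 0] by (auto elim!: eqv_mono)
  \<comment> \<open>Writing h at index n + 2 as [\<open>e 1\<close>, \<open>f n\<close>] lets the
    Jacobi identity reduce the bracket with E to the known [\<open>h (n + 1)\<close>,
    \<open>e 1\<close>] and to [\<open>e 1\<close>, \<open>e 0\<close>], negligible by the Serre
    relation.\<close>
  have Ce0: "eqv (2 * n + 5) (comm (h (Suc (Suc n))) E) (2 *\<^sub>C e (Suc (Suc n)))"
  proof -
    have "eqv (2 * n + 5) (comm (h (Suc (Suc n))) E) (comm (comm (e 1) (f n)) E)"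
      by (rule eqv_comm_right[OF E_V' h2(1)]) simp
    also have "\<dots> = comm (h (Suc n)) (e 1) - comm (f n) (comm (e 1) (e 0))"
      unfolding e.simps(1) comm_comm_left[of "e 1" "f n"]
      by (simp only: h_simps(2) comm_swap[of "f n" E] comm_minus_right comm_swap[of "e 1" "comm E (f n)"] minus_minus)
    also have "eqv (2 * n + 5) \<dots> (2 *\<^sub>C e (Suc (Suc n)) - comm (f n) 0)"
      by (intro eqv_diff C11 eqv_comm_left[OF f_V e_1_0]) simp_all
    finally show ?thesis by simp
  qed
  have Cf0: "eqv (2 * n + 5) (comm (h (Suc (Suc n))) F) ((- 2) *\<^sub>C f (Suc (Suc n)))"
  proof -
    have hn: "eqv (2 * n + 2) (comm (e n) (f 0)) (h (Suc n))" using B[of n 0] by simp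
    have "eqv (2 * n + 5) (comm (h (Suc (Suc n))) F) (comm (comm (e n) (f 1)) F)"
      by (rule eqv_comm_right[OF F_V' h2(2)]) simp
    also have "\<dots> = comm (e n) (comm (f 1) (f 0)) + comm (comm (e n) (f 0)) (f 1)"
      unfolding f.simps(1) comm_comm_left[of "e n" "f 1"] by (simp only: comm_swap[of "comm (e n) F"] diff_conv_add_uminus)
    also have "eqv (2 * n + 5) \<dots> (comm (e n) 0 + comm (h (Suc n)) (f 1))"
      by (intro eqv_add eqv_comm_left[OF e_V f_1_0] eqv_comm_right[OF f_V hn]) simp_all
    also have "eqv (2 * n + 5) \<dots> (0 + (- 2) *\<^sub>C f (Suc (Suc n)))"
      by (intro eqv_add C11) simp_all
    finally show ?thesis by simp
  qed
  have C': "eqv (2 * m + 2 * j + 1) (comm (h m) (e j)) (2 *\<^sub>C e (m + j)) \<and>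
     eqv (2 * m + 2 * j + 1) (comm (h m) (f j)) ((- 2) *\<^sub>C f (m + j))" if "1 \<le> m" "m + j \<le> Suc (Suc n)" for m j
  proof (cases j)
    case (Suc j')
    then show ?thesis using C1[of m j'] that by simp
  next
    case 0
    show ?thesis
    proof (cases "m = Suc (Suc n)")
      case True
      then show ?thesis using 0 Ce0 Cf0 by (auto elim!: eqv_mono)
    next
      case False
      then show ?thesis using that Ce[of m j] Cf[of m j] 0 by simp
    qed
  qed
  have D1: "eqv (2 * n + 6) (comm H (h (Suc (Suc n)))) 0"
  proof -
    let ?N = "Suc (Suc n)" and ?d = "2 * n + 6"
    define \<delta> where "\<delta> = (1 / 2) *\<^sub>C comm H (h ?N)"
    have "eqv ?d (comm (e i) (f j)) (comm (e 0) (f ?N) + of_nat i *\<^sub>C \<delta>)" if "i + j = ?N" for i j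
      using that
    proof (induction i arbitrary: j)
      case (Suc i)
      have "comm (e (Suc i)) (f j) = comm (e i) (f (Suc j)) + (1 / 2) *\<^sub>C comm H (comm (e i) (f j))"
        by (simp flip: ef_difference)
      also have "eqv ?d \<dots> ((comm (e 0) (f ?N) + of_nat i *\<^sub>C \<delta>) + \<delta>)"
        using Suc unfolding \<delta>_def by (intro eqv_add eqv_scale eqv_comm_left[OF H_V B1]) simp_all
      finally show ?case by (simp add: scaleC_add_left scaleC_one add_ac)
    qed simp
    from this[of ?N 0] have 1: "eqv ?d (comm (e ?N) F) (comm E (f ?N) + of_nat ?N *\<^sub>C \<delta>)" by simp
    have "comm H (h ?N) = comm F (comm (h ?N) E) - comm E (comm (h ?N) F)"
      unfolding comm_comm_left[of E F] comm_swap[of "h ?N"] comm_minus_right by simp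
    also have "eqv ?d \<dots> (comm F (2 *\<^sub>C e ?N) - comm E ((- 2) *\<^sub>C f ?N))"
      by (intro eqv_diff eqv_comm_left[OF F_V' Ce0] eqv_comm_left[OF E_V' Cf0]) simp_all
    also have "\<dots> = (- 2) *\<^sub>C (comm (e ?N) F - comm E (f ?N))"
      by (simp add: comm_scaleC_right comm_minus_right comm_swap[of F] cvs.scale_right_diff_distrib)
    also have "eqv ?d \<dots> ((- 2) *\<^sub>C (of_nat ?N *\<^sub>C \<delta>))"
      using eqv_diff[OF 1 eqv_refl[of ?d "comm E (f ?N)"]] by (intro eqv_scale) simp
    also have "\<dots> = (- of_nat ?N) *\<^sub>C comm H (h ?N)"
      by (simp add: \<delta>_def scaleC_scaleC)
    finally have "(1 + of_nat ?N) *\<^sub>C comm H (h ?N) \<in> V ?d"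
      by (simp only: eqv_def scaleC_add_left scaleC_one cvs.scale_minus_left diff_minus_eq_add)
    moreover have "(1 + of_nat ?N :: complex) \<noteq> 0"
      by (metis of_nat_Suc of_nat_neq_0)
    ultimately show ?thesis by (simp only: V_scale_iff eqv_def diff_0_right not_False_eq_True)
  qed
  have D': "eqv (2 + 2 * m) (comm H (h m)) 0" if "m \<le> Suc (Suc n)" for m
    using that D[of m] D1 by (cases "m = Suc (Suc n)") (auto elim!: eqv_mono)
  show ?case using B' C' D' by blast
qed

lemma comm_e_f: "eqv (2 * i + 2 * j + 2) (comm (e i) (f j)) (h (Suc (i + j)))"
  using current_relations[of "i + j"] by blast

lemma comm_H_h: "eqv (2 + 2 * m) (comm H (h m)) 0"
  using current_relations[of m] by auto

lemma comm_h_e: "eqv (2 * m + 2 * j + 1) (comm (h m) (e j)) (2 *\<^sub>C e (m + j))"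
  using current_relations[of "m + j"] k_e[of j] by (cases "m = 0") (auto simp: h_simps)

lemma comm_h_f: "eqv (2 * m + 2 * j + 1) (comm (h m) (f j)) ((- 2) *\<^sub>C f (m + j))"
  using current_relations[of "m + j"] k_f[of j] by (cases "m = 0") (auto simp: h_simps)

text \<open>Expanding \<open>h l\<close> as [E, \<open>f j\<close>] gives two contributions, 2h and
  -2h, with the same index.\<close>

lemma comm_h_h: "eqv (2 * m + 2 * l) (comm (h m) (h l)) 0"
proof (cases l)
  case 0
  then show ?thesis using k_h[of m] comm_swap[of "h m" k] by (simp add: h_simps)
next
  case (Suc j)
  have "comm (h m) (h l) = comm (comm (h m) E) (f j) + comm E (comm (h m) (f j))"
    unfolding Suc h_simps(2) by (rule comm_comm_right)
  also have "eqv (2 * m + 2 * l) \<dots> (comm (2 *\<^sub>C e m) (f j) + comm E ((- 2) *\<^sub>C f (m + j)))"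
    using comm_h_e[of m 0] Suc
    by (intro eqv_add eqv_comm_right[OF f_V, of "2 * m + 2 * 0 + 1"] eqv_comm_left[OF E_V' comm_h_f]) simp_all
  also have "\<dots> = 2 *\<^sub>C comm (e m) (f j) - 2 *\<^sub>C h (Suc (m + j))"
    by (simp add: comm_scaleC_left comm_scaleC_right comm_minus_right h_simps)
  also have "eqv (2 * m + 2 * l) \<dots> (2 *\<^sub>C h (Suc (m + j)) - 2 *\<^sub>C h (Suc (m + j)))"
    using comm_e_f[of m j] Suc by (intro eqv_diff eqv_scale) simp_all
  finally show ?thesis by simp
qed

text \<open>Bracketing with H shows that [\<open>e (i + 1)\<close>, \<open>e j\<close>] and
  [\<open>e i\<close>, \<open>e (j + 1)\<close>] are opposite, while bracketing
  [\<open>e 1\<close>, \<open>e 0\<close>] with \<open>h n\<close> shows that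
  [\<open>e 1\<close>, \<open>e n\<close>] and [\<open>e 0\<close>, \<open>e (n + 1)\<close>] are
  equal, both up to lower degree. Together these kill [\<open>e 0\<close>,
  \<open>e (n + 1)\<close>], and then every splitting.\<close>

lemma comm_e_e: "eqv (2 * i + 2 * j + 2) (comm (e i) (e j)) 0"
proof -
  have "\<forall>i j. i + j = n \<longrightarrow> eqv (2 * n + 2) (comm (e i) (e j)) 0" for n
  proof (induction n)
    case 0 then show ?case by simp
  next
    case (Suc n)
    have alt: "eqv (2 * n + 4) (comm (e (Suc i)) (e j) + comm (e i) (e (Suc j))) 0" if "i + j = n" for i j
    proof (rule eqv_scale_cancel[of 2])
      have "2 *\<^sub>C (comm (e (Suc i)) (e j) + comm (e i) (e (Suc j))) = comm H (comm (e i) (e j))"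
        by (simp add: comm_comm_right[of H] H_e comm_scaleC_left comm_scaleC_right scaleC_add_right)
      also have "eqv (2 * n + 4) \<dots> (comm H 0)"
        using Suc that by (intro eqv_comm_left[OF H_V, of "2 * n + 2"]) auto
      finally show "eqv (2 * n + 4) (2 *\<^sub>C (comm (e (Suc i)) (e j) + comm (e i) (e (Suc j)))) (2 *\<^sub>C 0)" by simp
    qed simp
    have 0: "eqv (2 * n + 4) (comm (e 0) (e (Suc n))) 0"
    proof (rule eqv_scale_cancel[of 4])
      have "comm (h n) (comm (e 1) (e 0)) = comm (comm (h n) (e 1)) (e 0) + comm (e 1) (comm (h n) (e 0))"
        by (rule comm_comm_right)
      also have "eqv (2 * n + 4) \<dots> (comm (2 *\<^sub>C e (n + 1)) (e 0) + comm (e 1) (2 *\<^sub>C e (n + 0)))"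
        by (intro eqv_add eqv_comm_right[OF e_V comm_h_e] eqv_comm_left[OF e_V comm_h_e]) simp_all
      finally have "eqv (2 * n + 4) (comm (2 *\<^sub>C e (n + 1)) (e 0) + comm (e 1) (2 *\<^sub>C e (n + 0))) (comm (h n) (comm (e 1) (e 0)))"
        by (rule eqv_sym)
      also have "eqv (2 * n + 4) \<dots> (comm (h n) 0)"
        by (rule eqv_comm_left[OF h_V e_1_0]) simp
      finally have "eqv (2 * n + 4) (2 *\<^sub>C comm (e 1) (e n) - 2 *\<^sub>C comm (e 0) (e (Suc n))) 0"
        by (simp add: comm_scaleC_left comm_scaleC_right comm_swap[of "e (Suc n)"])
      from eqv_diff[OF eqv_scale[OF alt[of 0 n], of 2] this]
      have "eqv (2 * n + 4) (2 *\<^sub>C comm E (e (Suc n)) + 2 *\<^sub>C comm E (e (Suc n))) 0"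
        by (simp add: scaleC_add_right)
      then show "eqv (2 * n + 4) (4 *\<^sub>C comm (e 0) (e (Suc n))) (4 *\<^sub>C 0)"
        by (simp flip: scaleC_add_left)
    qed simp
    have all: "eqv (2 * n + 4) (comm (e i) (e j)) 0" if "i + j = Suc n" for i j
      using that
    proof (induction i arbitrary: j)
      case 0 then show ?case using \<open>eqv (2 * n + 4) (comm (e 0) (e (Suc n))) 0\<close> by simp
    next
      case (Suc i)
      from eqv_diff[OF alt[of i j] Suc.IH[of "Suc j"]] Suc.prems show ?case by simp
    qed
    show ?case by (auto intro: eqv_mono[OF all])
  qed
  from this[of "i + j"] show ?thesis by (auto elim: eqv_mono)
qed

text \<open>The hypotheses are symmetric under exchanging E with F and k with -k. This sends H to -H
  and hence turns the recursion for e into the one for f.\<close>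

lemma comm_f_f: "eqv (2 * i + 2 * j + 2) (comm (f i) (f j)) 0"
proof -
  interpret swap: filtered_serre V "- k" F E
  proof
    show "comm (- k) F = 2 *\<^sub>C F" "comm (- k) E = (- 2) *\<^sub>C E"
      by (simp_all add: comm_minus_left k_E k_F)
    show "comm F (comm F (comm E F)) \<in> V 4" "comm E (comm E (comm E F)) \<in> V 4"
      using V_minus[OF serre_F] V_minus[OF serre_E] by (simp_all add: comm_swap[of E F] comm_minus_right)
  qed (use V_subspace V_mono V_mult_left V_mult_right E_V F_V V_minus[OF k_V] in auto)
  have H: "comm F E = - H" by (rule comm_swap)
  have "swap.e i = f i" for i
    by (induction i) (simp_all add: swap.e.simps(2) f.simps(2) H comm_minus_left)
  then show ?thesis
    using swap.comm_e_e[of i j] by (simp add: swap.eqv_def eqv_def)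
qed

section \<open>Reordering words\<close>

fun el :: "ygen \<times> nat \<Rightarrow> 'a" where
  "el (Gk, i) = h i" | "el (GE, i) = e i" | "el (GF, i) = f i"

end

text \<open>The power of z carried by the letter in the current algebra.\<close>

fun wt :: "ygen \<times> nat \<Rightarrow> nat" where
  "wt (Gk, i) = 2 * i" | "wt (GE, i) = 2 * i + 1" | "wt (GF, i) = 2 * i + 1"

abbreviation wtl :: "(ygen \<times> nat) list \<Rightarrow> nat" where
  "wtl w \<equiv> sum_list (map wt w)"

lemma span_mult:
  fixes x y :: "'a::complex_algebra_1"
  assumes "x \<in> cvs.span P" "y \<in> cvs.span Q" and R: "cvs.subspace R"
    and PQ: "\<And>a b. a \<in> P \<Longrightarrow> b \<in> Q \<Longrightarrow> a * b \<in> R"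
  shows "x * y \<in> R"
proof -
  have "Q \<subseteq> {y. a * y \<in> R}" "cvs.subspace {y. a * y \<in> R}" if "a \<in> P" for a
    using R PQ that by (auto simp: cvs.subspace_def distrib_left mult_scaleC_right)
  then have "a * y \<in> R" if "a \<in> P" for a
    using cvs.span_minimal that assms(2) by blast
  then have "P \<subseteq> {x. x * y \<in> R}" by blast
  moreover have "cvs.subspace {x. x * y \<in> R}"
    using R by (auto simp: cvs.subspace_def distrib_right mult_scaleC_left)
  ultimately show ?thesis using cvs.span_minimal assms(1) by blast
qed

context filtered_serre
begin

abbreviation W :: "(ygen \<times> nat) list \<Rightarrow> 'a" where
  "W w \<equiv> prod_list (map el w)"

lemma el_V: "el x \<in> V (Suc (wt x))"
  by (cases x rule: wt.cases) (use h_V e_V f_V in auto)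

text \<open>A summary of the current relations: a bracket of two letters is, up to lower degree, a
  multiple of one letter of the total weight. When the bracket is negligible, any letter of that
  weight serves, with coefficient 0.\<close>

lemma comm_el: "\<exists>c z. wt z = wt x + wt y \<and> eqv (wt x + wt y) (comm (el x) (el y)) (c *\<^sub>C el z)"
proof -
  have z: "\<exists>c z. wt z = n \<and> eqv n u (c *\<^sub>C el z)" if "eqv n u 0" for n u
  proof (cases "even n")
    case True
    then show ?thesis using that by (intro exI[of _ 0] exI[of _ "(Gk, n div 2)"]) simp
  next
    case False
    then show ?thesis using that by (intro exI[of _ 0] exI[of _ "(GE, n div 2)"]) simp
  qed
  have s: "comm u v = (- 1) *\<^sub>C comm v u" for u v by (simp add: comm_swap[of u v] scaleC_one)
  obtain g i g' j where [simp]: "x = (g, i)" "y = (g', j)" by (cases x; cases y)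
  show ?thesis
  proof (cases g; cases g')
    assume g: "g = Gk" "g' = Gk" show ?thesis using comm_h_h[of i j] g by (intro z) simp
  next
    assume g: "g = Gk" "g' = GE" then show ?thesis
      using comm_h_e[of i j] by (intro exI[of _ 2] exI[of _ "(GE, i + j)"]) simp
  next
    assume g: "g = Gk" "g' = GF" then show ?thesis
      using comm_h_f[of i j] by (intro exI[of _ "- 2"] exI[of _ "(GF, i + j)"]) simp
  next
    assume g: "g = GE" "g' = Gk" then show ?thesis
      using eqv_scale[OF comm_h_e[of j i], of "- 1"]
      by (intro exI[of _ "- 2"] exI[of _ "(GE, i + j)"]) (simp add: s[of "e i"] add_ac scaleC_scaleC)
  next
    assume g: "g = GE" "g' = GE" show ?thesis using comm_e_e[of i j] g by (intro z) simp
  next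
    assume g: "g = GE" "g' = GF" then show ?thesis
      using comm_e_f[of i j] by (intro exI[of _ 1] exI[of _ "(Gk, Suc (i + j))"]) (simp add: scaleC_one)
  next
    assume g: "g = GF" "g' = Gk" then show ?thesis
      using eqv_scale[OF comm_h_f[of j i], of "- 1"]
      by (intro exI[of _ 2] exI[of _ "(GF, i + j)"]) (simp add: s[of "f i"] add_ac scaleC_scaleC)
  next
    assume g: "g = GF" "g' = GE" then show ?thesis
      using eqv_scale[OF comm_e_f[of j i], of "- 1"]
      by (intro exI[of _ "- 1"] exI[of _ "(Gk, Suc (i + j))"]) (simp add: s[of "f i"] add_ac scaleC_scaleC)
  next
    assume g: "g = GF" "g' = GF" show ?thesis using comm_f_f[of i j] g by (intro z) simp
  qed
qed

end

section \<open>Words depend only on their multiset of letters, up to lower terms\<close>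

locale filtered_serre_words = filtered_serre +
  assumes one_V: "1 \<in> V 1"
    and V_words: "V n \<subseteq> cvs.span {prod_list (map el w) | w. wtl w < n}"
begin

lemma W_V: "W w \<in> V (Suc (wtl w))"
proof (induction w)
  case (Cons x w)
  then show ?case using V_mult_left[OF el_V[of x] Cons] by simp
qed (use one_V in simp)

text \<open>Filtration by weight and then, within weight d, by length.\<close>

definition U :: "nat \<Rightarrow> nat \<Rightarrow> 'a set" where
  "U d p = cvs.span {W w | w. wtl w < d \<or> wtl w = d \<and> length w < p}"

lemma U_subspace: "cvs.subspace (U d p)"
  by (simp add: U_def cvs.subspace_span)

lemma W_U: "wtl w < d \<or> wtl w = d \<and> length w < p \<Longrightarrow> W w \<in> U d p"
  unfolding U_def by (rule cvs.span_base) blast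

lemma V_subset_U: "V d \<subseteq> U d p"
  unfolding U_def by (rule subset_trans[OF V_words cvs.span_mono]) blast

lemma el_mult_U: "y \<in> U d p \<Longrightarrow> el x * y \<in> U (wt x + d) (Suc p)"
  unfolding U_def[of d p]
proof (rule span_mult[OF cvs.span_base[OF singletonI] _ U_subspace])
  fix a b assume "a \<in> {el x}" "b \<in> {W w | w. wtl w < d \<or> wtl w = d \<and> length w < p}"
  then obtain w where "a = el x" "b = W w" "wtl w < d \<or> wtl w = d \<and> length w < p" by auto
  then show "a * b \<in> U (wt x + d) (Suc p)"
    using W_U[of "x # w" "wt x + d" "Suc p"] by auto
qed

text \<open>Each exchange of neighbours produces, by \<open>comm_el\<close>, a word of the same
  weight with two letters merged into one, plus terms of smaller weight.\<close>

lemma move_front: "W (u @ x # v) - W (x # u @ v) \<in> U (wtl (x # u @ v)) (length (x # u @ v))"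
proof (induction u)
  case Nil
  then show ?case using cvs.subspace_0[OF U_subspace] by simp
next
  case (Cons y u)
  let ?d = "wtl (x # y # u @ v)" and ?p = "length (x # y # u @ v)"
  from comm_el[of y x] obtain c z where z: "wt z = wt y + wt x"
    and "eqv (wt y + wt x) (comm (el y) (el x)) (c *\<^sub>C el z)" by blast
  then have r: "comm (el y) (el x) - c *\<^sub>C el z \<in> V (wt y + wt x)" by (simp add: eqv_def)
  have "(comm (el y) (el x) - c *\<^sub>C el z) * W (u @ v) \<in> V (wt y + wt x + wtl (u @ v))"
    by (rule V_mult_right[OF r W_V])
  then have 1: "(comm (el y) (el x) - c *\<^sub>C el z) * W (u @ v) \<in> U ?d ?p"
    using V_subset_U by (auto simp: add_ac)
  have 2: "c *\<^sub>C W (z # u @ v) \<in> U ?d ?p"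
    using z by (intro cvs.subspace_scale[OF U_subspace] W_U) simp
  have 3: "el y * (W (u @ x # v) - W (x # u @ v)) \<in> U ?d ?p"
    using el_mult_U[OF Cons, of y] by (simp add: add_ac)
  have "W ((y # u) @ x # v) - W (x # (y # u) @ v) =
      el y * (W (u @ x # v) - W (x # u @ v)) + ((comm (el y) (el x) - c *\<^sub>C el z) * W (u @ v) + c *\<^sub>C W (z # u @ v))"
    by (simp add: comm_def algebra_simps mult_scaleC_left)
  then show ?case
    using cvs.subspace_add[OF U_subspace 3 cvs.subspace_add[OF U_subspace 1 2]] by simp
qed

lemma W_mset_cong: "mset w = mset w' \<Longrightarrow> W w - W w' \<in> U (wtl w) (length w)"
proof (induction w arbitrary: w')
  case Nil
  then show ?case using cvs.subspace_0[OF U_subspace] by simp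
next
  case (Cons x w)
  then have "x \<in> set w'" by (metis list.set_intros(1) set_mset_mset)
  then obtain u v where w': "w' = u @ x # v" by (meson split_list)
  with Cons.prems have uv: "mset w = mset (u @ v)" by simp
  then have eq: "wtl (u @ v) = wtl w" "length (u @ v) = length w"
    by (metis mset_map sum_mset_sum_list, metis size_mset)
  have "el x * (W w - W (u @ v)) \<in> U (wt x + wtl w) (Suc (length w))"
    by (rule el_mult_U[OF Cons.IH[OF uv]])
  moreover have "W (u @ x # v) - W (x # u @ v) \<in> U (wt x + wtl w) (Suc (length w))"
    using move_front[of u x v] eq by simp
  ultimately have "el x * (W w - W (u @ v)) - (W (u @ x # v) - W (x # u @ v)) \<in> U (wt x + wtl w) (Suc (length w))"
    by (rule cvs.subspace_diff[OF U_subspace])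
  then show ?case by (simp add: w' right_diff_distrib)
qed

end


section \<open>Representations of \<open>Y_sp2\<close> whose pole order matches the
  filtration\<close>

section \<open>Operators on functions\<close>

text \<open>Linear operators on complex-valued functions on 'b, made a type so that they form an
  instance of the class of complex algebras.\<close>

typedef 'b endo = "{f :: ('b \<Rightarrow> complex) \<Rightarrow> 'b \<Rightarrow> complex.
    (\<forall>\<phi> \<psi>. f (\<lambda>b. \<phi> b + \<psi> b) = (\<lambda>b. f \<phi> b + f \<psi> b)) \<and> (\<forall>c \<phi>. f (\<lambda>b. c * \<phi> b) = (\<lambda>b. c * f \<phi> b))}"
  morphisms app Abs_endo
  by (rule exI[of _ "\<lambda>\<phi>. \<phi>"]) simp

setup_lifting type_definition_endo

instantiation endo :: (type) complex_algebra_1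
begin

lift_definition zero_endo :: "'a endo" is "\<lambda>\<phi> b. 0" by simp
lift_definition one_endo :: "'a endo" is "\<lambda>\<phi>. \<phi>" by simp
lift_definition plus_endo :: "'a endo \<Rightarrow> 'a endo \<Rightarrow> 'a endo" is "\<lambda>f g \<phi> b. f \<phi> b + g \<phi> b"
  by (simp add: distrib_left fun_eq_iff)
lift_definition minus_endo :: "'a endo \<Rightarrow> 'a endo \<Rightarrow> 'a endo" is "\<lambda>f g \<phi> b. f \<phi> b - g \<phi> b"
  by (simp add: right_diff_distrib fun_eq_iff)
lift_definition uminus_endo :: "'a endo \<Rightarrow> 'a endo" is "\<lambda>f \<phi> b. - f \<phi> b"
  by (simp add: fun_eq_iff)
lift_definition times_endo :: "'a endo \<Rightarrow> 'a endo \<Rightarrow> 'a endo" is "\<lambda>f g \<phi>. f (g \<phi>)"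
  by simp
lift_definition scaleC_endo :: "complex \<Rightarrow> 'a endo \<Rightarrow> 'a endo" is "\<lambda>c f \<phi> b. c * f \<phi> b"
  by (simp add: distrib_left fun_eq_iff)

instance
proof
  show "(0 :: 'a endo) \<noteq> 1"
    by transfer (metis zero_neq_one)
  show "a * (b + c) = a * b + a * c" for a b c :: "'a endo"
    by transfer simp
qed (transfer; simp add: algebra_simps)+

end

lemma app_simps [simp]:
  "app 0 \<phi> b = 0" "app 1 \<phi> = \<phi>" "app (x + y) \<phi> b = app x \<phi> b + app y \<phi> b" "app (x * y) \<phi> = app x (app y \<phi>)"
  "app (c *\<^sub>C x) \<phi> b = c * app x \<phi> b" "app (- x) \<phi> b = - app x \<phi> b" "app (x - y) \<phi> b = app x \<phi> b - app y \<phi> b"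
  by (transfer; simp)+

lemma app_linear:
  "app x (\<lambda>b. \<phi> b + \<psi> b) = (\<lambda>b. app x \<phi> b + app x \<psi> b)" "app x (\<lambda>b. c * \<phi> b) = (\<lambda>b. c * app x \<phi> b)"
  by (transfer; simp)+

lemma app_sum [simp]: "app (sum f A) \<phi> b = (\<Sum>i\<in>A. app (f i) \<phi> b)"
  by (induction A rule: infinite_finite_induct) simp_all

lemma endo_eqI: "(\<And>\<phi> b. app x \<phi> b = app y \<phi> b) \<Longrightarrow> x = y"
  by transfer blast

instantiation fls :: (complex_algebra_1) complex_algebra_1
begin

definition scaleC_fls :: "complex \<Rightarrow> 'a fls \<Rightarrow> 'a fls" where
  "c *\<^sub>C f = fls_const (c *\<^sub>C 1) * f"

lemma fls_nth_scaleC: "fls_nth (c *\<^sub>C f) n = c *\<^sub>C fls_nth f n"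
  by (simp add: scaleC_fls_def mult_scaleC_left)

instance
proof
  fix a b :: complex and x y :: "'a fls"
  show "x * a *\<^sub>C y = a *\<^sub>C (x * y)"
  proof -
    have "x * fls_const (a *\<^sub>C 1) = fls_const (a *\<^sub>C 1) * x"
      by (rule fls_eqI) (simp add: mult_scaleC_left mult_scaleC_right)
    then show ?thesis by (simp add: scaleC_fls_def flip: mult.assoc)
  qed
  show "a *\<^sub>C x * y = a *\<^sub>C (x * y)" by (simp add: scaleC_fls_def mult.assoc)
qed (rule fls_eqI, simp add: fls_nth_scaleC scaleC_add_right scaleC_add_left scaleC_scaleC scaleC_one)+

end

text \<open>\<open>lead d x X\<close>: the series \<open>x\<close> has a pole of order at most \<open>d\<close>, with leading coefficient \<open>X\<close>.\<close>

definition lead :: "nat \<Rightarrow> 'a::complex_algebra_1 fls \<Rightarrow> 'a \<Rightarrow> bool" where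
  "lead d x X \<longleftrightarrow> (\<forall>n < - int d. fls_nth x n = 0) \<and> fls_nth x (- int d) = X"

lemma lead_add: "lead d x X \<Longrightarrow> lead d y Y \<Longrightarrow> lead d (x + y) (X + Y)"
  and lead_diff: "lead d x X \<Longrightarrow> lead d y Y \<Longrightarrow> lead d (x - y) (X - Y)"
  and lead_minus: "lead d x X \<Longrightarrow> lead d (- x) (- X)"
  and lead_scaleC: "lead d x X \<Longrightarrow> lead d (c *\<^sub>C x) (c *\<^sub>C X)"
  and lead_zero: "lead d 0 0"
  and lead_less: "lead d x X \<Longrightarrow> d < d' \<Longrightarrow> lead d' x 0"
  and lead_const: "lead 0 (fls_const a) a"
  by (simp_all add: lead_def fls_nth_scaleC)

lemma lead_X_inv: "lead 1 (fls_const a * fls_X_inv) a"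
  unfolding lead_def fls_X_inv_times_conv_shift by simp

lemma lead_mult:
  assumes x: "lead d x X" and y: "lead e y Y"
  shows "lead (d + e) (x * y) (X * Y)"
proof -
  have x0: "fls_nth x i = 0" if "i < - int d" for i using x that by (simp add: lead_def)
  have y0: "fls_nth y i = 0" if "i < - int e" for i using y that by (simp add: lead_def)
  have XY: "X = fls_nth x (- int d)" "Y = fls_nth y (- int e)" using x y by (simp_all add: lead_def)
  have t: "fls_nth x i * fls_nth y (n - i) = (if n = - int (d + e) \<and> i = - int d then X * Y else 0)"
    if "n \<le> - int (d + e)" for i n
  proof (cases "i < - int d")
    case False
    then have "n - i < - int e \<or> (n = - int (d + e) \<and> i = - int d)" using that by auto
    then show ?thesis using y0[of "n - i"] XY by auto
  qed (simp add: x0)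
  have "fls_nth (x * y) n = 0" if "n < - int (d + e)" for n
    unfolding fls_times_nth(2) using that t[of n] by (intro sum.neutral) simp
  moreover have "fls_nth (x * y) (- int (d + e)) = X * Y"
  proof -
    let ?I = "{fls_subdegree x .. - int (d + e) - fls_subdegree y}"
    have "fls_nth (x * y) (- int (d + e)) = (\<Sum>i\<in>?I. if i = - int d then X * Y else 0)"
      unfolding fls_times_nth(2) by (intro sum.cong refl) (subst t, simp_all)
    also have "\<dots> = (if - int d \<in> ?I then X * Y else 0)" by simp
    also have "\<dots> = X * Y"
    \<comment> \<open>The summation range is cut off at the true orders of x and y; if it misses -d,
      one of the two leading coefficients is 0.\<close>
    proof (cases "- int d \<in> ?I")
      case False
      then have "- int d < fls_subdegree x \<or> - int e < fls_subdegree y" by auto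
      then have "X = 0 \<or> Y = 0" unfolding XY by (auto intro: fls_eq0_below_subdegree)
      then show ?thesis by auto
    qed simp
    finally show ?thesis .
  qed
  ultimately show ?thesis by (simp add: lead_def)
qed

lemma lead_comm: "lead d x X \<Longrightarrow> lead e y Y \<Longrightarrow> lead (d + e) (comm x y) (comm X Y)"
  unfolding comm_def using lead_mult[of d x X e y Y] lead_mult[of e y Y d x X] by (simp add: lead_diff add.commute)

lemma lead_unique: "lead d x X \<Longrightarrow> lead d x Y \<Longrightarrow> X = Y"
  by (simp add: lead_def)


section \<open>Vector fields on the line\<close>

text \<open>
  A site carries the basis \<open>x\<^sup>m z\<^sup>q\<close>, and functions on states record coefficients with respect to
  the product basis.  The operators \<open>d/dx\<close>, \<open>- x\<^sup>2 d/dx\<close>, \<open>- 2 x d/dx\<close> form an \<open>sl\<^sub>2\<close>-triple with the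
  central character of the trivial representation, so that no normalisation of the quantum
  determinant is needed below; \<open>z\<close> is a formal evaluation parameter.
\<close>

type_synonym state = "nat \<Rightarrow> nat \<times> nat"

text \<open>The action on coefficient functions: the new coefficient at b is a weight times the old
  coefficient at the site state \<open>\<sigma> (b s)\<close>. In \<open>op GF\<close> the truncated
  subtraction at m = 0 is harmless, since the weight is 0 there.\<close>

lift_definition wshift :: "nat \<Rightarrow> (nat \<times> nat \<Rightarrow> complex) \<Rightarrow> (nat \<times> nat \<Rightarrow> nat \<times> nat) \<Rightarrow> state endo" is
  "\<lambda>s w \<sigma> \<phi> b. w (b s) * \<phi> (b(s := \<sigma> (b s)))"
  by (simp add: fun_eq_iff algebra_simps)

lemma app_wshift: "app (wshift s w \<sigma>) \<phi> b = w (b s) * \<phi> (b(s := \<sigma> (b s)))"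
  by transfer simp

lemma wshift_commute: "s \<noteq> t \<Longrightarrow> wshift s w \<sigma> * wshift t w' \<sigma>' = wshift t w' \<sigma>' * wshift s w \<sigma>"
  by (rule endo_eqI) (simp add: app_wshift fun_upd_twist)

fun op :: "ygen \<Rightarrow> nat \<Rightarrow> state endo" where
  "op Gk s = wshift s (\<lambda>(m, q). - 2 * of_nat m) (\<lambda>p. p)"
| "op GE s = wshift s (\<lambda>(m, q). of_nat m + 1) (\<lambda>(m, q). (Suc m, q))"
| "op GF s = wshift s (\<lambda>(m, q). - of_nat (m - 1)) (\<lambda>(m, q). (m - 1, q))"

definition opZ :: "nat \<Rightarrow> state endo" where
  "opZ s = wshift s (\<lambda>(m, q). if q = 0 then 0 else 1) (\<lambda>(m, q). (m, q - 1))"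

lemma op_commute: "s \<noteq> t \<Longrightarrow> op g s * op g' t = op g' t * op g s"
  by (cases g; cases g') (simp_all add: wshift_commute)

lemma op_Z_commute: "op g s * opZ t = opZ t * op g s"
proof (cases "s = t")
  case True
  then show ?thesis
    by (cases g) (auto intro!: endo_eqI simp: opZ_def app_wshift split: prod.splits)
next
  case False
  then show ?thesis by (cases g) (simp_all add: opZ_def wshift_commute)
qed

lemma Z_Z_commute: "opZ s * opZ t = opZ t * opZ s"
  by (cases "s = t") (simp_all add: opZ_def wshift_commute)

text \<open>The last two identities say that the Casimir element acts by 0, written in two
  orderings.\<close>

lemma op_sl2:
  "comm (op Gk s) (op GE s) = 2 *\<^sub>C op GE s" "comm (op Gk s) (op GF s) = (- 2) *\<^sub>C op GF s"
  "comm (op GE s) (op GF s) = op Gk s"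
  "op Gk s * op Gk s + 4 *\<^sub>C (op GF s * op GE s) = (- 2) *\<^sub>C op Gk s"
  "op Gk s * op Gk s + 4 *\<^sub>C (op GE s * op GF s) = 2 *\<^sub>C op Gk s"
proof -
  show "comm (op Gk s) (op GE s) = 2 *\<^sub>C op GE s" "comm (op Gk s) (op GF s) = (- 2) *\<^sub>C op GF s"
  "comm (op GE s) (op GF s) = op Gk s"
  "op Gk s * op Gk s + 4 *\<^sub>C (op GF s * op GE s) = (- 2) *\<^sub>C op Gk s"
  "op Gk s * op Gk s + 4 *\<^sub>C (op GE s * op GF s) = 2 *\<^sub>C op Gk s"
    by (rule endo_eqI, simp add: comm_def app_wshift split: prod.split, simp add: algebra_simps, (auto simp: algebra_simps of_nat_diff fun_upd_idem split: nat_diff_split)?)+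
qed

declare op.simps [simp del]


section \<open>Products of L-operators\<close>

text \<open>The evaluation L-operator 1 + M/(u - z).\<close>

definition Lop :: "(ix \<Rightarrow> ix \<Rightarrow> 'a::ring_1) \<Rightarrow> 'a \<Rightarrow> 'a fps^ix^ix" where
  "Lop M z = (\<chi> i j. Abs_fps (\<lambda>r. case r of 0 \<Rightarrow> if i = j then 1 else 0 | Suc k \<Rightarrow> M i j * z ^ k))"

text \<open>A form of \<open>yangian_matrix\<close> that passes to products at once: it asks for
  T(u) T(u+2)^t = 1 in all entries and keeps RTT as an identity of series.\<close>

definition strong_yangian :: "'a::ring_1 fps^ix^ix \<Rightarrow> bool" where
  "strong_yangian T \<longleftrightarrow> unit_lead T \<and> (\<forall>i j k l. rtt_rel T i j k l = 0) \<and>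
     T ** sp_transpose (msubst (recip_lin 1 2) T) = mat 1"

lemma strong_yangian_imp: "strong_yangian T \<Longrightarrow> yangian_matrix T"
  using rtt_rel_eq_0_iff[of T]
  by (simp add: strong_yangian_def yangian_matrix_def subst_lin_eq_msubst mat_ix_entry)

lemma fps_mult_commuteI:
  fixes f g :: "'a::ring_1 fps"
  assumes "\<And>m n. fps_nth f m * fps_nth g n = fps_nth g n * fps_nth f m"
  shows "f * g = g * f"
proof (rule fps_ext)
  fix n
  have "fps_nth (f * g) n = (\<Sum>i=0..n. fps_nth g (n - i) * fps_nth f i)"
    by (simp add: fps_mult_nth assms)
  also have "\<dots> = fps_nth (g * f) n"
    unfolding fps_mult_nth by (rule sum.reindex_bij_witness[of _ "\<lambda>i. n - i" "\<lambda>i. n - i"]) auto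
  finally show "fps_nth (f * g) n = fps_nth (g * f) n" .
qed

text \<open>With y = 1/(u-z) the matrix is 1 + M y, and RTT reduces to the commutators of M. Since M
  has trace 0, its transpose is -M, and (1 + M y)(1 - M y2) = 1 because M^2 = 2M and y - y2 = 2 y
  y2, where y2 = 1/(u+2-z).\<close>

lemma strong_yangian_Lop:
  fixes M :: "ix \<Rightarrow> ix \<Rightarrow> 'a::ring_1"
  assumes M: "\<And>i j k l. comm (M i j) (M k l) = 2 * ((if k = j then M i l else 0) - (if i = l then M k j else 0))"
    and zM: "\<And>i j. z * M i j = M i j * z"
    and tr: "M P1 P1 = - M N1 N1"
    and sq: "\<And>i j. M i N1 * M N1 j + M i P1 * M P1 j = 2 * M i j"
  shows "strong_yangian (Lop M z)"
proof -
  have lead: "unit_lead (Lop M z)" by (simp add: Lop_def)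
  have zpM: "z ^ p * M i j = M i j * z ^ p" for p i j
    by (induction p) (simp_all add: mult.assoc zM, simp add: zM flip: mult.assoc)
  have MM: "M i j * z ^ p * (M k l * z ^ q) = M i j * M k l * z ^ (p + q)" for i j k l p q
    by (simp only: mult.assoc power_add) (simp only: zpM flip: mult.assoc)
  have c: "comm (M i j * z ^ p) (M k l * z ^ q) = comm (M i j) (M k l) * z ^ (p + q)" for i j k l p q
    unfolding comm_def MM left_diff_distrib by (simp add: add.commute)
  have "rtt_coeff (Lop M z) i j k l r s = 0" for i j k l r s
  proof (cases r; cases s)
    assume "r = 0" "s = 0" then show ?thesis
      by (simp add: rtt_coeff_def Lop_def)
  next
    fix s' assume "r = 0" "s = Suc s'" then show ?thesis
      using c[of i j 0 k l s'] by (simp add: rtt_coeff_def Lop_def M) (auto simp: comm_def left_diff_distrib mult.assoc)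
  next
    fix r' assume "r = Suc r'" "s = 0" then show ?thesis
      using c[of i j r' k l 0] by (simp add: rtt_coeff_def Lop_def M) (auto simp: comm_def left_diff_distrib mult.assoc)
  next
    fix r' s' assume "r = Suc r'" "s = Suc s'" then show ?thesis
      using c[of i j "Suc r'" k l s'] c[of i j r' k l "Suc s'"]
      by (simp add: rtt_coeff_def Lop_def MM add.commute del: power_Suc)
  qed
  then have rtt: "\<forall>i j k l. rtt_rel (Lop M z) i j k l = 0"
    using rtt_rel_eq_0_iff[OF lead] by blast
  define y :: "'a fps" where "y = Abs_fps (\<lambda>r. case r of 0 \<Rightarrow> 0 | Suc k \<Rightarrow> z ^ k)"
  define r :: "'a fps" where "r = of_int_fps (recip_lin 1 2)"
  define y2 where "y2 = y oi recip_lin 1 2"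
  let ?Z = "fps_const z" and ?X = "fps_X :: 'a fps"
  have Xc: "x * ?X = ?X * x" for x by (rule fps_mult_fps_X_commute[symmetric])
  have L: "Lop M z $ i $ j = (if i = j then 1 else 0) + fps_const (M i j) * y" for i j
    by (rule fps_ext) (simp add: Lop_def y_def split: nat.split)
  have y_eq: "y = ?X + ?X * (?Z * y)"
  proof (rule fps_ext)
    fix n show "fps_nth y n = fps_nth (?X + ?X * (?Z * y)) n"
      by (cases n) (auto simp: y_def nth_X_mult split: nat.split)
  qed
  have subst_const: "fps_const a oi c = fps_const a" for a :: 'a and c
    by (rule fps_ext) (simp add: fps_subst_nth if_distrib[of "\<lambda>x. x * _"] fps_nth_fps_const if_distribR sum.delta cong: if_cong)
  have X_subst: "?X oi recip_lin 1 2 = r"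
    using fps_subst_of_int[of fps_X "recip_lin 1 2", where ?'a = 'a]
    by (simp add: of_int_fps_simps r_def)
  have "y2 = r + r * (?Z * y2)"
    using arg_cong[OF y_eq, of "\<lambda>f. f oi recip_lin 1 2"]
    by (simp add: fps_compose_add_distrib fps_subst_mult subst_const X_subst flip: y2_def)
  then have "(1 + 2 * ?X) * y2 = (1 + 2 * ?X) * r + (1 + 2 * ?X) * r * (?Z * y2)"
    by (metis distrib_left mult.assoc)
  also have "(1 + 2 * ?X) * r = ?X"
    unfolding r_def recip_lin_of_int_fps[symmetric] by (rule recip_lin_1_2)
  finally have y2_eq: "y2 + 2 * (?X * y2) = ?X + ?X * (?Z * y2)" by (simp add: distrib_right mult.assoc)
  have Zy: "?Z * y = y * ?Z"
    by (rule fps_mult_commuteI) (simp add: y_def power_commutes split: nat.split)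
  have My: "y * fps_const (M i j) = fps_const (M i j) * y" for i j
    by (rule fps_mult_commuteI) (simp add: y_def zpM split: nat.split)
  have "?X * y = y * (y2 + 2 * (?X * y2)) - y * (?X * (?Z * y2))"
    unfolding y2_eq by (simp add: distrib_left Xc)
  moreover have "?X * y2 = y * y2 - y * (?X * (?Z * y2))"
  proof -
    have "y * y2 = ?X * y2 + ?X * (?Z * y) * y2" by (subst y_eq) (simp only: distrib_right)
    moreover have "?X * (?Z * y) * y2 = y * (?X * (?Z * y2))"
      by (simp only: Zy mult.assoc) (simp only: Xc flip: mult.assoc)
    ultimately show ?thesis by simp
  qed
  ultimately have "?X * (y - y2) = y * (2 * (?X * y2))" by (simp add: distrib_left right_diff_distrib)
  also have "\<dots> = ?X * (y * y2 + y * y2)"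
    by (simp only: mult_2 distrib_left) (simp only: Xc flip: mult.assoc)
  finally have yy2: "y - y2 = y * y2 + y * y2" by (rule fps_X_cancel)
  have L2: "msubst (recip_lin 1 2) (Lop M z) $ i $ j = (if i = j then 1 else 0) + fps_const (M i j) * y2" for i j
    unfolding map_matrix_nth L fps_compose_add_distrib fps_subst_mult[OF recip_lin_nth_0] subst_const y2_def by simp
  have "sp_transpose (msubst (recip_lin 1 2) (Lop M z)) $ i $ j = (if i = j then 1 else 0) - fps_const (M i j) * y2" for i j
    unfolding sp_transpose_def vec_lambda_beta L2
    by (cases i; cases j) (simp_all add: tr fps_const_neg[symmetric] del: fps_const_neg)
  moreover have "Lop M z ** sp_transpose (msubst (recip_lin 1 2) (Lop M z)) = mat 1"
  proof -
    have e: "fps_const (M i k) * (y * (fps_const (M k' j) * y2)) = fps_const (M i k * M k' j) * (y * y2)" for i j k k'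
    proof -
      have "y * (fps_const (M k' j) * y2) = fps_const (M k' j) * (y * y2)"
        by (simp only: My flip: mult.assoc)
      then show ?thesis by (simp only: fps_const_mult[symmetric] mult.assoc)
    qed
    have sq': "fps_const (M i N1 * M N1 j) * (y * y2) + fps_const (M i P1 * M P1 j) * (y * y2) = fps_const (M i j) * (y - y2)" for i j
    proof -
      have "fps_const (M i N1 * M N1 j) * (y * y2) + fps_const (M i P1 * M P1 j) * (y * y2) = fps_const (2 * M i j) * (y * y2)"
        by (simp only: sq[symmetric] fps_const_add[symmetric] distrib_right)
      also have "\<dots> = fps_const (M i j) * (y - y2)"
        unfolding yy2 by (simp add: mult_2 fps_const_add[symmetric] distrib_right distrib_left del: fps_const_add)
      finally show ?thesis .
    qed
    have "(Lop M z ** sp_transpose (msubst (recip_lin 1 2) (Lop M z))) $ i $ j = (if i = j then 1 else 0)" for i j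
    proof -
      have "(Lop M z ** sp_transpose (msubst (recip_lin 1 2) (Lop M z))) $ i $ j = (if i = j then 1 else 0) +
          fps_const (M i j) * y - fps_const (M i j) * y2 -
          (fps_const (M i N1 * M N1 j) * (y * y2) + fps_const (M i P1 * M P1 j) * (y * y2))"
        unfolding mult_ix L \<open>\<And>i j. sp_transpose _ $ i $ j = _\<close>
        by (cases i; cases j) (simp_all add: e algebra_simps del: fps_const_mult)
      then show ?thesis unfolding sq' by (simp add: right_diff_distrib)
    qed
    then show ?thesis by (simp add: vec_eq_iff mat_def)
  qed
  ultimately show ?thesis using lead rtt by (simp add: strong_yangian_def)
qed

text \<open>The comultiplication of the Yangian. By the Leibniz rule each bracket of products splits
  into a bracket of A and one of L; after summation over the two inner indices the mixed terms
  cancel.\<close>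

lemma rtt_product_aux:
  fixes A A' L L' :: "ix \<Rightarrow> ix \<Rightarrow> 'a::ring_1" and u :: 'a
  assumes u: "\<And>x. x * u = u * x"
    and A: "\<And>i j k l. u * comm (A i j) (A' k l) = 2 * (A k j * A' i l - A' k j * A i l)"
    and L: "\<And>i j k l. u * comm (L i j) (L' k l) = 2 * (L k j * L' i l - L' k j * L i l)"
    and c: "\<And>i j k l. L i j * A k l = A k l * L i j" "\<And>i j k l. L i j * A' k l = A' k l * L i j"
      "\<And>i j k l. L' i j * A k l = A k l * L' i j" "\<And>i j k l. L' i j * A' k l = A' k l * L' i j"
    and P: "\<And>i j. P i j = A i N1 * L N1 j + A i P1 * L P1 j" "\<And>i j. P' i j = A' i N1 * L' N1 j + A' i P1 * L' P1 j"
  shows "u * comm (P i j) (P' k l) = 2 * (P k j * P' i l - P' k j * P i l)"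
proof -
  have c': "L i j * (A k l * y) = A k l * (L i j * y)" "L i j * (A' k l * y) = A' k l * (L i j * y)"
    "L' i j * (A k l * y) = A k l * (L' i j * y)" "L' i j * (A' k l * y) = A' k l * (L' i j * y)" for i j k l y
    by (metis c mult.assoc)+
  have u': "x * (u * y) = u * (x * y)" for x y by (metis u mult.assoc)
  have t: "u * comm (A i m * L m j) (A' k n * L' n l) =
     2 * (A k m * A' i n - A' k m * A i n) * (L m j * L' n l) + A' k n * A i m * (2 * (L n j * L' m l - L' n j * L m l))" for m n
  proof -
    have "u * comm (A i m * L m j) (A' k n * L' n l) =
        (u * comm (A i m) (A' k n)) * (L m j * L' n l) + A' k n * A i m * (u * comm (L m j) (L' n l))"
      by (simp add: comm_def algebra_simps c c' u u')
    then show ?thesis unfolding A L .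
  qed
  have "u * comm (P i j) (P' k l) =
     u * comm (A i N1 * L N1 j) (A' k N1 * L' N1 l) + u * comm (A i N1 * L N1 j) (A' k P1 * L' P1 l) +
     u * comm (A i P1 * L P1 j) (A' k N1 * L' N1 l) + u * comm (A i P1 * L P1 j) (A' k P1 * L' P1 l)"
    unfolding P by (simp add: comm_add_left comm_add_right distrib_left add_ac)
  also have "\<dots> = 2 * (P k j * P' i l - P' k j * P i l)"
    unfolding t P by (simp add: algebra_simps mult_2 c c')
  finally show ?thesis .
qed

lemma in_u_hom: "in_u (f + g) = in_u f + in_u g" "in_u (f * g) = in_u f * in_u g"
  and in_v_hom: "in_v (f + g) = in_v f + in_v g" "in_v (f * g) = in_v f * in_v g"
  for f g :: "'a::ring_1 fps"
proof -
  let ?c = "\<lambda>f :: 'a fps. Abs_fps (\<lambda>n. fls_const (fps_nth f n))"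
  have "fls_const (sum h I) = (\<Sum>i\<in>I. fls_const (h i))" for h :: "nat \<Rightarrow> 'a" and I
    by (induction I rule: infinite_finite_induct) (simp_all flip: fls_plus_const)
  then have "?c (f + g) = ?c f + ?c g" "?c (f * g) = ?c f * ?c g"
    by (simp_all add: fps_eq_iff fps_mult_nth fls_plus_const)
  then show "in_u (f + g) = in_u f + in_u g" "in_u (f * g) = in_u f * in_u g"
    by (simp_all add: in_u_def fls_times_fps_to_fls)
  show "in_v (f + g) = in_v f + in_v g" "in_v (f * g) = in_v f * in_v g"
    by (simp_all add: in_v_def fls_times_fps_to_fls fls_plus_const)
qed

lemma in_u_in_v_commute:
  assumes "\<And>m n. fps_nth f m * fps_nth g n = fps_nth g n * fps_nth f m"
  shows "in_u f * in_v g = in_v g * in_u f"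
  by (intro fls_eqI) (simp add: nth_in_u_in_v assms)

definition entries_commute :: "'a::ring_1 fps^ix^ix \<Rightarrow> 'a fps^ix^ix \<Rightarrow> bool" where
  "entries_commute A L \<longleftrightarrow> (\<forall>i j k l m n. fps_nth (L $ i $ j) m * fps_nth (A $ k $ l) n = fps_nth (A $ k $ l) n * fps_nth (L $ i $ j) m)"

lemma strong_yangian_mult:
  assumes A: "strong_yangian A" and L: "strong_yangian L" and c: "entries_commute A L"
  shows "strong_yangian (A ** L)"
proof -
  have cc: "L $ i $ j * A $ k $ l = A $ k $ l * L $ i $ j" for i j k l
    using c by (intro fps_mult_commuteI) (simp add: entries_commute_def)
  have "unit_lead (A ** L)"
    using A L by (simp add: strong_yangian_def mult_ix all_ix)
  moreover have "rtt_rel (A ** L) i j k l = 0" for i j k l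
  proof -
    let ?u = "var_u - var_v :: 'a fls fls"
    have r: "?u * comm (in_u (T $ i $ j)) (in_v (T $ k $ l)) = 2 * (in_u (T $ k $ j) * in_v (T $ i $ l) - in_v (T $ k $ j) * in_u (T $ i $ l))"
      if "strong_yangian T" for T :: "'a fps^ix^ix" and i j k l
      using that by (simp add: strong_yangian_def rtt_rel_def)
    have e: "in_u ((A ** L) $ i $ j) = in_u (A $ i $ N1) * in_u (L $ N1 $ j) + in_u (A $ i $ P1) * in_u (L $ P1 $ j)"
      "in_v ((A ** L) $ i $ j) = in_v (A $ i $ N1) * in_v (L $ N1 $ j) + in_v (A $ i $ P1) * in_v (L $ P1 $ j)" for i j
      by (simp_all add: mult_ix in_u_hom in_v_hom)
    have "?u * comm (in_u ((A ** L) $ i $ j)) (in_v ((A ** L) $ k $ l)) =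
        2 * (in_u ((A ** L) $ k $ j) * in_v ((A ** L) $ i $ l) - in_v ((A ** L) $ k $ j) * in_u ((A ** L) $ i $ l))"
    proof (rule rtt_product_aux[of ?u "\<lambda>i j. in_u (A $ i $ j)" "\<lambda>i j. in_v (A $ i $ j)" "\<lambda>i j. in_u (L $ i $ j)" "\<lambda>i j. in_v (L $ i $ j)"
      "\<lambda>i j. in_u ((A ** L) $ i $ j)" "\<lambda>i j. in_v ((A ** L) $ i $ j)", OF _ r[OF A] r[OF L] _ _ _ _ e])
      show "x * ?u = ?u * x" for x by (simp add: right_diff_distrib left_diff_distrib var_u_central var_v_central)
      show "in_u (L $ i $ j) * in_u (A $ k $ l) = in_u (A $ k $ l) * in_u (L $ i $ j)"
        "in_v (L $ i $ j) * in_v (A $ k $ l) = in_v (A $ k $ l) * in_v (L $ i $ j)" for i j k l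
        by (simp_all add: cc flip: in_u_hom in_v_hom)
      show "in_u (L $ i $ j) * in_v (A $ k $ l) = in_v (A $ k $ l) * in_u (L $ i $ j)" for i j k l
        by (rule in_u_in_v_commute) (use c in \<open>simp add: entries_commute_def\<close>)
      show "in_v (L $ i $ j) * in_u (A $ k $ l) = in_u (A $ k $ l) * in_v (L $ i $ j)" for i j k l
        by (rule in_u_in_v_commute[symmetric]) (use c in \<open>simp add: entries_commute_def\<close>)
    qed
    then show ?thesis by (simp add: rtt_rel_def)
  qed
  moreover have "(A ** L) ** sp_transpose (msubst (recip_lin 1 2) (A ** L)) = mat 1"
  proof -
    let ?s = "msubst (recip_lin 1 2) :: 'a fps^ix^ix \<Rightarrow> _"
    have cs: "?s L $ i $ j * ?s A $ k $ l = ?s A $ k $ l * ?s L $ i $ j" for i j k l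
      by (simp add: cc flip: fps_subst_mult)
    \<comment> \<open>Transposition reverses this product because the entries of the two factors
      commute; then L times its shifted transpose is enclosed between A and the shifted transpose of
      A.\<close>
    have "sp_transpose (?s A ** ?s L) = sp_transpose (?s L) ** sp_transpose (?s A)"
      unfolding mat_eq_ix mult_ix sp_transpose_entries by (simp add: cs[simplified])
    then have "(A ** L) ** sp_transpose (?s (A ** L)) = A ** (L ** sp_transpose (?s L)) ** sp_transpose (?s A)"
      by (simp add: msubst_mult matrix_mul_assoc)
    then show ?thesis using A L by (simp add: strong_yangian_def)
  qed
  ultimately show ?thesis by (simp add: strong_yangian_def)
qed

lemma strong_yangian_one: "strong_yangian (mat 1 :: 'a::ring_1 fps^ix^ix)"
proof -
  have "unit_lead (mat 1 :: 'a fps^ix^ix)" by (simp add: mat_ix_entry)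
  moreover have "rtt_coeff (mat 1 :: 'a fps^ix^ix) i j k l r s = 0" for i j k l r s
    by (cases r; cases s) (simp_all add: rtt_coeff_def mat_ix_entry if_distrib[of "\<lambda>f. fps_nth f _"] if_distrib[of "comm _"] cong: if_cong)
  moreover have "mat 1 ** sp_transpose (msubst (recip_lin 1 2) (mat 1 :: 'a fps^ix^ix)) = mat 1"
    by (simp add: mat_eq_ix mult_ix sp_transpose_entries mat_ix_entry)
  ultimately show ?thesis using rtt_rel_eq_0_iff[of "mat 1 :: 'a fps^ix^ix"] by (simp add: strong_yangian_def)
qed


section \<open>Multi-site representations and their leading terms\<close>

definition sM :: "nat \<Rightarrow> ix \<Rightarrow> ix \<Rightarrow> state endo" where
  "sM s i j = mat2_entry (- op Gk s) (2 *\<^sub>C op GF s) (2 *\<^sub>C op GE s) (op Gk s) i j"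

definition site_M :: "nat \<Rightarrow> ix \<Rightarrow> ix \<Rightarrow> state endo fls" where
  "site_M s i j = fls_const (sM s i j)"

text \<open>The pole variable multiplies the evaluation parameter, so the pole order counts powers
  of z. The factor 2 gives the images of E and F the leading coefficients \<open>XX n GE 1\<close>
  and \<open>XX n GF 1\<close> exactly.\<close>

definition site_z :: "nat \<Rightarrow> state endo fls" where
  "site_z s = fls_const (2 *\<^sub>C opZ s) * fls_X_inv"

primrec Tn :: "nat \<Rightarrow> state endo fls fps^ix^ix" where
  "Tn 0 = mat 1" | "Tn (Suc n) = Tn n ** Lop (site_M n) (site_z n)"

lemma sM_comm: "comm (sM s i j) (sM s k l) = 2 * ((if k = j then sM s i l else 0) - (if i = l then sM s k j else 0))"
proof -
  note r = op_sl2(1-3)[of s]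
  have r': "comm (op GE s) (op Gk s) = (- 2) *\<^sub>C op GE s" "comm (op GF s) (op Gk s) = 2 *\<^sub>C op GF s"
    "comm (op GF s) (op GE s) = - op Gk s"
    using r by (simp_all add: comm_swap[of "op GE s" "op Gk s"] comm_swap[of "op GF s"])
  have kk: "op Gk s + op Gk s = 2 *\<^sub>C op Gk s" "- op Gk s - op Gk s = (- 2) *\<^sub>C op Gk s"
    by (simp_all add: scaleC_one flip: scaleC_add_left) (simp_all add: scaleC_numeral mult_2)
  show ?thesis
    by (cases i; cases j; cases k; cases l;
        simp only: sM_def mat2_entry.simps comm_minus_left comm_minus_right comm_scaleC_left comm_scaleC_right comm_self r r'
          ix.distinct if_True if_False refl simp_thms;
        simp add: scaleC_scaleC kk flip: scaleC_numeral;
        simp add: scaleC_complex_def)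
qed

text \<open>The vanishing of the Casimir element in matrix form; it makes the quantum determinant of
  a site equal to 1 without a scalar correction.\<close>

lemma sM_square: "sM s i N1 * sM s N1 j + sM s i P1 * sM s P1 j = 2 * sM s i j"
proof -
  note r = op_sl2(1,2)[of s, unfolded comm_def] op_sl2(4,5)[of s]
  have "op Gk s * op GE s = op GE s * op Gk s + 2 *\<^sub>C op GE s"
    "op Gk s * op GF s = op GF s * op Gk s - 2 *\<^sub>C op GF s"
    using r(1,2) by (simp_all add: algebra_simps)
  note r' = this r(3,4)
  show ?thesis
    using r'(3,4)
    by (cases i; cases j; simp add: sM_def mult_scaleC_left mult_scaleC_right scaleC_scaleC r'(1,2) flip: scaleC_numeral;
        simp add: scaleC_complex_def cvs.scale_right_distrib cvs.scale_right_diff_distrib scaleC_scaleC add.commute)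
qed

lemma X_inv_central: "x * fls_X_inv = fls_X_inv * (x :: 'a::ring_1 fls)"
  by (simp only: fls_X_inv_times_conv_shift)

lemma sM_commute: "s \<noteq> t \<Longrightarrow> sM s i j * sM t k l = sM t k l * sM s i j"
  by (cases i; cases j; cases k; cases l; simp add: sM_def mult_scaleC_left mult_scaleC_right op_commute scaleC_scaleC mult.commute)

lemma sM_Z_commute: "sM s i j * opZ t = opZ t * sM s i j"
  by (cases i; cases j; simp add: sM_def mult_scaleC_left mult_scaleC_right op_Z_commute)

lemma const_z_commute: "x * opZ t = opZ t * x \<Longrightarrow> fls_const x * site_z t = site_z t * fls_const x"
proof -
  assume x: "x * opZ t = opZ t * x"
  have "fls_const x * site_z t = fls_const (x * (2 *\<^sub>C opZ t)) * fls_X_inv"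
    by (simp add: site_z_def mult.assoc[symmetric])
  also have "\<dots> = fls_const (2 *\<^sub>C opZ t * x) * fls_X_inv"
    by (simp add: mult_scaleC_left mult_scaleC_right x)
  also have "\<dots> = site_z t * fls_const x"
    unfolding site_z_def fls_const_mult_const[symmetric] by (simp only: mult.assoc X_inv_central)
  finally show ?thesis .
qed

lemma site_M_z_commute: "site_M s i j * site_z t = site_z t * site_M s i j"
  unfolding site_M_def by (rule const_z_commute[OF sM_Z_commute])

lemma site_z_z_commute: "site_z s * site_z t = site_z t * site_z s"
proof -
  have z: "fls_const (2 *\<^sub>C opZ s) * site_z t = site_z t * fls_const (2 *\<^sub>C opZ s)"
    by (rule const_z_commute) (simp add: mult_scaleC_left mult_scaleC_right Z_Z_commute)
  have "site_z s * site_z t = fls_const (2 *\<^sub>C opZ s) * site_z t * fls_X_inv"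
    unfolding site_z_def[of s] by (simp only: mult.assoc X_inv_central)
  also have "\<dots> = site_z t * site_z s"
    unfolding z unfolding site_z_def[of s] by (simp only: mult.assoc)
  finally show ?thesis .
qed

lemma site_M_commute: "s \<noteq> t \<Longrightarrow> site_M s i j * site_M t k l = site_M t k l * site_M s i j"
  by (simp add: site_M_def sM_commute)

lemma strong_yangian_site: "strong_yangian (Lop (site_M s) (site_z s))"
proof (rule strong_yangian_Lop)
  have two: "2 * fls_const a = fls_const (2 * a)" for a :: "state endo"
    by (simp add: mult_2 fls_plus_const)
  show "comm (site_M s i j) (site_M s k l) = 2 * ((if k = j then site_M s i l else 0) - (if i = l then site_M s k j else 0))" for i j k l
  proof -
    have "comm (site_M s i j) (site_M s k l) = fls_const (comm (sM s i j) (sM s k l))"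
      by (simp add: comm_def site_M_def fls_minus_const)
    then show ?thesis by (simp add: sM_comm) (auto simp: site_M_def two fls_minus_const fls_const_uminus)
  qed
  show "site_M s i N1 * site_M s N1 j + site_M s i P1 * site_M s P1 j = 2 * site_M s i j" for i j
    by (simp add: site_M_def fls_plus_const two sM_square)
  show "site_M s P1 P1 = - site_M s N1 N1"
    by (simp add: site_M_def sM_def)
qed (simp add: site_M_z_commute)

lemma commute_mult: "x * a = a * x \<Longrightarrow> x * b = b * x \<Longrightarrow> x * (a * b) = a * b * (x :: 'a::ring_1)"
  by (metis mult.assoc)

lemma commute_power: "x * a = a * x \<Longrightarrow> x * a ^ k = a ^ k * (x :: 'a::ring_1)"
  by (induction k) (simp_all add: commute_mult)

lemma commute_Lop:
  assumes "\<And>i j. x * M i j = M i j * x" "x * z = z * x"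
  shows "x * fps_nth (Lop M z $ i $ j) r = fps_nth (Lop M z $ i $ j) r * x"
  using commute_mult[OF assms(1) commute_power[OF assms(2)]] by (simp add: Lop_def split: nat.split)

lemma Tn_commute:
  assumes "\<And>s i j. s < n \<Longrightarrow> x * site_M s i j = site_M s i j * x" "\<And>s. s < n \<Longrightarrow> x * site_z s = site_z s * x"
  shows "x * fps_nth (Tn n $ i $ j) r = fps_nth (Tn n $ i $ j) r * x"
  using assms
proof (induction n arbitrary: i j r)
  case 0
  then show ?case by (simp add: mat_ix_entry)
next
  case (Suc n)
  have L: "x * fps_nth (Lop (site_M n) (site_z n) $ i $ j) r = fps_nth (Lop (site_M n) (site_z n) $ i $ j) r * x" for i j r
    using Suc.prems by (intro commute_Lop) simp_all
  show ?case
    by (simp add: mult_ix fps_mult_nth distrib_left distrib_right sum_distrib_left sum_distrib_right commute_mult Suc L)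
qed

lemma strong_yangian_Tn: "strong_yangian (Tn n)"
proof (induction n)
  case 0
  then show ?case by (simp add: strong_yangian_one)
next
  case (Suc n)
  have "entries_commute (Tn n) (Lop (site_M n) (site_z n))"
    unfolding entries_commute_def
  proof (intro allI Tn_commute)
    fix i j k l m and r :: nat
    show "fps_nth (Lop (site_M n) (site_z n) $ i $ j) m * site_M s k l = site_M s k l * fps_nth (Lop (site_M n) (site_z n) $ i $ j) m"
      if "s < n" for s k l
      by (rule commute_Lop[symmetric]) (use that in \<open>simp_all add: site_M_commute site_M_z_commute\<close>)
    show "fps_nth (Lop (site_M n) (site_z n) $ i $ j) m * site_z s = site_z s * fps_nth (Lop (site_M n) (site_z n) $ i $ j) m"
      if "s < n" for s
      by (rule commute_Lop[symmetric]) (simp_all add: site_M_z_commute site_z_z_commute)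
  qed
  then show ?case using Suc strong_yangian_site by (simp add: strong_yangian_mult)
qed

lemma unit_lead_Tn: "unit_lead (Tn n)"
  using strong_yangian_Tn by (simp add: strong_yangian_def)

lemma lead_Tn_1: "lead 0 (fps_nth (Tn n $ i $ j) 1) (\<Sum>s<n. sM s i j)"
proof (induction n)
  case (Suc n)
  have "fps_nth (Tn (Suc n) $ i $ j) 1 = fps_nth (Tn n $ i $ j) 1 + site_M n i j"
    using unit_lead_Tn[of n] by (cases i; cases j) (simp_all add: mult_ix fps_mult_nth Lop_def)
  then show ?case using lead_add[OF Suc lead_const[of "sM n i j"]] by (simp add: site_M_def)
qed (simp add: mat_ix_entry lead_zero)

text \<open>Products of first coefficients have no pole, so at pole order 1 only the single-site
  terms M_s z_s remain.\<close>

lemma lead_Tn_2: "lead 1 (fps_nth (Tn n $ i $ j) 2) (\<Sum>s<n. sM s i j * (2 *\<^sub>C opZ s))"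
proof (induction n)
  case (Suc n)
  have e: "fps_nth (Tn (Suc n) $ i $ j) 2 = fps_nth (Tn n $ i $ j) 2 + site_M n i j * site_z n +
     (fps_nth (Tn n $ i $ N1) 1 * site_M n N1 j + fps_nth (Tn n $ i $ P1) 1 * site_M n P1 j)"
    using unit_lead_Tn[of n] by (cases i; cases j) (simp_all add: mult_ix fps_mult_nth Lop_def numeral_2_eq_2 add_ac)
  have 0: "lead 1 (fps_nth (Tn n $ i $ k) 1 * site_M n k j) 0" for k
    using lead_less[OF lead_mult[OF lead_Tn_1 lead_const]] by (simp add: site_M_def)
  have z: "lead (0 + 1) (site_M n i j * site_z n) (sM n i j * (2 *\<^sub>C opZ n))"
    unfolding site_M_def site_z_def by (rule lead_mult[OF lead_const lead_X_inv])
  show ?case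
    unfolding e using lead_add[OF lead_add[OF Suc z[unfolded add_0_left]] lead_add[OF 0 0]] by simp
qed (simp add: mat_ix_entry lead_zero)

text \<open>The element g z^p of the current algebra, acting on n sites by the sum over the
  sites.\<close>

definition XX :: "nat \<Rightarrow> ygen \<Rightarrow> nat \<Rightarrow> state endo" where
  "XX n g p = (\<Sum>s<n. op g s * opZ s ^ p)"

lemma Z_pow_commute: "op g s * opZ t ^ p = opZ t ^ p * op g s"
  by (rule commute_power[OF op_Z_commute])

lemma Z_pow_pow_commute: "opZ s ^ p * opZ t ^ q = opZ t ^ q * opZ s ^ p"
  by (rule commute_power[OF commute_power[OF Z_Z_commute, symmetric]])

lemma XX_comm:
  assumes "\<And>s. comm (op g s) (op g' s) = c *\<^sub>C op g'' s"
  shows "comm (XX n g p) (XX n g' q) = c *\<^sub>C XX n g'' (p + q)"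
proof -
  have m: "op g s * opZ s ^ p * (op g' t * opZ t ^ q) = op g s * op g' t * (opZ s ^ p * opZ t ^ q)" for g g' s t p q
    by (metis mult.assoc Z_pow_commute)
  have c: "comm (op g s * opZ s ^ p) (op g' t * opZ t ^ q) = (if s = t then c *\<^sub>C (op g'' s * opZ s ^ (p + q)) else 0)" for s t
  proof (cases "s = t")
    case True
    then show ?thesis
      using assms[of s] unfolding comm_def m
      by (simp add: add.commute[of q p] flip: power_add left_diff_distrib mult_scaleC_left)
  next
    case False
    then show ?thesis unfolding comm_def m by (simp add: op_commute[OF False] Z_pow_pow_commute[of t q])
  qed
  have "comm (XX n g p) (XX n g' q) = (\<Sum>s<n. \<Sum>t<n. comm (op g s * opZ s ^ p) (op g' t * opZ t ^ q))"
    unfolding XX_def comm_def sum_product sum_subtractf by (subst (3) sum.swap) simp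
  also have "\<dots> = c *\<^sub>C XX n g'' (p + q)"
    unfolding c XX_def by (simp add: cvs.scale_sum_right)
  finally show ?thesis .
qed

text \<open>The universal property applied to \<open>Tn n\<close>. In B_2 and C_2 the quadratic
  terms have pole order 0, so the leading coefficients come from the second coefficients of T
  alone.\<close>

lemma rep_exists:
  "\<exists>\<rho> :: Y_sp2 \<Rightarrow> state endo fls. algebra_hom \<rho> \<and> lead 0 (\<rho> ((- 1 / 2) *\<^sub>C Y.A 1)) (XX n Gk 0) \<and>
     lead 1 (\<rho> ((1 / 8) *\<^sub>C Y.C 2)) (XX n GE 1) \<and> lead 1 (\<rho> ((- 1 / 8) *\<^sub>C Y.B 2)) (XX n GF 1)"
proof -
  obtain \<rho> :: "Y_sp2 \<Rightarrow> state endo fls" where \<rho>: "algebra_hom \<rho>" and T: "map_matrix (fps_map \<rho>) T_Y = Tn n"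
    using Y_sp2_hom_of_yangian_matrix[OF strong_yangian_imp[OF strong_yangian_Tn]] by blast
  note h = algebra_homD[OF \<rho>]
  have t: "\<rho> (fps_nth (T_Y $ i $ j) r) = fps_nth (Tn n $ i $ j) r" for i j r
    unfolding T[symmetric] by simp
  have two: "\<rho> (2 * x) = \<rho> x + \<rho> x" for x by (simp add: mult_2 h)
  let ?K = "\<Sum>s<n. - op Gk s" and ?t = "\<lambda>i j. fps_nth (Tn n $ i $ j) 1" and ?s = "\<lambda>i j. fps_nth (Tn n $ i $ j) 2"
  have 1: "lead 1 (?t i j * ?t k l) 0" for i j k l
    using lead_less[OF lead_mult[OF lead_Tn_1 lead_Tn_1]] by simp
  have dup: "c *\<^sub>C (a *\<^sub>C x + a *\<^sub>C x) = (c * (a + a)) *\<^sub>C x" for c a and x :: "state endo"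
    by (simp only: scaleC_add_left scaleC_add_right distrib_left scaleC_scaleC)
  have "lead 0 ((- 1 / 2) *\<^sub>C (?t N1 N1 + ?t N1 N1)) ((- 1 / 2) *\<^sub>C ((\<Sum>s<n. sM s N1 N1) + (\<Sum>s<n. sM s N1 N1)))"
    by (intro lead_scaleC lead_add lead_Tn_1)
  moreover have "(- 1 / 2) *\<^sub>C ((\<Sum>s<n. sM s N1 N1) + (\<Sum>s<n. sM s N1 N1)) = XX n Gk 0"
  proof -
    have "(\<Sum>s<n. sM s N1 N1) = (- 1) *\<^sub>C XX n Gk 0"
      by (simp add: XX_def sM_def sum_negf scaleC_one)
    then show ?thesis by (simp only: dup) (simp add: scaleC_one)
  qed
  ultimately have A: "lead 0 (\<rho> ((- 1 / 2) *\<^sub>C Y.A 1)) (XX n Gk 0)"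
    unfolding Y.S_low(7) h(4) two t by simp
  have "lead 1 ((1 / 8) *\<^sub>C (?s P1 N1 + ?s P1 N1 + ?t P1 N1 * ?t N1 N1 + ?t N1 N1 * ?t P1 N1))
     ((1 / 8) *\<^sub>C ((\<Sum>s<n. sM s P1 N1 * (2 *\<^sub>C opZ s)) + (\<Sum>s<n. sM s P1 N1 * (2 *\<^sub>C opZ s)) + 0 + 0))"
    by (intro lead_scaleC lead_add lead_Tn_2 1)
  moreover have "(1 / 8) *\<^sub>C ((\<Sum>s<n. sM s P1 N1 * (2 *\<^sub>C opZ s)) + (\<Sum>s<n. sM s P1 N1 * (2 *\<^sub>C opZ s)) + 0 + 0) = XX n GE 1"
  proof -
    have "(\<Sum>s<n. sM s P1 N1 * (2 *\<^sub>C opZ s)) = 4 *\<^sub>C XX n GE 1"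
      by (simp add: XX_def sM_def mult_scaleC_left mult_scaleC_right scaleC_scaleC cvs.scale_sum_right)
    then show ?thesis by (simp only: add_0_right dup) (simp add: scaleC_one)
  qed
  ultimately have C: "lead 1 (\<rho> ((1 / 8) *\<^sub>C Y.C 2)) (XX n GE 1)"
    unfolding Y.S_low(10) h(2,4) two unfolding h(3) t by simp
  have "lead 1 ((- 1 / 8) *\<^sub>C (?t N1 N1 * ?t N1 P1 + ?t N1 P1 * ?t N1 N1 - (?s N1 P1 + ?s N1 P1)))
     ((- 1 / 8) *\<^sub>C (0 + 0 - ((\<Sum>s<n. sM s N1 P1 * (2 *\<^sub>C opZ s)) + (\<Sum>s<n. sM s N1 P1 * (2 *\<^sub>C opZ s)))))"
    by (intro lead_scaleC lead_add lead_diff lead_Tn_2 1)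
  moreover have "(- 1 / 8) *\<^sub>C (0 + 0 - ((\<Sum>s<n. sM s N1 P1 * (2 *\<^sub>C opZ s)) + (\<Sum>s<n. sM s N1 P1 * (2 *\<^sub>C opZ s)))) = XX n GF 1"
  proof -
    have "(\<Sum>s<n. sM s N1 P1 * (2 *\<^sub>C opZ s)) = 4 *\<^sub>C XX n GF 1"
      by (simp add: XX_def sM_def mult_scaleC_left mult_scaleC_right scaleC_scaleC cvs.scale_sum_right)
    then show ?thesis
      by (simp only: add_0_right diff_0 cvs.scale_minus_right[symmetric] cvs.scale_minus_left[symmetric] minus_add_distrib dup) (simp add: scaleC_one)
  qed
  ultimately have B: "lead 1 (\<rho> ((- 1 / 8) *\<^sub>C Y.B 2)) (XX n GF 1)"
    unfolding Y.S_low(9) h(2,4,7) two unfolding h(3) t by simp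
  show ?thesis using \<rho> A B C by blast
qed

abbreviation X :: "nat \<Rightarrow> ygen \<times> nat \<Rightarrow> state endo" where
  "X n x \<equiv> XX n (fst x) (wt x)"

context filtered_serre
begin

text \<open>Leading coefficients are multiplicative, and by \<open>XX_comm\<close> their brackets
  follow the same recursion that defines \<open>e\<close>, \<open>f\<close> and
  \<open>h\<close>.\<close>

lemma lead_el:
  assumes \<psi>: "algebra_hom \<psi>" and k: "lead 0 (\<psi> k) (XX n Gk 0)" and E: "lead 1 (\<psi> E) (XX n GE 1)"
    and F: "lead 1 (\<psi> F) (XX n GF 1)"
  shows "lead (wt x) (\<psi> (el x)) (X n x)"
proof -
  note h' = algebra_homD[OF \<psi>] algebra_hom_comm[OF \<psi>]
  have H: "lead 2 (\<psi> H) (XX n Gk 2)"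
    using lead_comm[OF E F] XX_comm[of GE GF 1 Gk n 1 1] op_sl2(3) by (simp add: h' scaleC_one numeral_2_eq_2)
  have e: "lead (2 * i + 1) (\<psi> (e i)) (XX n GE (2 * i + 1))" for i
  proof (induction i)
    case 0 then show ?case using E by simp
  next
    case (Suc i)
    from lead_scaleC[OF lead_comm[OF H Suc], of "1 / 2"] XX_comm[OF op_sl2(1), of n 2 "2 * i + 1"]
    show ?case by (simp add: h' e.simps(2) scaleC_scaleC scaleC_one)
  qed
  have f: "lead (2 * i + 1) (\<psi> (f i)) (XX n GF (2 * i + 1))" for i
  proof (induction i)
    case 0 then show ?case using F by simp
  next
    case (Suc i)
    from lead_scaleC[OF lead_comm[OF H Suc], of "- 1 / 2"] XX_comm[OF op_sl2(2), of n 2 "2 * i + 1"]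
    show ?case by (simp add: h' f.simps(2) scaleC_scaleC scaleC_one)
  qed
  have hh: "lead (2 * i) (\<psi> (h i)) (XX n Gk (2 * i))" for i
  proof (cases i)
    case 0 then show ?thesis using k by (simp add: h_simps)
  next
    case (Suc j)
    from lead_comm[OF E f[of j]] XX_comm[of GE GF 1 Gk n 1 "2 * j + 1"] op_sl2(3)
    show ?thesis by (simp add: Suc h' h_simps scaleC_one)
  qed
  show ?thesis using e f hh by (cases x rule: wt.cases) simp_all
qed

lemma lead_W:
  assumes "algebra_hom \<psi>" "lead 0 (\<psi> k) (XX n Gk 0)" "lead 1 (\<psi> E) (XX n GE 1)" "lead 1 (\<psi> F) (XX n GF 1)"
  shows "lead (wtl w) (\<psi> (W w)) (prod_list (map (X n) w))"
proof (induction w)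
  case Nil
  then show ?case using lead_const[of 1] by (simp add: algebra_homD[OF assms(1)])
next
  case (Cons x w)
  then show ?case using lead_mult[OF lead_el[OF assms, of x] Cons] by (simp add: algebra_homD[OF assms(1)])
qed

end


section \<open>Independence of monomials by adding one site at a time\<close>

section \<open>Linear independence of the ordered monomials\<close>

text \<open>When \<phi> ignores site n, this is the tensor product of \<phi> with the basis vector p
  at that site.\<close>

definition ins :: "nat \<Rightarrow> nat \<times> nat \<Rightarrow> (state \<Rightarrow> complex) \<Rightarrow> state \<Rightarrow> complex" where
  "ins n p \<phi> b = (if b n = p then \<phi> b else 0)"

definition indep_from :: "nat \<Rightarrow> (state \<Rightarrow> complex) \<Rightarrow> bool" where
  "indep_from n \<phi> \<longleftrightarrow> (\<forall>m\<ge>n. \<forall>p b. \<phi> (b(m := p)) = \<phi> b)"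

text \<open>A letter x sends the basis state p of a site to \<open>cf x p\<close> times
  \<open>act x p\<close>. The truncated m - 1 at m = 0 comes with coefficient 0.\<close>

fun act :: "ygen \<times> nat \<Rightarrow> nat \<times> nat \<Rightarrow> nat \<times> nat" where
  "act (Gk, i) (m, q) = (m, q + wt (Gk, i))"
| "act (GE, i) (m, q) = (m - 1, q + wt (GE, i))"
| "act (GF, i) (m, q) = (m + 1, q + wt (GF, i))"

fun cf :: "ygen \<times> nat \<Rightarrow> nat \<times> nat \<Rightarrow> complex" where
  "cf (Gk, i) (m, q) = - 2 * of_nat m"
| "cf (GE, i) (m, q) = of_nat m"
| "cf (GF, i) (m, q) = - of_nat m"

lemma app_wshift_indep: "indep_from n \<phi> \<Longrightarrow> s < n \<Longrightarrow> indep_from n (app (wshift s w \<sigma>) \<phi>)"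
  unfolding indep_from_def app_wshift
proof (intro allI impI)
  fix m p b assume \<phi>: "\<forall>m\<ge>n. \<forall>p b. \<phi> (b(m := p)) = \<phi> b" and "s < n" "n \<le> m"
  then have s: "m \<noteq> s" by simp
  have "\<phi> (b(m := p, s := \<sigma> (b s))) = \<phi> (b(s := \<sigma> (b s), m := p))" by (subst fun_upd_twist[OF s]) simp
  then show "w ((b(m := p)) s) * \<phi> (b(m := p, s := \<sigma> ((b(m := p)) s))) = w (b s) * \<phi> (b(s := \<sigma> (b s)))"
    using \<phi> \<open>n \<le> m\<close> s by simp
qed

lemma app_wshift_ins: "s \<noteq> n \<Longrightarrow> app (wshift s w \<sigma>) (ins n p \<phi>) = ins n p (app (wshift s w \<sigma>) \<phi>)"
  by (simp add: fun_eq_iff app_wshift ins_def)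

lemma app_Z_ins: "indep_from n \<phi> \<Longrightarrow> app (opZ n) (ins n (m, q) \<phi>) = ins n (m, Suc q) \<phi>"
  by (auto simp: fun_eq_iff opZ_def app_wshift ins_def indep_from_def split: prod.split)

lemma app_Z_pow_ins: "indep_from n \<phi> \<Longrightarrow> app (opZ n ^ d) (ins n (m, q) \<phi>) = ins n (m, q + d) \<phi>"
  by (induction d) (simp_all add: app_Z_ins)

lemma app_op_ins:
  assumes "indep_from n \<phi>"
  shows "app (op g n * opZ n ^ wt (g, i)) (ins n p \<phi>) = (\<lambda>b. cf (g, i) p * ins n (act (g, i) p) \<phi> b)"
proof -
  obtain m q where p: "p = (m, q)" by (cases p)
  have \<phi>: "\<phi> (b(n := r)) = \<phi> b" for b r using assms unfolding indep_from_def by blast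
  show ?thesis
    unfolding p app_simps app_Z_pow_ins[OF assms]
  proof (rule ext)
    fix b :: state
    obtain m' q' where b: "b n = (m', q')" by (cases "b n")
    show "app (op g n) (ins n (m, q + wt (g, i)) \<phi>) b = cf (g, i) (m, q) * ins n (act (g, i) (m, q)) \<phi> b"
      by (cases g; cases m; cases m') (auto simp: op.simps app_wshift ins_def b \<phi> algebra_simps)
  qed
qed

lemma app_op_indep: "indep_from n \<phi> \<Longrightarrow> s < n \<Longrightarrow> indep_from n (app (op g s * opZ s ^ d) \<phi>)"
proof -
  assume \<phi>: "indep_from n \<phi>" and s: "s < n"
  have "indep_from n (app (opZ s ^ d) \<phi>)"
    by (induction d) (use \<phi> s in \<open>simp_all add: opZ_def app_wshift_indep\<close>)
  then show ?thesis using s by (cases g) (simp_all add: op.simps app_wshift_indep)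
qed

lemma app_op_ins_other: "s \<noteq> n \<Longrightarrow> app (op g s * opZ s ^ d) (ins n p \<phi>) = ins n p (app (op g s * opZ s ^ d) \<phi>)"
proof -
  assume s: "s \<noteq> n"
  have "app (opZ s ^ d) (ins n p \<phi>) = ins n p (app (opZ s ^ d) \<phi>)"
    by (induction d) (simp_all add: opZ_def app_wshift_ins s)
  then show ?thesis by (cases g) (simp_all add: op.simps app_wshift_ins s)
qed

lemma app_X: "app (X n x) \<phi> b = (\<Sum>s<n. app (op (fst x) s * opZ s ^ wt x) \<phi> b)"
  by (simp only: XX_def app_sum)

text \<open>The additional site contributes one more summand, which moves its basis state by
  \<open>app_op_ins\<close>.\<close>

lemma app_X_Suc_ins:
  assumes "indep_from n \<phi>"
  shows "app (X (Suc n) x) (ins n p \<phi>) b = ins n p (app (X n x) \<phi>) b + cf x p * ins n (act x p) \<phi> b"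
proof -
  have "(\<Sum>s<n. app (op (fst x) s * opZ s ^ wt x) (ins n p \<phi>) b) = ins n p (app (X n x) \<phi>) b"
  proof -
    have "(\<Sum>s<n. app (op (fst x) s * opZ s ^ wt x) (ins n p \<phi>) b) =
        (\<Sum>s<n. ins n p (app (op (fst x) s * opZ s ^ wt x) \<phi>) b)"
      by (intro sum.cong refl) (subst app_op_ins_other, auto)
    then show ?thesis by (simp only: ins_def app_X) simp
  qed
  moreover have "app (op (fst x) n * opZ n ^ wt x) (ins n p \<phi>) b = cf x p * ins n (act x p) \<phi> b"
    using app_op_ins[OF assms, of "fst x" "snd x" p] by simp
  ultimately show ?thesis by (simp only: app_X sum.lessThan_Suc)
qed

lemma app_X_indep: "indep_from n \<phi> \<Longrightarrow> indep_from n (app (X n x) \<phi>)"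
  using app_op_indep[of n \<phi> _ "fst x" "wt x"] by (simp only: indep_from_def app_X) simp

abbreviation Wn :: "nat \<Rightarrow> (ygen \<times> nat) list \<Rightarrow> state endo" where
  "Wn n w \<equiv> prod_list (map (X n) w)"

lemma app_Wn_indep: "indep_from n \<phi> \<Longrightarrow> indep_from n (app (Wn n w) \<phi>)"
  by (induction w) (simp_all add: app_X_indep)

text \<open>
  \<open>hits w p\<close> lists the contributions to the action of \<open>w\<close> on a state in which one additional
  site starts in \<open>p\<close>: a coefficient, the letters of \<open>w\<close> acting on the other sites, and the
  final state of the additional site.
\<close>

fun hits :: "(ygen \<times> nat) list \<Rightarrow> nat \<times> nat \<Rightarrow> (complex \<times> (ygen \<times> nat) list \<times> nat \<times> nat) list" where
  "hits [] p = [(1, [], p)]"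
| "hits (x # w) p = map (\<lambda>(c, v, q). (c, x # v, q)) (hits w p) @ map (\<lambda>(c, v, q). (c * cf x q, v, act x q)) (hits w p)"

lemma app_sum_list:
  "app x (\<lambda>b. \<Sum>t\<leftarrow>ts. c t * \<psi> t b) = (\<lambda>b. \<Sum>t\<leftarrow>ts. c t * app x (\<psi> t) b)"
proof (induction ts)
  case Nil
  then show ?case using app_linear(2)[of x 0 "\<lambda>b. 0"] by simp
next
  case (Cons t ts)
  then show ?case by (simp add: app_linear)
qed

lemma app_Wn_Suc_ins:
  assumes "indep_from n \<phi>"
  shows "app (Wn (Suc n) w) (ins n p \<phi>) = (\<lambda>b. \<Sum>t\<leftarrow>hits w p. fst t * ins n (snd (snd t)) (app (Wn n (fst (snd t))) \<phi>) b)"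
proof (induction w)
  case (Cons x w)
  have "app (Wn (Suc n) (x # w)) (ins n p \<phi>) =
      (\<lambda>b. \<Sum>t\<leftarrow>hits w p. fst t * app (X (Suc n) x) (ins n (snd (snd t)) (app (Wn n (fst (snd t))) \<phi>)) b)"
    by (simp add: Cons app_sum_list)
  also have "\<dots> = (\<lambda>b. \<Sum>t\<leftarrow>hits (x # w) p. fst t * ins n (snd (snd t)) (app (Wn n (fst (snd t))) \<phi>) b)"
    by (simp add: app_X_Suc_ins[OF app_Wn_indep[OF assms]] fun_eq_iff o_def split_beta distrib_left sum_list_addf mult.assoc)
  finally show ?case .
qed simp

lemma hits_length: "t \<in> set (hits w p) \<Longrightarrow> length (fst (snd t)) \<le> length w"
  by (induction w arbitrary: t) (auto intro: le_SucI)

lemma hits_full: "filter (\<lambda>t. length (fst (snd t)) = length w) (hits w p) = [(1, w, p)]"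
proof (induction w)
  case (Cons x w)
  have "filter (\<lambda>t. length (fst (snd t)) = Suc (length w)) (map (\<lambda>(c, v, q). (c * cf x q, v, act x q)) (hits w p)) = []"
    using hits_length[of _ w p] by (fastforce simp: filter_empty_conv)
  with Cons show ?case by (simp add: filter_map o_def split_beta)
qed simp

lemma sum_list_filter: "(\<Sum>t\<leftarrow>filter P ts. h t) = (\<Sum>t\<leftarrow>ts. if P t then h t else (0 :: complex))"
  by (induction ts) auto

lemma sum_hits_full: "(\<Sum>t\<leftarrow>hits w p. if length (fst (snd t)) = length w then h t else 0) = (h (1, w, p) :: complex)"
  using sum_list_filter[of h "\<lambda>t. length (fst (snd t)) = length w" "hits w p"] by (simp add: hits_full)

text \<open>The vector x in the site basis: no letter kills it, and its image determines the
  letter.\<close>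

abbreviation (input) "p0 \<equiv> (1 :: nat, 0 :: nat)"

lemma act_p0_inj: "act y p0 = act x p0 \<longleftrightarrow> y = x"
  by (cases x rule: wt.cases; cases y rule: wt.cases) auto

lemma cf_p0_neq_0: "cf x p0 \<noteq> 0"
  by (cases x rule: wt.cases) auto

text \<open>A single letter of w acts on the new site, and it must be x because the image of
  \<open>p0\<close> determines the letter; each occurrence of x in w contributes
  \<open>cf x p0\<close>.\<close>

lemma sum_hits_single:
  "(\<Sum>t\<leftarrow>hits w p0. if Suc (length (fst (snd t))) = length w \<and> snd (snd t) = act x p0 \<and> mset (fst (snd t)) = M then fst t else 0) =
    (if mset w = add_mset x M then cf x p0 * of_nat (count (mset w) x) else 0)"
proof (induction w arbitrary: M)
  case (Cons y w)
  let ?P = "\<lambda>w M t. Suc (length (fst (snd t))) = length w \<and> snd (snd t) = act x p0 \<and> mset (fst (snd t)) = M"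
  have 1: "(\<Sum>t\<leftarrow>hits w p0. if ?P (y # w) M (fst t, y # fst (snd t), snd (snd t)) then fst t else 0) =
      (if y \<in># M \<and> add_mset y (mset w) = add_mset x M then cf x p0 * of_nat (count (mset w) x) else 0)"
  proof (cases "y \<in># M")
    case True
    then obtain M' where M': "M = add_mset y M'" by (metis mset_add)
    show ?thesis using Cons[of M'] unfolding M' by (simp add: add_mset_commute[of x y])
  next
    case False
    have "(\<Sum>t\<leftarrow>hits w p0. if ?P (y # w) M (fst t, y # fst (snd t), snd (snd t)) then fst t else 0) = (\<Sum>t\<leftarrow>hits w p0. 0)"
      by (intro arg_cong[where f = sum_list] map_cong) (use False in auto)
    then show ?thesis using False by simp
  qed
  have 2: "(\<Sum>t\<leftarrow>hits w p0. if ?P (y # w) M (fst t * cf y (snd (snd t)), fst (snd t), act y (snd (snd t))) then fst t * cf y (snd (snd t)) else 0) =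
      (if y = x \<and> mset w = M then cf x p0 else 0)"
  proof -
    have "(\<Sum>t\<leftarrow>hits w p0. if ?P (y # w) M (fst t * cf y (snd (snd t)), fst (snd t), act y (snd (snd t))) then fst t * cf y (snd (snd t)) else 0) =
        (\<Sum>t\<leftarrow>hits w p0. if length (fst (snd t)) = length w then (if act y (snd (snd t)) = act x p0 \<and> mset (fst (snd t)) = M then fst t * cf y (snd (snd t)) else 0) else 0)"
      by (intro arg_cong[where f = sum_list] map_cong) auto
    also have "\<dots> = (if y = x \<and> mset w = M then cf x p0 else 0)"
      unfolding sum_hits_full by (auto simp: act_p0_inj simp del: One_nat_def)
    finally show ?thesis .
  qed
  have "(\<Sum>t\<leftarrow>hits (y # w) p0. if ?P (y # w) M t then fst t else 0) =
      (if y \<in># M \<and> add_mset y (mset w) = add_mset x M then cf x p0 * of_nat (count (mset w) x) else 0) +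
      (if y = x \<and> mset w = M then cf x p0 else 0)"
    unfolding 1[symmetric] 2[symmetric] by (simp add: o_def split_beta cong: if_cong)
  also have "\<dots> = (if mset (y # w) = add_mset x M then cf x p0 * of_nat (count (mset (y # w)) x) else 0)"
  proof (cases "add_mset y (mset w) = add_mset x M")
    case True
    show ?thesis
    proof (cases "y = x")
      case yx: True
      with True have "mset w = M" by simp
      then show ?thesis using yx by (cases "x \<in># M") (simp_all add: distrib_left not_in_iff)
    next
      case False
      then have "y \<in># M" using True by (metis insert_noteq_member)
      moreover have "count (mset (y # w)) x = count (mset w) x" using False by simp
      ultimately show ?thesis using True False by (simp del: count_add_mset)
    qed
  next
    case False
    then show ?thesis by auto
  qed
  finally show ?case .
qed auto

text \<open>Q is read as a formal combination of words. This is the part of its action in which a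
  new site goes from \<open>p0\<close> to p1, without the terms where no letter acts on that
  site.\<close>

definition terms_at :: "nat \<times> nat \<Rightarrow> (complex \<times> (ygen \<times> nat) list) list \<Rightarrow> (complex \<times> (ygen \<times> nat) list) list" where
  "terms_at p1 Q = concat (map (\<lambda>(c0, w). map (\<lambda>t. (c0 * fst t, fst (snd t)))
     (filter (\<lambda>t. snd (snd t) = p1 \<and> length (fst (snd t)) < length w) (hits w p0))) Q)"

lemma sum_list_terms_at: "(\<Sum>t\<leftarrow>terms_at p1 Q. h t) =
    (\<Sum>(c0, w)\<leftarrow>Q. \<Sum>t\<leftarrow>hits w p0. if snd (snd t) = p1 \<and> length (fst (snd t)) < length w then h (c0 * fst t, fst (snd t)) else (0 :: complex))"
  unfolding terms_at_def by (induction Q) (auto simp: o_def sum_list_filter)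

text \<open>Induction on the length. Put a new site in the state \<open>p0\<close> and isolate the
  final state \<open>act x p0\<close>: each longest word loses one letter x, with a factor counting
  the occurrences of x. This gives a relation between words of length at most p, to which the
  induction hypothesis applies with one x removed from M. The relation is assumed for every n
  because each step uses up one site.\<close>

lemma words_independent:
  assumes "\<And>c w. (c, w) \<in> set Q \<Longrightarrow> length w \<le> p"
    and "\<And>n \<phi> b. indep_from n \<phi> \<Longrightarrow> (\<Sum>(c, w)\<leftarrow>Q. c * app (Wn n w) \<phi> b) = 0"
    and "size M = p"
  shows "(\<Sum>(c, w)\<leftarrow>Q. if mset w = M then c else 0) = 0"
  using assms
proof (induction p arbitrary: Q M)
  case 0
  have w: "w = []" if "(c, w) \<in> set Q" for c w using 0(1)[OF that] by simp
  have "(\<Sum>(c, w)\<leftarrow>Q. if mset w = M then c else 0) = (\<Sum>(c, w)\<leftarrow>Q. c * app (Wn 0 w) (\<lambda>_. 1) (\<lambda>_. (0, 0)))"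
    using 0(3) by (intro arg_cong[where f = sum_list] map_cong) (auto dest!: w)
  also have "\<dots> = 0" by (rule 0(2)) (simp add: indep_from_def)
  finally show ?case .
next
  case (Suc p)
  from Suc.prems(3) obtain x M' where M: "M = add_mset x M'" and M': "size M' = p" by (cases M) auto
  let ?p1 = "act x p0"
  \<comment> \<open>The component of the relation on n + 1 sites with the new site in the final
    state \<open>act x p0\<close> is a relation between shorter words on the old sites.\<close>
  have vanish: "(\<Sum>(c, v)\<leftarrow>terms_at ?p1 Q. c * app (Wn n v) \<phi> b) = 0" if \<phi>: "indep_from n \<phi>" for n \<phi> b
  proof -
    let ?b = "b(n := ?p1)"
    have b: "app (Wn n v) \<phi> ?b = app (Wn n v) \<phi> b" for v
      using app_Wn_indep[OF \<phi>, of v] unfolding indep_from_def by blast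
    have "indep_from (Suc n) (ins n p0 \<phi>)"
      using \<phi> by (auto simp: indep_from_def ins_def)
    then have "0 = (\<Sum>(c, w)\<leftarrow>Q. c * app (Wn (Suc n) w) (ins n p0 \<phi>) ?b)"
      using Suc.prems(2) by simp
    also have "\<dots> = (\<Sum>(c0, w)\<leftarrow>Q. \<Sum>t\<leftarrow>hits w p0. if snd (snd t) = ?p1 then c0 * fst t * app (Wn n (fst (snd t))) \<phi> b else 0)"
      unfolding app_Wn_Suc_ins[OF \<phi>]
      by (intro arg_cong[where f = sum_list] map_cong refl)
        (auto simp: ins_def b sum_list_const_mult[symmetric] mult.assoc simp del: One_nat_def intro!: arg_cong[where f = sum_list] map_cong)
    also have "\<dots> = (\<Sum>(c0, w)\<leftarrow>Q. (\<Sum>t\<leftarrow>hits w p0. if snd (snd t) = ?p1 \<and> length (fst (snd t)) < length w then c0 * fst t * app (Wn n (fst (snd t))) \<phi> b else 0) +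
        (if p0 = ?p1 then c0 * app (Wn n w) \<phi> b else 0))"
    proof (intro arg_cong[where f = sum_list] map_cong refl, clarify)
      fix c0 w
      have "(\<Sum>t\<leftarrow>hits w p0. if snd (snd t) = ?p1 then c0 * fst t * app (Wn n (fst (snd t))) \<phi> b else 0) =
         (\<Sum>t\<leftarrow>hits w p0. (if snd (snd t) = ?p1 \<and> length (fst (snd t)) < length w then c0 * fst t * app (Wn n (fst (snd t))) \<phi> b else 0) +
           (if length (fst (snd t)) = length w then (if snd (snd t) = ?p1 then c0 * fst t * app (Wn n (fst (snd t))) \<phi> b else 0) else 0))"
        using hits_length[of _ w p0] by (intro arg_cong[where f = sum_list] map_cong refl) force
      also have "\<dots> = (\<Sum>t\<leftarrow>hits w p0. if snd (snd t) = ?p1 \<and> length (fst (snd t)) < length w then c0 * fst t * app (Wn n (fst (snd t))) \<phi> b else 0) +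
        (if p0 = ?p1 then c0 * app (Wn n w) \<phi> b else 0)"
        unfolding sum_list_addf sum_hits_full by simp
      finally show "(\<Sum>t\<leftarrow>hits w p0. if snd (snd t) = ?p1 then c0 * fst t * app (Wn n (fst (snd t))) \<phi> b else 0) = \<dots>" .
    qed
    also have "\<dots> = (\<Sum>(c, v)\<leftarrow>terms_at ?p1 Q. c * app (Wn n v) \<phi> b) + (\<Sum>(c0, w)\<leftarrow>Q. if p0 = ?p1 then c0 * app (Wn n w) \<phi> b else 0)"
      unfolding sum_list_terms_at by (simp add: case_prod_unfold sum_list_addf cong: if_cong)
    \<comment> \<open>Terms that leave the new site untouched end in \<open>p0\<close>. This is the
      wanted final state only for the letter \<open>(Gk, 0)\<close>, and then they add up to the
      given relation, which is 0.\<close>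
    also have "(\<Sum>(c0, w)\<leftarrow>Q. if p0 = ?p1 then c0 * app (Wn n w) \<phi> b else 0) = 0"
      using Suc.prems(2)[OF \<phi>, of b] by (cases "p0 = ?p1") (simp_all add: case_prod_unfold)
    finally show ?thesis by simp
  qed
  have "(\<Sum>(c, v)\<leftarrow>terms_at ?p1 Q. if mset v = M' then c else 0) = 0"
  proof (rule Suc.IH[OF _ vanish M'])
    fix c v assume "(c, v) \<in> set (terms_at ?p1 Q)"
    then obtain c0 w where "(c0, w) \<in> set Q" "length v < length w" by (auto simp: terms_at_def)
    then show "length v \<le> p" using Suc.prems(1)[of c0 w] by simp
  qed
  \<comment> \<open>Only words of length p + 1 that lose a single letter leave a word of length p;
    these are counted by \<open>sum_hits_single\<close>.\<close>
  moreover have "(\<Sum>(c, v)\<leftarrow>terms_at ?p1 Q. if mset v = M' then c else 0) =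
      (\<Sum>(c0, w)\<leftarrow>Q. (if mset w = M then c0 else 0) * (cf x p0 * of_nat (count M x)))"
    unfolding sum_list_terms_at case_prod_unfold fst_conv snd_conv
  proof (intro arg_cong[where f = sum_list] map_cong refl)
    fix cw assume cw: "cw \<in> set Q"
    have len: "length (snd cw) \<le> Suc p" using Suc.prems(1)[of "fst cw" "snd cw"] cw by simp
    have "(\<Sum>t\<leftarrow>hits (snd cw) p0. if snd (snd t) = ?p1 \<and> length (fst (snd t)) < length (snd cw) then (if mset (fst (snd t)) = M' then fst cw * fst t else 0) else 0) =
       fst cw * (\<Sum>t\<leftarrow>hits (snd cw) p0. if Suc (length (fst (snd t))) = length (snd cw) \<and> snd (snd t) = act x p0 \<and> mset (fst (snd t)) = M' then fst t else 0)"
      unfolding sum_list_const_mult[symmetric]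
      using len M' by (intro arg_cong[where f = sum_list] map_cong refl) auto
    also have "\<dots> = (if mset (snd cw) = M then fst cw else 0) * (cf x p0 * of_nat (count M x))"
      unfolding sum_hits_single M by auto
    finally show "(\<Sum>t\<leftarrow>hits (snd cw) p0. if snd (snd t) = ?p1 \<and> length (fst (snd t)) < length (snd cw) then (if mset (fst (snd t)) = M' then fst cw * fst t else 0) else 0) = \<dots>" .
  qed
  ultimately have "(\<Sum>(c0, w)\<leftarrow>Q. if mset w = M then c0 else 0) * (cf x p0 * of_nat (count M x)) = 0"
    by (simp add: case_prod_unfold sum_list_mult_const)
  moreover have "count M x \<noteq> 0" by (simp add: M)
  ultimately show ?case using cf_p0_neq_0[of x] by auto
qed


section \<open>The filtered algebra \<open>Y2_plus\<close>, injectivity, and the isomorphism\<close>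

section \<open>The filtration of the presented algebra\<close>

lemma Y2_plus_relations:
  fixes k E F :: Y2_plus
  defines "k \<equiv> pgen Gk" and "E \<equiv> pgen GE" and "F \<equiv> pgen GF"
  shows "comm k E = 2 *\<^sub>C E" "comm k F = (- 2) *\<^sub>C F"
    "comm E (comm E (comm F E)) = 12 *\<^sub>C (E * k * E)" "comm F (comm F (comm F E)) = 12 *\<^sub>C (F * k * F)"
proof -
  note h = algebra_homD[OF algebra_hom_abs_presented[where ?'a = ygen]] algebra_hom_comm[OF algebra_hom_abs_presented[where ?'a = ygen]]
  have num: "abs_presented (numeral n :: ygen free_algebra) = numeral n" for n
    using algebra_hom_of_nat[OF algebra_hom_abs_presented, of "numeral n"] by simp
  have r: "abs_presented r = 0" if "r \<in> relators" for r :: "ygen free_algebra"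
    by (rule abs_presented_relator[OF that])
  have "abs_presented (comm (gen Gk) (gen GE) - 2 * gen GE) = 0"
    "abs_presented (comm (gen Gk) (gen GF) - (- 2 * gen GF)) = 0"
    "abs_presented (comm (gen GE) (comm (gen GE) (comm (gen GF) (gen GE))) - 12 * (gen GE * gen Gk * gen GE)) = 0"
    "abs_presented (comm (gen GF) (comm (gen GF) (comm (gen GF) (gen GE))) - 12 * (gen GF * gen Gk * gen GF)) = 0"
    by (rule r; simp add: relators_ygen_def Let_def)+
  then show "comm k E = 2 *\<^sub>C E" "comm k F = (- 2) *\<^sub>C F"
    "comm E (comm E (comm F E)) = 12 *\<^sub>C (E * k * E)" "comm F (comm F (comm F E)) = 12 *\<^sub>C (F * k * F)"
    unfolding h minus_mult_left[symmetric] num k_def E_def F_def pgen_def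
    by (simp_all add: scaleC_numeral eq_neg_iff_add_eq_0)
qed

definition letter_deg :: "ygen list \<Rightarrow> nat" where
  "letter_deg ws = length (filter (\<lambda>g. g \<noteq> Gk) ws)"

definition filt :: "nat \<Rightarrow> Y2_plus set" where
  "filt n = cvs.span {prod_list (map pgen ws) | ws. letter_deg ws < n}"

lemma filt_word: "letter_deg ws < n \<Longrightarrow> prod_list (map pgen ws) \<in> filt n"
  unfolding filt_def by (rule cvs.span_base) blast

lemma filt_subspace: "cvs.subspace (filt n)"
  by (simp add: filt_def cvs.subspace_span)

lemma filt_mult:
  assumes "x \<in> filt m" "y \<in> filt n" "\<And>i j. i < m \<Longrightarrow> j < n \<Longrightarrow> i + j < d"
  shows "x * y \<in> filt d"
proof (rule span_mult[OF assms(1,2)[unfolded filt_def] filt_subspace])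
  fix a b assume "a \<in> {prod_list (map pgen ws) | ws. letter_deg ws < m}" "b \<in> {prod_list (map pgen ws) | ws. letter_deg ws < n}"
  then obtain v w where "a = prod_list (map pgen v)" "b = prod_list (map pgen w)" "letter_deg v < m" "letter_deg w < n" by blast
  then show "a * b \<in> filt d"
    using filt_word[of "v @ w" d] assms(3)[of "letter_deg v" "letter_deg w"] by (simp add: letter_deg_def)
qed

lemma filt_mono: "m \<le> n \<Longrightarrow> filt m \<subseteq> filt n"
  unfolding filt_def by (rule cvs.span_mono) auto

interpretation F: filtered_serre filt "pgen Gk" "pgen GE" "pgen GF"
proof
  show "x * y \<in> filt (m + n)" if "x \<in> filt (Suc m)" "y \<in> filt n" for x y m n
    by (rule filt_mult[OF that]) simp
  show "x * y \<in> filt (m + n)" if "x \<in> filt m" "y \<in> filt (Suc n)" for x y m n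
    by (rule filt_mult[OF that]) simp
  show "pgen Gk \<in> filt 1" "pgen GE \<in> filt 2" "pgen GF \<in> filt 2"
    using filt_word[of "[Gk]" 1] filt_word[of "[GE]" 2] filt_word[of "[GF]" 2] by (simp_all add: letter_deg_def)
  \<comment> \<open>By the defining relations these are multiples of E k E and F k F, of degree 2
    and not 4.\<close>
  show "comm (pgen GE) (comm (pgen GE) (comm (pgen GF) (pgen GE))) \<in> filt 4"
    "comm (pgen GF) (comm (pgen GF) (comm (pgen GF) (pgen GE))) \<in> filt 4"
    unfolding Y2_plus_relations
    using filt_word[of "[GE, Gk, GE]" 4] filt_word[of "[GF, Gk, GF]" 4]
    by (auto intro!: cvs.subspace_scale[OF filt_subspace] simp: letter_deg_def mult.assoc)
qed (simp_all add: filt_subspace filt_mono Y2_plus_relations)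

interpretation F: filtered_serre_words filt "pgen Gk" "pgen GE" "pgen GF"
proof
  show "1 \<in> filt 1" using filt_word[of "[]" 1] by (simp add: letter_deg_def)
  show "filt n \<subseteq> cvs.span {F.W w | w. wtl w < n}" for n
    unfolding filt_def
  proof (rule cvs.span_mono, safe)
    fix ws assume ws: "letter_deg ws < n"
    \<comment> \<open>The generators are the letters of index 0, with weight equal to
      degree.\<close>
    have "F.W (map (\<lambda>g. (g, 0)) ws) = prod_list (map pgen ws)"
    proof (induction ws)
      case (Cons g ws)
      then show ?case by (cases g) (simp_all add: F.h_simps)
    qed simp
    moreover have "wtl (map (\<lambda>g. (g, 0)) ws) = letter_deg ws"
    proof (induction ws)
      case (Cons g ws)
      then show ?case by (cases g) (simp_all add: letter_deg_def)
    qed (simp add: letter_deg_def)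
    ultimately show "\<exists>w. prod_list (map pgen ws) = F.W w \<and> wtl w < n" using ws by metis
  qed
qed

lemma filt_exhaustive: "\<exists>n. y \<in> filt n"
proof -
  have "subalgebra {y. \<exists>n. y \<in> filt n}"
    unfolding subalgebra_def
  proof (safe; (elim exE)?)
    show "\<exists>n. 1 \<in> filt n" using F.one_V by blast
  next
    fix x y m n assume x: "x \<in> filt m" and y: "y \<in> filt n"
    have "x \<in> filt (m + n)" "y \<in> filt (m + n)" using x y filt_mono[of m "m + n"] filt_mono[of n "m + n"] by auto
    then show "\<exists>n. x + y \<in> filt n" using cvs.subspace_add[OF filt_subspace] by blast
    have "x * y \<in> filt (m + n)" by (rule filt_mult[OF x y]) simp
    then show "\<exists>n. x * y \<in> filt n" by blast
  next
    fix x c n assume "x \<in> filt n"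
    then show "\<exists>n. c *\<^sub>C x \<in> filt n" using cvs.subspace_scale[OF filt_subspace] by blast
  qed
  moreover have "\<exists>n. pgen g \<in> filt n" for g
    using F.k_V F.E_V F.F_V by (cases g) blast+
  ultimately have "subalgebra hull (range pgen) \<subseteq> {y. \<exists>n. y \<in> filt n}"
    by (intro hull_minimal) auto
  then show ?thesis using presented_generated by blast
qed

lemma span_words:
  assumes "y \<in> cvs.span {F.W w | w. P w}"
  shows "\<exists>S r. finite S \<and> (\<forall>w\<in>S. P w) \<and> y = (\<Sum>w\<in>S. r w *\<^sub>C F.W w)"
proof -
  from assms obtain t r where t: "finite t" "t \<subseteq> F.W ` {w. P w}" and y: "y = (\<Sum>a\<in>t. r a *\<^sub>C a)"
    unfolding cvs.span_explicit by (auto simp: setcompr_eq_image)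
  from t(2) obtain S where S: "S \<subseteq> {w. P w}" "inj_on F.W S" "t = F.W ` S"
    by (meson subset_image_inj)
  then have "finite S" using t(1) by (simp add: finite_image_iff)
  moreover have "y = (\<Sum>w\<in>S. r (F.W w) *\<^sub>C F.W w)"
    unfolding y S(3) by (simp add: sum.reindex[OF S(2)])
  ultimately show ?thesis using S(1) by (intro exI[of _ S] exI[of _ "r \<circ> F.W"]) auto
qed


section \<open>Injectivity\<close>

lemma lead_sum_words:
  assumes "finite S" "\<And>w. w \<in> S \<Longrightarrow> wtl w \<le> d" "\<And>w. w \<in> S \<Longrightarrow> lead (wtl w) (x w) (Z w)"
  shows "lead d (\<Sum>w\<in>S. r w *\<^sub>C x w) (\<Sum>w\<in>S. if wtl w = d then r w *\<^sub>C Z w else 0)"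
  using assms
proof (induction S rule: finite_induct)
  case (insert w S)
  have "lead d (r w *\<^sub>C x w) (if wtl w = d then r w *\<^sub>C Z w else 0)"
    using lead_scaleC[OF insert.prems(2)[of w], of "r w"] lead_less[of "wtl w" "r w *\<^sub>C x w" "r w *\<^sub>C Z w" d]
      insert.prems(1)[of w] by auto
  moreover have "lead d (\<Sum>w\<in>S. r w *\<^sub>C x w) (\<Sum>w\<in>S. if wtl w = d then r w *\<^sub>C Z w else 0)"
    using insert.prems by (intro insert.IH) auto
  ultimately show ?case unfolding sum.insert[OF insert.hyps] by (rule lead_add)
qed (simp add: lead_zero)

context
  fixes \<Phi> :: "Y2_plus \<Rightarrow> Y_sp2"
  assumes \<Phi>: "algebra_hom \<Phi>"
    and \<Phi>_k: "\<Phi> (pgen Gk) = (- 1 / 2) *\<^sub>C Y.A 1" and \<Phi>_E: "\<Phi> (pgen GE) = (1 / 8) *\<^sub>C Y.C 2"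
    and \<Phi>_F: "\<Phi> (pgen GF) = (- 1 / 8) *\<^sub>C Y.B 2"
begin

text \<open>
  An element of the kernel has vanishing leading term in every multi-site representation, so by
  independence of the ordered monomials its top-degree part can be shortened.
\<close>

lemma kernel_descent:
  assumes y: "y \<in> F.U d (Suc p)" and ker: "\<Phi> y = 0"
  shows "y \<in> F.U d p"
proof -
  from y obtain S r where S: "finite S" "\<And>w. w \<in> S \<Longrightarrow> wtl w < d \<or> wtl w = d \<and> length w < Suc p"
    and y_eq: "y = (\<Sum>w\<in>S. r w *\<^sub>C F.W w)"
    unfolding F.U_def using span_words[of y "\<lambda>w. wtl w < d \<or> wtl w = d \<and> length w < Suc p"] by blast
  define R where "R = {w \<in> S. wtl w = d}"
  obtain ws where ws: "set ws = R" "distinct ws"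
    using S(1) finite_distinct_list[of R] by (auto simp: R_def)
  \<comment> \<open>The coefficient at pole order d of the image of y, which is 0; words of weight
    below d do not reach that order.\<close>
  have vanish: "(\<Sum>w\<in>R. r w *\<^sub>C Wn n w) = 0" for n
  proof -
    obtain \<rho> :: "Y_sp2 \<Rightarrow> state endo fls" where \<rho>: "algebra_hom \<rho>"
      and l: "lead 0 (\<rho> ((- 1 / 2) *\<^sub>C Y.A 1)) (XX n Gk 0)" "lead 1 (\<rho> ((1 / 8) *\<^sub>C Y.C 2)) (XX n GE 1)"
        "lead 1 (\<rho> ((- 1 / 8) *\<^sub>C Y.B 2)) (XX n GF 1)"
      using rep_exists[of n] by blast
    have c: "algebra_hom (\<rho> \<circ> \<Phi>)" by (rule algebra_hom_compose[OF \<Phi> \<rho>])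
    have W: "lead (wtl w) ((\<rho> \<circ> \<Phi>) (F.W w)) (Wn n w)" for w
      by (rule F.lead_W[OF c]) (simp_all only: o_apply \<Phi>_k \<Phi>_E \<Phi>_F l)
    have "lead d (\<Sum>w\<in>S. r w *\<^sub>C (\<rho> \<circ> \<Phi>) (F.W w)) (\<Sum>w\<in>S. if wtl w = d then r w *\<^sub>C Wn n w else 0)"
      by (rule lead_sum_words[OF S(1) _ W]) (use S(2) in fastforce)
    moreover have "(\<Sum>w\<in>S. r w *\<^sub>C (\<rho> \<circ> \<Phi>) (F.W w)) = (\<rho> \<circ> \<Phi>) y"
      unfolding y_eq by (simp only: algebra_hom_sum[OF c] algebra_homD(4)[OF c])
    moreover have "(\<rho> \<circ> \<Phi>) y = 0" using ker by (simp add: algebra_homD(5)[OF \<rho>])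
    ultimately have "lead d 0 (\<Sum>w\<in>S. if wtl w = d then r w *\<^sub>C Wn n w else 0)"
      by (simp only:)
    then have "(\<Sum>w\<in>S. if wtl w = d then r w *\<^sub>C Wn n w else 0) = 0"
      by (rule lead_unique[OF _ lead_zero])
    then show ?thesis unfolding R_def using S(1) by (simp add: sum.inter_filter)
  qed
  \<comment> \<open>Words in R have length at most p, so size p is the top layer treated by
    \<open>words_independent\<close>.\<close>
  have coeffs: "(\<Sum>w\<in>{w \<in> R. mset w = M}. r w) = 0" if "size M = p" for M
  proof -
    have "(\<Sum>(c, w)\<leftarrow>map (\<lambda>w. (r w, w)) ws. if mset w = M then c else 0) = 0"
    proof (rule words_independent[OF _ _ that])
      show "length w \<le> p" if "(c, w) \<in> set (map (\<lambda>w. (r w, w)) ws)" for c w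
        using that S(2)[of w] ws(1) by (auto simp: R_def)
      show "(\<Sum>(c, w)\<leftarrow>map (\<lambda>w. (r w, w)) ws. c * app (Wn n w) \<phi> b) = 0" for n \<phi> b
        using arg_cong[OF vanish[of n], of "\<lambda>x. app x \<phi> b"] ws
        by (simp add: o_def sum_list_distinct_conv_sum_set)
    qed
    then have "(\<Sum>w\<in>R. if mset w = M then r w else 0) = 0"
      using ws by (simp add: o_def sum_list_distinct_conv_sum_set)
    moreover have "finite R" using S(1) by (simp add: R_def)
    ultimately show ?thesis by (simp only: sum.inter_filter)
  qed
  define T where "T = {w \<in> R. length w = p}"
  \<comment> \<open>One word for each multiset. Replacing a top word by its canonical reordering
    costs only lower terms, and the canonical words cancel because the coefficients belonging to
    each multiset sum to 0.\<close>
  define canon where "canon M = F.W (SOME w. mset w = M)" for M :: "(ygen \<times> nat) multiset"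
  have T: "finite T" "T \<subseteq> S" using S(1) by (auto simp: T_def R_def)
  have "(\<Sum>w\<in>T. r w *\<^sub>C canon (mset w)) = (\<Sum>M\<in>mset ` T. \<Sum>w\<in>{w \<in> T. mset w = M}. r w *\<^sub>C canon (mset w))"
    by (rule sum.image_gen[OF T(1)])
  also have "\<dots> = (\<Sum>M\<in>mset ` T. (\<Sum>w\<in>{w \<in> R. mset w = M}. r w) *\<^sub>C canon M)"
  proof (intro sum.cong refl)
    fix M assume "M \<in> mset ` T"
    then have "size M = p" by (auto simp: T_def)
    then have "{w \<in> T. mset w = M} = {w \<in> R. mset w = M}" by (auto simp: T_def)
    then show "(\<Sum>w\<in>{w \<in> T. mset w = M}. r w *\<^sub>C canon (mset w)) = (\<Sum>w\<in>{w \<in> R. mset w = M}. r w) *\<^sub>C canon M"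
      by (simp add: cvs.scale_sum_left)
  qed
  also have "\<dots> = 0"
    by (intro sum.neutral ballI) (auto simp: T_def coeffs)
  finally have zero: "(\<Sum>w\<in>T. r w *\<^sub>C canon (mset w)) = 0" .
  have "y = (\<Sum>w\<in>S - T. r w *\<^sub>C F.W w) + (\<Sum>w\<in>T. r w *\<^sub>C F.W w)"
    unfolding y_eq using sum.subset_diff[OF T(2) S(1)] .
  also have "(\<Sum>w\<in>T. r w *\<^sub>C F.W w) = (\<Sum>w\<in>T. r w *\<^sub>C (F.W w - canon (mset w)))"
    using zero by (simp add: cvs.scale_right_diff_distrib sum_subtractf)
  also have "(\<Sum>w\<in>S - T. r w *\<^sub>C F.W w) + (\<Sum>w\<in>T. r w *\<^sub>C (F.W w - canon (mset w))) \<in> F.U d p"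
  proof (intro cvs.subspace_add[OF F.U_subspace] cvs.subspace_sum[OF F.U_subspace] cvs.subspace_scale[OF F.U_subspace])
    show "F.W w \<in> F.U d p" if "w \<in> S - T" for w
      using that S(2)[of w] by (intro F.W_U) (auto simp: T_def R_def)
    show "F.W w - canon (mset w) \<in> F.U d p" if "w \<in> T" for w
    proof -
      have "mset (SOME w'. mset w' = mset w) = mset w" by (rule someI[of _ w]) simp
      then show ?thesis
        using F.W_mset_cong[of w "SOME w'. mset w' = mset w"] that by (simp add: T_def R_def canon_def)
    qed
  qed
  finally show ?thesis .
qed

text \<open>A double descent: \<open>kernel_descent\<close> lowers the length bound to 0, which
  leaves only words of weight below d; then d itself decreases to 0, where no words are
  left.\<close>

lemma kernel_trivial:
  assumes "\<Phi> y = 0"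
  shows "y = 0"
proof -
  have down: "y \<in> F.U d p \<Longrightarrow> y \<in> F.U d 0" for d p
    by (induction p) (use kernel_descent[OF _ assms] in auto)
  have "y \<in> F.U d 0 \<Longrightarrow> y = 0" for d
  proof (induction d)
    case 0
    then show ?case by (simp add: F.U_def)
  next
    case (Suc d)
    then obtain S r where S: "finite S" "\<forall>w\<in>S. wtl w < Suc d" and y: "y = (\<Sum>w\<in>S. r w *\<^sub>C F.W w)"
      using span_words[of y "\<lambda>w. wtl w < Suc d"] by (auto simp: F.U_def)
    define p where "p = Suc (Max (length ` S))"
    have "length w < p" if "w \<in> S" for w
      using that S(1) by (simp add: p_def less_Suc_eq_le)
    then have "y \<in> F.U d p"
      unfolding y using S(2)
      by (intro cvs.subspace_sum[OF F.U_subspace] cvs.subspace_scale[OF F.U_subspace] F.W_U) (auto simp: less_Suc_eq)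
    then show ?case using down Suc.IH by blast
  qed
  moreover obtain d where "y \<in> filt d" using filt_exhaustive by blast
  then have "y \<in> F.U d 0" using F.V_subset_U by blast
  ultimately show ?thesis by blast
qed

text \<open>Surjectivity: the generators go to nonzero multiples of A_1, B_2 and C_2, and these
  generate \<open>Y_tw\<close>.\<close>

lemma iso: "algebra_iso_onto Y_tw \<Phi>"
proof -
  have "inj \<Phi>"
  proof (rule injI)
    fix x y assume "\<Phi> x = \<Phi> y"
    then show "x = y" using kernel_trivial[of "x - y"] by (simp add: algebra_homD[OF \<Phi>])
  qed
  moreover have "range \<Phi> = Y_tw"
  proof
    have "subalgebra (\<Phi> -` Y_tw)"
      unfolding Y_tw_eq by (intro subalgebra_vimage[OF \<Phi>] subalgebra_hull)
    moreover have "Y.A 1 \<in> Y_tw" "Y.B 2 \<in> Y_tw" "Y.C 2 \<in> Y_tw"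
      unfolding Y_tw_eq by (simp_all add: hull_inc)
    then have "\<Phi> (pgen g) \<in> Y_tw" for g
      using subalgebraD(4)[OF subalgebra_hull] unfolding Y_tw_eq by (cases g) (simp_all only: \<Phi>_k \<Phi>_E \<Phi>_F)
    ultimately have "subalgebra hull (range pgen) \<subseteq> \<Phi> -` Y_tw"
      by (intro hull_minimal) auto
    then show "range \<Phi> \<subseteq> Y_tw" using presented_generated by blast
    have scale: "x \<in> range \<Phi>" if "c *\<^sub>C x \<in> range \<Phi>" "c \<noteq> 0" for c x
      using subalgebraD(4)[OF subalgebra_range[OF \<Phi>] that(1), of "1 / c"] that(2) by (simp add: scaleC_scaleC scaleC_one)
    have "Y.A 1 \<in> range \<Phi>" "Y.B 2 \<in> range \<Phi>" "Y.C 2 \<in> range \<Phi>"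
      using scale[of "- 1 / 2" "Y.A 1"] scale[of "- 1 / 8" "Y.B 2"] scale[of "1 / 8" "Y.C 2"]
        rangeI[of \<Phi> "pgen Gk"] rangeI[of \<Phi> "pgen GE"] rangeI[of \<Phi> "pgen GF"]
      unfolding \<Phi>_k \<Phi>_E \<Phi>_F by simp_all
    then show "Y_tw \<subseteq> range \<Phi>"
      unfolding Y_tw_eq by (intro hull_minimal subalgebra_range[OF \<Phi>]) auto
  qed
  ultimately show ?thesis using \<Phi> by (simp add: algebra_iso_onto_def bij_betw_def)
qed

end

theorem proposition5p6:
  shows "\<exists>!\<Phi> :: Y2_plus \<Rightarrow> Y_sp2.
    algebra_iso_onto Y_tw \<Phi> \<and>
    \<Phi> (pgen Gk) = (- 1 / 2) *\<^sub>C k_coeff 0 \<and>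
    \<Phi> (pgen GF) = (- 1 / 8) *\<^sub>C e_coeff 1 \<and>
    \<Phi> (pgen GE) = (1 / 8) *\<^sub>C f_coeff 1"
proof -
  define g where "g x = (case x of Gk \<Rightarrow> (- 1 / 2) *\<^sub>C Y.A 1 | GE \<Rightarrow> (1 / 8) *\<^sub>C Y.C 2 | GF \<Rightarrow> (- 1 / 8) *\<^sub>C Y.B 2)" for x
  have g: "g Gk = (- 1 / 2) *\<^sub>C Y.A 1" "g GE = (1 / 8) *\<^sub>C Y.C 2" "g GF = (- 1 / 8) *\<^sub>C Y.B 2"
    by (simp_all only: g_def ygen.case)
  obtain \<Phi> :: "Y2_plus \<Rightarrow> Y_sp2" where \<Phi>: "algebra_hom \<Phi>" "\<And>x. \<Phi> (pgen x) = g x"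
    using presented_hom_exists[OF relations_hold[OF g]] by blast
  show ?thesis
    unfolding gauss_coeffs
  proof (rule ex1I[of _ \<Phi>])
    show "algebra_iso_onto Y_tw \<Phi> \<and> \<Phi> (pgen Gk) = (- 1 / 2) *\<^sub>C Y.A 1 \<and>
        \<Phi> (pgen GF) = (- 1 / 8) *\<^sub>C Y.B 2 \<and> \<Phi> (pgen GE) = (1 / 8) *\<^sub>C Y.C 2"
      using iso[OF \<Phi>(1)] by (simp only: \<Phi>(2) g simp_thms)
  next
    fix \<Psi> :: "Y2_plus \<Rightarrow> Y_sp2"
    assume \<Psi>: "algebra_iso_onto Y_tw \<Psi> \<and> \<Psi> (pgen Gk) = (- 1 / 2) *\<^sub>C Y.A 1 \<and>
        \<Psi> (pgen GF) = (- 1 / 8) *\<^sub>C Y.B 2 \<and> \<Psi> (pgen GE) = (1 / 8) *\<^sub>C Y.C 2"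
    show "\<Psi> = \<Phi>"
    proof (rule presented_hom_unique)
      show "algebra_hom \<Psi>" using \<Psi> by (simp add: algebra_iso_onto_def)
      show "\<Psi> (pgen x) = \<Phi> (pgen x)" for x
        using \<Psi> by (cases x) (simp_all only: \<Phi>(2) g)
    qed (rule \<Phi>(1))
  qed
qed

end
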